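(* Let $d\ge1$, $\mu\in\mathbb{R}^d$, $A$ a $d\times d$ symmetric positive definite matrix, and $R$ a $d\times d$ reflection nonsingular $\mathcal{M}$-matrix satisfying Assumption (C), with $\overline{R}=RC$ and $\Omega=\overline{R}^{-1}$. Let $c_+$ and $c_-$ be the maximum and minimum of $x'\Omega A\Omega x/x'\Omega x$ over $x\in\mathbb{R}^d_+\setminus\{0\}$. (i) If $\mathrm{tr}(\Omega A)\ge 2c_+$, then $\mathrm{SRBM}^d(R,\mu,A)$ does not hit the corner. (ii) If $0\le\mathrm{tr}(\Omega A)<2c_-$, then $\mathrm{SRBM}^d(R,\mu,A)$ hits the corner.
   Context: Let $S=\mathbb{R}^d_+$, $S_i=\{x\in S: x_i=0\}$, and for $I\subseteq\{1,\dots,d\}$, $S_I=\{x\in S: x_i=0 \ \forall i\in I\}$. A $d\times d$ matrix $R=(r_{ij})$ is a reflection nonsingular $\mathcal{M}$-matrix if $r_{ii}=1$, $r_{ij}\le 0$ for $i\ne j$, and the spectral radius of $I_d-R$ is less than $1$; it satisfies Assumption (C) if there is a diagonal $C=\mathrm{diag}(c_1,\dots,c_d)$, $c_i>0$, with $RC$ symmetric. $\mathrm{SRBM}^d(R,\mu,A)$ started at $z\in S$: a continuous adapted $S$-valued process $Z$ with $Z(t)=B(t)+RL(t)$, where $B$ is a Brownian motion in $\mathbb{R}^d$ with drift $\mu$, covariance matrix $A$, $B(0)=z$, and $L=(L_1,\dots,L_d)'$ is continuous adapted with each $L_k$ nondecreasing, $L_k(0)=0$, $\int_0^\infty Z_k(t)\,dL_k(t)=0$.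 For reflection nonsingular $\mathcal{M}$-matrices $R$ it exists and is pathwise unique for every $z$; write $\mathbb{P}_z$ for its law. The SRBM does not hit $S_I$ (avoids $S_I$) if $\mathbb{P}_z(\exists t>0: Z(t)\in S_I)=0$ for every $z\in S$, and hits $S_I$ if this probability is positive for every $z\in S$. Hitting the corner means hitting $S_{\{1,\dots,d\}}=\{0\}$. *)

theory Defs
  imports "HOL-Probability.Probability"
begin

definition diag_mat :: "real^'n \<Rightarrow> real^'n^'n" where
  "diag_mat c = (\<chi> i j. if i = j then c $ i else 0)"

definition cmat :: "real^'n^'n \<Rightarrow> complex^'n^'n" where
  "cmat M = (\<chi> i j. complex_of_real (M $ i $ j))"

definition spectral_radius :: "real^'n^'n \<Rightarrow> real" where
  "spectral_radius M =
     Max {cmod l | l. \<exists>v. v \<noteq> 0 \<and> cmat M *v v = l *s v}"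

definition refl_nonsing_M_matrix :: "real^'n^'n \<Rightarrow> bool" where
  "refl_nonsing_M_matrix R \<longleftrightarrow>
     (\<forall>i. R $ i $ i = 1) \<and> (\<forall>i j. i \<noteq> j \<longrightarrow> R $ i $ j \<le> 0) \<and>
     spectral_radius (mat 1 - R) < 1"

definition sym_pos_def :: "real^'n^'n \<Rightarrow> bool" where
  "sym_pos_def A \<longleftrightarrow> transpose A = A \<and> (\<forall>x. x \<noteq> 0 \<longrightarrow> x \<bullet> (A *v x) > 0)"

definition orthant :: "(real^'n) set" where
  "orthant = {x. \<forall>i. 0 \<le> x $ i}"

definition face :: "'n set \<Rightarrow> (real^'n) set" where
  "face I = {x \<in> orthant. \<forall>i\<in>I. x $ i = 0}"

definition rq_set :: "real^'n^'n \<Rightarrow> real^'n^'n \<Rightarrow> real set" where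
  "rq_set Om A = {(x \<bullet> ((Om ** A ** Om) *v x)) / (x \<bullet> (Om *v x)) | x. x \<in> orthant \<and> x \<noteq> 0}"

definition c_plus :: "real^'n^'n \<Rightarrow> real^'n^'n \<Rightarrow> real" where
  "c_plus Om A = Sup (rq_set Om A)"

definition c_minus :: "real^'n^'n \<Rightarrow> real^'n^'n \<Rightarrow> real" where
  "c_minus Om A = Inf (rq_set Om A)"

definition filtered_prob_space :: "'a measure \<Rightarrow> (real \<Rightarrow> 'a measure) \<Rightarrow> bool" where
  "filtered_prob_space M F \<longleftrightarrow> prob_space M \<and> filtration (space M) F \<and>
     (\<forall>t. sets (F t) \<subseteq> sets M)"

definition adapted_cont :: "(real \<Rightarrow> 'a measure) \<Rightarrow> 'a set \<Rightarrow> (real \<Rightarrow> 'a \<Rightarrow> real^'n) \<Rightarrow> bool" where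
  "adapted_cont F \<Omega> X \<longleftrightarrow> (\<forall>t\<ge>0. X t \<in> borel_measurable (F t)) \<and>
     (\<forall>\<omega>\<in>\<Omega>. continuous_on {0..} (\<lambda>t. X t \<omega>))"

text \<open>(F_t)-Brownian motion with drift mu, covariance A, started at z: continuous, adapted,
  B(0)=z, and for 0<=s<t the increment B(t)-B(s) is independent of F_s and Gaussian with
  mean (t-s)mu and covariance (t-s)A (every nonzero linear functional of it is normal).\<close>
definition brownian_motion ::
  "'a measure \<Rightarrow> (real \<Rightarrow> 'a measure) \<Rightarrow> real^'n \<Rightarrow> real^'n^'n \<Rightarrow> real^'n
    \<Rightarrow> (real \<Rightarrow> 'a \<Rightarrow> real^'n) \<Rightarrow> bool" where
  "brownian_motion M F mu A z B \<longleftrightarrow>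
     adapted_cont F (space M) B \<and>
     (\<forall>\<omega>\<in>space M. B 0 \<omega> = z) \<and>
     (\<forall>s t. 0 \<le> s \<and> s < t \<longrightarrow>
        (\<forall>u. u \<noteq> 0 \<longrightarrow>
           distributed M lborel (\<lambda>\<omega>. u \<bullet> (B t \<omega> - B s \<omega>))
             (normal_density ((t - s) * (u \<bullet> mu)) (sqrt ((t - s) * (u \<bullet> (A *v u)))))) \<and>
        (\<forall>E\<in>sets (F s). \<forall>Y\<in>sets borel.
           measure M (E \<inter> {\<omega>\<in>space M. B t \<omega> - B s \<omega> \<in> Y}) =
           measure M E * measure M {\<omega>\<in>space M. B t \<omega> - B s \<omega> \<in> Y}))"

text \<open>Z is an SRBM^d(R,mu,A) started at z on the filtered probability space (M,F).
  The complementarity condition int_0^oo Z_k dL_k = 0 uses the Lebesgue-Stieltjes measure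
  of L_k (extended by 0 to negative times).\<close>
definition is_SRBM ::
  "'a measure \<Rightarrow> (real \<Rightarrow> 'a measure) \<Rightarrow> real^'n^'n \<Rightarrow> real^'n \<Rightarrow> real^'n^'n \<Rightarrow> real^'n
    \<Rightarrow> (real \<Rightarrow> 'a \<Rightarrow> real^'n) \<Rightarrow> bool" where
  "is_SRBM M F R mu A z Z \<longleftrightarrow>
     filtered_prob_space M F \<and> adapted_cont F (space M) Z \<and>
     (\<forall>t\<ge>0. \<forall>\<omega>\<in>space M. Z t \<omega> \<in> orthant) \<and>
     (\<exists>B L. brownian_motion M F mu A z B \<and> adapted_cont F (space M) L \<and>
        (\<forall>t\<ge>0. \<forall>\<omega>\<in>space M. Z t \<omega> = B t \<omega> + R *v L t \<omega>) \<and>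
        (\<forall>\<omega>\<in>space M. \<forall>k.
           L 0 \<omega> $ k = 0 \<and>
           (\<forall>s t. 0 \<le> s \<and> s \<le> t \<longrightarrow> L s \<omega> $ k \<le> L t \<omega> $ k) \<and>
           (\<integral>\<^sup>+ t. ennreal (indicator {0..} t * Z t \<omega> $ k)
              \<partial>interval_measure (\<lambda>t. L (max t 0) \<omega> $ k)) = 0))"

text \<open>Not hitting / hitting a set G (Z avoids G a.s. / hits G with positive probability, for
  every start point and every realisation of the SRBM; the event is handled via AE, so no
  measurability side condition is needed).\<close>
definition SRBM_avoids :: "'a itself \<Rightarrow> real^'n^'n \<Rightarrow> real^'n \<Rightarrow> real^'n^'n \<Rightarrow> (real^'n) set \<Rightarrow> bool" where
  "SRBM_avoids _ R mu A G \<longleftrightarrow>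
     (\<forall>z\<in>orthant. \<forall>(M::'a measure) F Z. is_SRBM M F R mu A z Z \<longrightarrow>
        (AE \<omega> in M. \<forall>t>0. Z t \<omega> \<notin> G))"

definition SRBM_hits :: "'a itself \<Rightarrow> real^'n^'n \<Rightarrow> real^'n \<Rightarrow> real^'n^'n \<Rightarrow> (real^'n) set \<Rightarrow> bool" where
  "SRBM_hits _ R mu A G \<longleftrightarrow>
     (\<forall>z\<in>orthant. \<forall>(M::'a measure) F Z. is_SRBM M F R mu A z Z \<longrightarrow>
        \<not> (AE \<omega> in M. \<forall>t>0. Z t \<omega> \<notin> G))"

end

theory Submission
  imports Defs
begin

text \<open>With \<open>\<Omega> = (RC)\<^sup>-\<^sup>1\<close> one has \<open>\<Omega> R = C\<^sup>-\<^sup>1\<close>, so in the expansion of \<open>V(Z) = Z'\<Omega>Z\<close> the boundary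
  term is \<open>2 Z'C\<^sup>-\<^sup>1 dL\<close>, which vanishes by complementarity. Hence \<open>V(Z)\<close> behaves like a squared Bessel process
  with drift \<open>tr(\<Omega>A) + 2 Z'\<Omega>\<mu>\<close> and squared diffusion coefficient \<open>4 Z'\<Omega>A\<Omega>Z\<close>, the latter
  lying between \<open>4 c\<^sub>- V\<close> and \<open>4 c\<^sub>+ V\<close>.
  Stochastic integrals are avoided by working on finite time grids: a Taylor expansion over each step uses only
  Gaussian moments and independence, and the boundary contributions sum to at most the modulus of continuity
  times the total of \<open>L\<close>, so that Dynkin's formula holds up to an error vanishing with the mesh.
  When \<open>tr(\<Omega>A) \<ge> 2 c\<^sub>+\<close>, the function \<open>ln (1 + 1/V) + a exp (-sqrt V)\<close> is unbounded at the origin but has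
  generator bounded above; the second summand compensates the drift \<open>\<mu>\<close>.
  When \<open>tr(\<Omega>A) < 2 c\<^sub>-\<close>, the bounded function \<open>f = exp (-l (V\<^sup>p + sqrt V))\<close> has generator at least
  \<open>l f\<close> away from the origin, so its expectation would grow without bound if the origin were
  almost surely avoided. In both cases \<open>V\<close> is replaced by \<open>V + \<epsilon>\<close> to make the functions smooth.\<close>

section \<open>Linear algebra of the reflection matrix\<close>

text \<open>\<open>2 * Q \<le> tr(Om A) * V\<close> is the analogue of Bessel dimension at least 2,
  with the logarithm harmonic in the borderline case. If instead \<open>Q \<ge> c * V\<close> with
  \<open>2 * c\<close> above the trace, a power \<open>V^p\<close> with small \<open>p\<close> is
  superharmonic near the origin. The drift \<open>mu\<close> enters with order
  \<open>sqrt V\<close>: lower order, but not negligible once the leading terms of the logarithm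
  cancel exactly. Two obstacles shape the argument. A path may start at the origin, where the
  barrier says nothing: avoidance is therefore proved from rational times at which the path is away
  from 0, and a separate estimate forbids resting at 0 initially. For the same reason the hitting
  argument starts its clock at time 1. Secondly, events about whole paths need not be measurable:
  probabilities are assigned only to events on finite grids or at rational times, and stopping is
  expressed by the indicator of an event known at the left end point of each step. Localisation
  bounds the total pushing as well as \<open>Z\<close>, because the pushing is what dominates the
  boundary errors.\<close>

text \<open>\<open>spectral_radius\<close> is a \<open>Max\<close>, which is informative only on a
  finite set. Eigenvalues are roots of the determinant of \<open>M - X\<close>, formed over
  polynomial entries; this polynomial is nonzero because no eigenvalue exceeds \<open>K\<close> in
  modulus.\<close>

lemma finite_eigenvalues:
  fixes M :: "complex^'n^'n"
  shows "finite {l. \<exists>v. v \<noteq> 0 \<and> M *v v = l *s v}"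
proof -
  define P :: "complex poly^'n^'n" where "P = (\<chi> i j. [:M$i$j:] - (if i = j then [:0,1:] else 0))"
  define p where "p = det P"
  have eval: "poly p l = det (\<chi> i j. M$i$j - (if i = j then l else 0))" for l
  proof -
    have "poly (of_int (sign q) * (\<Prod>i\<in>UNIV. P $ i $ q i)) l
        = of_int (sign q) * (\<Prod>i\<in>UNIV. M $ i $ q i - (if i = q i then l else 0))" for q
      by (simp add: poly_prod P_def) (intro disjI2 prod.cong refl, simp)
    then show ?thesis
      by (simp add: p_def det_def poly_sum)
  qed
  have mulv: "((\<chi> i j. M$i$j - (if i = j then l else 0)) *v v) = M *v v - l *s v" for l v
  proof -
    have "(M$i$j - (if i = j then l else 0)) * v$j = M$i$j * v$j - (if i = j then l * v$i else 0)" for i j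
      by (simp add: left_diff_distrib)
    then show ?thesis
      by (simp add: matrix_vector_mult_def vec_eq_iff sum_subtractf)
  qed
  have root: "poly p l = 0" if "v \<noteq> 0" "M *v v = l *s v" for l v
  proof (rule ccontr)
    assume "poly p l \<noteq> 0"
    then have "invertible (\<chi> i j. M$i$j - (if i = j then l else 0))"
      by (simp add: eval invertible_det_nz)
    then show False
      using that mulv[of l v] unfolding invertible_left_inverse matrix_left_invertible_ker by auto
  qed
  \<comment> \<open>A crude bound read off at a coordinate of maximal modulus. Its only purpose is
    to exhibit \<open>K + 1\<close> as a non-root.\<close>
  define K where "K = (\<Sum>i\<in>UNIV. \<Sum>j\<in>UNIV. cmod (M$i$j))"
  have K0: "K \<ge> 0" by (simp add: K_def sum_nonneg)
  have bound: "cmod l \<le> K" if v: "v \<noteq> 0" "M *v v = l *s v" for l v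
  proof -
    have "Max (range (\<lambda>i. cmod (v$i))) \<in> range (\<lambda>i. cmod (v$i))" by (intro Max_in) auto
    then obtain i where i: "cmod (v$i) = Max (range (\<lambda>i. cmod (v$i)))" by force
    have mx: "cmod (v$j) \<le> cmod (v$i)" for j unfolding i by (intro Max_ge) auto
    have pos: "cmod (v$i) > 0"
    proof (rule ccontr)
      assume "\<not> cmod (v$i) > 0"
      then have "v$j = 0" for j using mx[of j] by auto
      then show False using v by (simp add: vec_eq_iff)
    qed
    have "cmod l * cmod (v$i) = cmod (\<Sum>j\<in>UNIV. M$i$j * v$j)"
      using arg_cong[OF v(2), of "\<lambda>w. w$i"] by (simp add: matrix_vector_mult_def norm_mult)
    also have "\<dots> \<le> (\<Sum>j\<in>UNIV. cmod (M$i$j) * cmod (v$i))"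
      by (rule sum_norm_le) (simp add: norm_mult mult_left_mono mx)
    also have "\<dots> = (\<Sum>j\<in>UNIV. cmod (M$i$j)) * cmod (v$i)" by (simp add: sum_distrib_right)
    also have "\<dots> \<le> K * cmod (v$i)"
      unfolding K_def
      by (intro mult_right_mono member_le_sum[of i UNIV "\<lambda>i. \<Sum>j\<in>UNIV. cmod (M$i$j)"]) (auto simp: sum_nonneg)
    finally show ?thesis using pos by simp
  qed
  have "p \<noteq> 0"
  proof
    assume "p = 0"
    then have "\<not> invertible (\<chi> i j. M$i$j - (if i = j then of_real (K+1) else 0))"
      using eval[of "of_real (K+1)"] by (simp add: invertible_det_nz)
    then obtain v where "v \<noteq> 0" "M *v v = of_real (K+1) *s v"
      unfolding invertible_left_inverse matrix_left_invertible_ker mulv by auto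
    from bound[OF this] K0 show False by (simp del: of_real_add)
  qed
  then have "finite {l. poly p l = 0}" by (rule poly_roots_finite)
  then show ?thesis by (rule rev_finite_subset) (use root in auto)
qed

text \<open>A real eigenpair is also a complex one; finiteness of the set of moduli then lets
  \<open>Max\<close> bound each member.\<close>

lemma abs_eigenvalue_le_spectral_radius:
  fixes M :: "real^'n^'n"
  assumes "x \<noteq> 0" "M *v x = l *s x"
  shows "\<bar>l\<bar> \<le> spectral_radius M"
proof -
  define y :: "complex^'n" where "y = (\<chi> i. of_real (x$i))"
  have y: "y \<noteq> 0" using assms(1) by (auto simp: y_def vec_eq_iff)
  have eq: "(\<Sum>j\<in>UNIV. M$i$j * x$j) = l * x$i" for i
    using arg_cong[OF assms(2), of "\<lambda>w. w$i"] by (simp add: matrix_vector_mult_def)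
  have "cmat M *v y = of_real l *s y"
    by (simp add: vec_eq_iff matrix_vector_mult_def cmat_def y_def eq flip: of_real_mult of_real_sum)
  with y have "\<bar>l\<bar> \<in> {cmod l | l. \<exists>v. v \<noteq> 0 \<and> cmat M *v v = l *s v}"
    by (intro CollectI exI[of _ "of_real l"]) auto
  moreover have "finite {cmod l | l. \<exists>v. v \<noteq> 0 \<and> cmat M *v v = l *s v}"
    using finite_imageI[OF finite_eigenvalues[of "cmat M"], of cmod]
    by (simp add: setcompr_eq_image)
  ultimately show ?thesis unfolding spectral_radius_def by (intro Max_ge)
qed

lemma inner_matrix_sym:
  fixes M :: "real^'n^'n"
  assumes "transpose M = M"
  shows "x \<bullet> (M *v y) = y \<bullet> (M *v x)"
  by (metis assms dot_lmul_matrix inner_commute matrix_transpose_mul transpose_matrix_vector)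

text \<open>Moving from \<open>x\<close> against \<open>M x\<close> lowers the form to first order
  by twice the squared norm of \<open>M x\<close>, so a zero of a nonnegative form, being a minimum,
  lies in the kernel.\<close>

lemma psd_quadratic_zero:
  fixes M :: "real^'n^'n"
  assumes sym: "transpose M = M" and psd: "\<And>x. x \<bullet> (M *v x) \<ge> 0" and z: "x \<bullet> (M *v x) = 0"
  shows "M *v x = 0"
proof -
  define y where "y = M *v x"
  define K where "K = y \<bullet> (M *v y)"
  have K: "K \<ge> 0" using psd by (simp add: K_def)
  have *: "0 \<le> - 2 * t * (y \<bullet> y) + t\<^sup>2 * K" for t
  proof -
    have "0 \<le> (x - t *\<^sub>R y) \<bullet> (M *v (x - t *\<^sub>R y))" by (rule psd)
    also have "\<dots> = - 2 * t * (y \<bullet> y) + t\<^sup>2 * K"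
      using z inner_matrix_sym[OF sym, of x y]
      by (simp add: K_def y_def[symmetric] algebra_simps inner_diff_left inner_diff_right
          matrix_vector_mult_diff_distrib matrix_vector_mult_scaleR power2_eq_square)
    finally show ?thesis .
  qed
  have "y \<bullet> y = 0"
  proof (rule ccontr)
    assume ne: "y \<bullet> y \<noteq> 0"
    then have pos: "y \<bullet> y > 0" by auto
    \<comment> \<open>Small enough that the quadratic term costs at most half of the linear gain;
      the \<open>+1\<close> covers \<open>K = 0\<close>.\<close>
    define t where "t = (y \<bullet> y) / (K+1)"
    have t: "t > 0" using pos K by (simp add: t_def)
    have "t * K \<le> y \<bullet> y" using K pos by (simp add: t_def field_simps)
    then have "t * (t * K) \<le> t * (y \<bullet> y)" using t by (simp add: mult_left_mono)
    moreover have "t * (y \<bullet> y) > 0" using t pos by simp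
    ultimately show False using *[of t] by (simp add: power2_eq_square mult.assoc)
  qed
  then show ?thesis by (simp add: y_def)
qed

lemma diag_mat_mult_vec: "diag_mat c *v x = (\<chi> i. c$i * x$i)"
  by (simp add: diag_mat_def matrix_vector_mult_def vec_eq_iff if_distrib if_distribR cong: if_cong)

lemma transpose_diag_mat: "transpose (diag_mat c) = diag_mat c"
  by (simp add: diag_mat_def transpose_def vec_eq_iff)

lemma quadratic_form_continuous:
  fixes M :: "real^'n^'n"
  shows "continuous_on S (\<lambda>x. x \<bullet> (M *v x))"
  by (intro continuous_intros matrix_vector_mult_linear_continuous_on)

text \<open>The minimum of the generalised Rayleigh quotient of \<open>RC\<close> against \<open>C\<close> is an eigenvalue of \<open>R\<close>,
  hence positive.\<close>
lemma M_matrix_pos_def: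
  fixes R :: "real^'n^'n"
  assumes R: "refl_nonsing_M_matrix R" and c: "\<forall>i. c $ i > 0"
    and sym: "transpose (R ** diag_mat c) = R ** diag_mat c"
    and x: "x \<noteq> 0"
  shows "x \<bullet> ((R ** diag_mat c) *v x) > 0"
proof -
  define S where "S = R ** diag_mat c"
  define D where "D = diag_mat c"
  have Dpos: "x \<bullet> (D *v x) > 0" if x: "x \<noteq> 0" for x
  proof -
    obtain i where "x$i \<noteq> 0" using x by (auto simp: vec_eq_iff)
    then show ?thesis
      unfolding D_def diag_mat_mult_vec inner_vec_def
      by (intro sum_pos2[of _ i])
         (auto simp: c less_imp_le mult.left_commute[of "x$_"] simp flip: power2_eq_square)
  qed
  define q where "q = (\<lambda>x. (x \<bullet> (S *v x)) / (x \<bullet> (D *v x)))"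
  have ne: "sphere (0::real^'n) 1 \<noteq> {}" by simp
  have "continuous_on (sphere 0 1) q"
    unfolding q_def using Dpos
    by (intro continuous_intros quadratic_form_continuous)
       (metis less_irrefl norm_zero mem_sphere_0 zero_neq_one)
  then obtain x0 where x0: "norm x0 = 1" and min: "\<And>y. norm y = 1 \<Longrightarrow> q x0 \<le> q y"
    using continuous_attains_inf[OF compact_sphere ne] by (metis mem_sphere_0)
  define l where "l = q x0"
  have x0n: "x0 \<noteq> 0" using x0 by auto
  \<comment> \<open>\<open>S - l D\<close> is nonnegative and vanishes at the minimiser
    \<open>x0\<close>, so \<open>x0\<close> will lie in its kernel.\<close>
  define M where "M = S - l *\<^sub>R D"
  have Mv: "M *v y = S *v y - l *\<^sub>R (D *v y)" for y
    by (simp add: M_def matrix_vector_mult_diff_rdistrib scaleR_matrix_vector_assoc)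
  have qform: "y \<bullet> (S *v y) \<ge> l * (y \<bullet> (D *v y))" for y
  proof (cases "y = 0")
    case False
    have "l \<le> q ((1 / norm y) *\<^sub>R y)" unfolding l_def using False by (intro min) simp
    also have "\<dots> = q y" using False Dpos[OF False]
      by (simp add: q_def matrix_vector_mult_scaleR)
    finally show ?thesis using Dpos[OF False] by (simp add: q_def field_simps)
  qed simp
  have symM: "transpose M = M"
    using sym transpose_diag_mat[of c] by (simp add: M_def S_def D_def transpose_def vec_eq_iff)
  have "M *v x0 = 0"
  proof (rule psd_quadratic_zero[OF symM])
    show "x \<bullet> (M *v x) \<ge> 0" for x using qform[of x] by (simp add: Mv inner_diff_right)
    show "x0 \<bullet> (M *v x0) = 0" using Dpos[OF x0n] by (simp add: Mv inner_diff_right l_def q_def)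
  qed
  then have eig: "R *v (D *v x0) = l *\<^sub>R (D *v x0)"
    by (simp add: Mv S_def D_def matrix_vector_mul_assoc)
  have "D *v x0 \<noteq> 0" using Dpos[OF x0n] by auto
  \<comment> \<open>\<open>D x0\<close> is an eigenvector of \<open>R\<close> for \<open>l\<close>,
    hence of \<open>I - R\<close> for \<open>1 - l\<close>; a spectral radius below 1 forces
    \<open>l > 0\<close>.\<close>
  then have "\<bar>1 - l\<bar> \<le> spectral_radius (mat 1 - R)"
    by (rule abs_eigenvalue_le_spectral_radius)
       (simp add: matrix_vector_mult_diff_rdistrib eig scalar_mult_eq_scaleR algebra_simps)
  then have "l > 0" using R unfolding refl_nonsing_M_matrix_def by linarith
  then show ?thesis using qform[of x] Dpos[OF x] unfolding S_def
    by (meson less_le_trans mult_pos_pos)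
qed

lemma pos_def_invertible:
  fixes S :: "real^'n^'n"
  assumes "\<And>x. x \<noteq> 0 \<Longrightarrow> x \<bullet> (S *v x) > 0"
  shows "invertible S"
  unfolding invertible_left_inverse matrix_left_invertible_ker
  using assms by (metis inner_zero_right less_irrefl)

lemma pos_def_inverse:
  fixes S :: "real^'n^'n"
  assumes sym: "transpose S = S" and pd: "\<And>x. x \<noteq> 0 \<Longrightarrow> x \<bullet> (S *v x) > 0"
  shows "S ** matrix_inv S = mat 1" "matrix_inv S ** S = mat 1"
    "sym_pos_def (matrix_inv S)"
proof -
  have inv: "invertible S" using pd by (rule pos_def_invertible)
  show r: "S ** matrix_inv S = mat 1" and l: "matrix_inv S ** S = mat 1"
    using inv unfolding matrix_inv_def invertible_def by (metis (mono_tags, lifting) someI_ex)+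
  have t: "transpose (matrix_inv S) = matrix_inv S"
  proof -
    have "transpose (matrix_inv S) ** S = mat 1"
      using arg_cong[OF r, of transpose] by (simp add: matrix_transpose_mul sym transpose_mat)
    then have "transpose (matrix_inv S) ** (S ** matrix_inv S) = matrix_inv S"
      by (simp add: matrix_mul_assoc)
    then show ?thesis by (simp add: r)
  qed
  have "x \<bullet> (matrix_inv S *v x) > 0" if "x \<noteq> 0" for x
  proof -
    define y where "y = matrix_inv S *v x"
    have x: "x = S *v y" by (simp add: y_def matrix_vector_mul_assoc r)
    with that have "y \<noteq> 0" by auto
    then have "0 < (S *v y) \<bullet> y" using pd[of y] by (simp add: inner_commute)
    then show ?thesis by (simp only: x[symmetric] y_def[symmetric])
  qed
  with t show "sym_pos_def (matrix_inv S)" by (auto simp: sym_pos_def_def)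
qed

lemma pos_def_coercive:
  fixes S :: "real^'n^'n"
  assumes "\<And>x. x \<noteq> 0 \<Longrightarrow> x \<bullet> (S *v x) > 0"
  obtains k where "k > 0" "\<And>x. k * (norm x)\<^sup>2 \<le> x \<bullet> (S *v x)"
proof -
  have ne: "sphere (0::real^'n) 1 \<noteq> {}" by simp
  obtain x0 where x0: "norm x0 = 1" and min: "\<And>y. norm y = 1 \<Longrightarrow> x0 \<bullet> (S *v x0) \<le> y \<bullet> (S *v y)"
    using continuous_attains_inf[OF compact_sphere ne quadratic_form_continuous[of _ S]]
    by (metis mem_sphere_0)
  show ?thesis
  proof (rule that[of "x0 \<bullet> (S *v x0)"])
    show "x0 \<bullet> (S *v x0) > 0" using x0 by (intro assms) auto
    show "x0 \<bullet> (S *v x0) * (norm x)\<^sup>2 \<le> x \<bullet> (S *v x)" for x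
    proof (cases "x = 0")
      case False
      then have "x0 \<bullet> (S *v x0) \<le> ((1 / norm x) *\<^sub>R x) \<bullet> (S *v ((1 / norm x) *\<^sub>R x))"
        by (intro min) simp
      then show ?thesis using False
        by (simp add: matrix_vector_mult_scaleR field_simps power2_eq_square)
    qed simp
  qed
qed

lemma matrix_norm_bound:
  fixes M :: "real^'n^'n"
  obtains K where "K > 0" "\<And>x. norm (M *v x) \<le> K * norm x"
proof -
  have "bounded_linear ((*v) M)" by simp
  from bounded_linear.pos_bounded[OF this] obtain K where "K > 0" "\<And>x. norm (M *v x) \<le> norm x * K"
    by auto
  with that show ?thesis by (simp add: mult.commute)
qed

section \<open>Gaussian increments\<close>

text \<open>Raw moments follow from the central ones by expanding around \<open>m\<close>. The
  fourth is needed because large increments \<open>b\<close> are controlled by the fourth power of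
  their norm, whose mean is of order \<open>h^2\<close> over a step of length \<open>h\<close> and
  so vanishes when summed over a grid.\<close>

lemma (in prob_space) normal_moments:
  assumes X: "distributed M lborel X (normal_density m \<sigma>)" and s: "\<sigma> > 0"
  shows "integrable M X" "expectation X = m"
    "integrable M (\<lambda>x. (X x)\<^sup>2)" "expectation (\<lambda>x. (X x)\<^sup>2) = \<sigma>\<^sup>2 + m\<^sup>2"
    "integrable M (\<lambda>x. (X x)^4)" "expectation (\<lambda>x. (X x)^4) = 3 * \<sigma>^4 + 6 * \<sigma>\<^sup>2 * m\<^sup>2 + m^4"
proof -
  let ?d = "normal_density m \<sigma>"
  have tr: "integrable M (\<lambda>x. g (X x)) \<and> expectation (\<lambda>x. g (X x)) = v"
    if g: "g \<in> borel_measurable borel" and h: "has_bochner_integral lborel (\<lambda>x. ?d x * g x) v" for g v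
    using distributed_integrable[OF X, of g] distributed_integral[OF X, of g] g h
    by (simp add: has_bochner_integral_iff)
  note E = normal_moment_even[OF s, of m] and O = normal_moment_odd[OF s, of m]
  have m0: "has_bochner_integral lborel ?d 1" using E[of 0] by simp
  have m1: "has_bochner_integral lborel (\<lambda>x. ?d x * (x - m)) 0" using O[of 0] by simp
  have m2: "has_bochner_integral lborel (\<lambda>x. ?d x * (x - m)\<^sup>2) (\<sigma>\<^sup>2)"
  proof -
    have "fact 2 / (2 / \<sigma>\<^sup>2) = \<sigma>\<^sup>2" using s by simp
    then show ?thesis using E[of 1] by simp
  qed
  have m3: "has_bochner_integral lborel (\<lambda>x. ?d x * (x - m)^3) 0" using O[of 1] by (simp add: numeral_3_eq_3)
  have m4: "has_bochner_integral lborel (\<lambda>x. ?d x * (x - m)^4) (3 * \<sigma>^4)"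
  proof -
    have "fact 4 / ((2 / \<sigma>\<^sup>2)^2 * fact 2) = 3 * \<sigma>^4"
      using s by (simp add: fact_numeral power_divide flip: power_mult)
    then show ?thesis using E[of 2] by simp
  qed
  have "has_bochner_integral lborel (\<lambda>x. ?d x * (x - m) + m * ?d x) (0 + m * 1)"
    by (intro has_bochner_integral_add has_bochner_integral_mult_right m0 m1)
  also have "(\<lambda>x. ?d x * (x - m) + m * ?d x) = (\<lambda>x. ?d x * x)" by (simp add: algebra_simps)
  finally show "integrable M X" "expectation X = m" using tr[of "\<lambda>x. x"] by auto
  have "has_bochner_integral lborel (\<lambda>x. ?d x * (x - m)\<^sup>2 + (2 * m * (?d x * (x - m)) + m\<^sup>2 * ?d x))
      (\<sigma>\<^sup>2 + (2 * m * 0 + m\<^sup>2 * 1))"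
    by (intro has_bochner_integral_add has_bochner_integral_mult_right m0 m1 m2)
  also have "(\<lambda>x. ?d x * (x - m)\<^sup>2 + (2 * m * (?d x * (x - m)) + m\<^sup>2 * ?d x)) = (\<lambda>x. ?d x * x\<^sup>2)"
    by (simp add: algebra_simps power2_eq_square)
  finally show "integrable M (\<lambda>x. (X x)\<^sup>2)" "expectation (\<lambda>x. (X x)\<^sup>2) = \<sigma>\<^sup>2 + m\<^sup>2"
    using tr[of "\<lambda>x. x\<^sup>2"] by auto
  have "has_bochner_integral lborel (\<lambda>x. ?d x * (x - m)^4 + (4 * m * (?d x * (x - m)^3)
      + (6 * m\<^sup>2 * (?d x * (x - m)\<^sup>2) + (4 * m^3 * (?d x * (x - m)) + m^4 * ?d x))))
      (3 * \<sigma>^4 + (4 * m * 0 + (6 * m\<^sup>2 * \<sigma>\<^sup>2 + (4 * m^3 * 0 + m^4 * 1))))"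
    by (intro has_bochner_integral_add has_bochner_integral_mult_right m0 m1 m2 m3 m4)
  also have "(\<lambda>x. ?d x * (x - m)^4 + (4 * m * (?d x * (x - m)^3)
      + (6 * m\<^sup>2 * (?d x * (x - m)\<^sup>2) + (4 * m^3 * (?d x * (x - m)) + m^4 * ?d x)))) = (\<lambda>x. ?d x * x^4)"
  proof
    fix x
    have "x^4 = (x - m)^4 + (4 * m * (x - m)^3 + (6 * m\<^sup>2 * (x - m)\<^sup>2 + (4 * m^3 * (x - m) + m^4)))"
      by (simp add: algebra_simps power2_eq_square power3_eq_cube power4_eq_xxxx)
    then show "?d x * (x - m)^4 + (4 * m * (?d x * (x - m)^3)
      + (6 * m\<^sup>2 * (?d x * (x - m)\<^sup>2) + (4 * m^3 * (?d x * (x - m)) + m^4 * ?d x))) = ?d x * x^4"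
      by (simp only:) (simp add: algebra_simps)
  qed
  finally show "integrable M (\<lambda>x. (X x)^4)" "expectation (\<lambda>x. (X x)^4) = 3 * \<sigma>^4 + 6 * \<sigma>\<^sup>2 * m\<^sup>2 + m^4"
    using tr[of "\<lambda>x. x^4"] by auto
qed

text \<open>The Brownian definition gives independence only as a product rule for events. Preimages
  of Borel sets form intersection-stable generators, so the rule extends to the generated
  sigma-algebras and then to expectations.\<close>

lemma (in prob_space) indep_increment_expectation:
  fixes X :: "'a \<Rightarrow> 'b::topological_space" and g :: "'a \<Rightarrow> real" and \<psi> :: "'b \<Rightarrow> real"
  assumes G: "space G = space M" "sets G \<subseteq> sets M" and X: "X \<in> borel_measurable M"
    and ind: "\<And>E Y. E \<in> sets G \<Longrightarrow> Y \<in> sets borel \<Longrightarrow>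
      measure M (E \<inter> {\<omega>\<in>space M. X \<omega> \<in> Y}) = measure M E * measure M {\<omega>\<in>space M. X \<omega> \<in> Y}"
    and g: "g \<in> borel_measurable G" "\<And>\<omega>. \<omega> \<in> space M \<Longrightarrow> \<bar>g \<omega>\<bar> \<le> K"
    and \<psi>: "\<psi> \<in> borel_measurable borel" "integrable M (\<lambda>\<omega>. \<psi> (X \<omega>))"
  shows "integrable M (\<lambda>\<omega>. g \<omega> * \<psi> (X \<omega>))"
    "expectation (\<lambda>\<omega>. g \<omega> * \<psi> (X \<omega>)) = expectation g * expectation (\<lambda>\<omega>. \<psi> (X \<omega>))"
proof -
  have gM: "g \<in> borel_measurable M"
    using g(1) G by (auto simp: measurable_def)
  have "indep_var borel g borel (\<lambda>\<omega>. \<psi> (X \<omega>))"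
    unfolding indep_var_eq
  proof (intro conjI indep_set_sigma_sets)
    show "random_variable borel g" by (rule gM)
    show "random_variable borel (\<lambda>\<omega>. \<psi> (X \<omega>))" using X \<psi>(1) by measurable
    show "indep_set {g -` A \<inter> space M |A. A \<in> sets borel}
        {(\<lambda>\<omega>. \<psi> (X \<omega>)) -` A \<inter> space M |A. A \<in> sets borel}"
    proof (rule indep_setI)
      show "{g -` A \<inter> space M |A. A \<in> sets borel} \<subseteq> events" using gM by (auto simp: measurable_def)
      show "{(\<lambda>\<omega>. \<psi> (X \<omega>)) -` A \<inter> space M |A. A \<in> sets borel} \<subseteq> events"
        using measurable_compose[OF X \<psi>(1)] by (auto simp: measurable_def)
      fix a b
      assume "a \<in> {g -` A \<inter> space M |A. A \<in> sets borel}"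
        "b \<in> {(\<lambda>\<omega>. \<psi> (X \<omega>)) -` A \<inter> space M |A. A \<in> sets borel}"
      then obtain S T where S: "a = g -` S \<inter> space M" "S \<in> sets borel"
        and T: "b = (\<lambda>\<omega>. \<psi> (X \<omega>)) -` T \<inter> space M" "T \<in> sets borel" by auto
      have "a \<in> sets G" using g(1) S G by (auto simp: measurable_def)
      moreover have "b = {\<omega>\<in>space M. X \<omega> \<in> \<psi> -` T}" using T by auto
      moreover have "\<psi> -` T \<in> sets borel" using \<psi>(1) T(2) by (metis measurable_sets_borel)
      ultimately show "prob (a \<inter> b) = prob a * prob b" using ind[of a "\<psi> -` T"] by (simp only:)
    qed
    have stable: "Int_stable {f -` A \<inter> space M |A. A \<in> sets borel}" for f :: "'a \<Rightarrow> real"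
    proof (rule Int_stableI)
      fix a b
      assume "a \<in> {f -` A \<inter> space M |A. A \<in> sets borel}" "b \<in> {f -` A \<inter> space M |A. A \<in> sets borel}"
      then obtain S T where "a = f -` S \<inter> space M" "b = f -` T \<inter> space M" "S \<in> sets borel" "T \<in> sets borel"
        by auto
      then have "a \<inter> b = f -` (S \<inter> T) \<inter> space M" "S \<inter> T \<in> sets borel" by auto
      then show "a \<inter> b \<in> {f -` A \<inter> space M |A. A \<in> sets borel}" by blast
    qed
    show "Int_stable {g -` A \<inter> space M |A. A \<in> sets borel}" by (rule stable)
    show "Int_stable {(\<lambda>\<omega>. \<psi> (X \<omega>)) -` A \<inter> space M |A. A \<in> sets borel}" by (rule stable)
  qed
  moreover have "integrable M g"
    by (rule integrable_const_bound[of _ K]) (use g(2) gM in auto)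
  ultimately show "integrable M (\<lambda>\<omega>. g \<omega> * \<psi> (X \<omega>))"
    "expectation (\<lambda>\<omega>. g \<omega> * \<psi> (X \<omega>)) = expectation g * expectation (\<lambda>\<omega>. \<psi> (X \<omega>))"
    using indep_var_integrable indep_var_lebesgue_integral \<psi>(2) by blast+
qed

locale brownian = prob_space M for M :: "'a measure" +
  fixes F :: "real \<Rightarrow> 'a measure" and mu :: "real^'n" and A :: "real^'n^'n" and z :: "real^'n"
    and B :: "real \<Rightarrow> 'a \<Rightarrow> real^'n"
  assumes filt: "filtration (space M) F" and F_sub: "\<And>t. sets (F t) \<subseteq> sets M"
    and bm: "brownian_motion M F mu A z B" and A_spd: "sym_pos_def A"
begin

lemma space_F: "space (F t) = space M"
  using filt by (rule filtration.space_F)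

lemma F_mono: "s \<le> t \<Longrightarrow> sets (F s) \<subseteq> sets (F t)"
  using filt by (rule filtration.sets_F_mono)

lemma F_measurable_mono: "s \<le> t \<Longrightarrow> g \<in> measurable (F s) N \<Longrightarrow> g \<in> measurable (F t) N"
  using F_mono[of s t] by (auto simp: measurable_def space_F)

lemma F_measurable_M: "g \<in> measurable (F s) N \<Longrightarrow> g \<in> measurable M N"
  using F_sub[of s] by (auto simp: measurable_def space_F)

lemma B_measurable: "t \<ge> 0 \<Longrightarrow> B t \<in> borel_measurable (F t)"
  using bm unfolding brownian_motion_def adapted_cont_def by auto

lemma B_measurable_M [measurable]: "t \<ge> 0 \<Longrightarrow> B t \<in> borel_measurable M"
  using B_measurable F_measurable_M by blast

lemma A_pos: "u \<noteq> 0 \<Longrightarrow> u \<bullet> (A *v u) > 0"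
  using A_spd unfolding sym_pos_def_def by auto

context
  fixes s t :: real
  assumes st: "0 \<le> s" "s < t"
begin

abbreviation incr :: "'a \<Rightarrow> real^'n" where "incr \<omega> \<equiv> B t \<omega> - B s \<omega>"

lemma incr_measurable: "incr \<in> borel_measurable M"
  using B_measurable_M[of s] B_measurable_M[of t] st by simp

lemma linear_incr_moments:
  shows "integrable M (\<lambda>\<omega>. u \<bullet> incr \<omega>)" (is ?m1) "expectation (\<lambda>\<omega>. u \<bullet> incr \<omega>) = (t - s) * (u \<bullet> mu)" (is ?e1)
    "integrable M (\<lambda>\<omega>. (u \<bullet> incr \<omega>)\<^sup>2)" (is ?m2)
    "expectation (\<lambda>\<omega>. (u \<bullet> incr \<omega>)\<^sup>2) = (t - s) * (u \<bullet> (A *v u)) + ((t - s) * (u \<bullet> mu))\<^sup>2" (is ?e2)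
    "integrable M (\<lambda>\<omega>. (u \<bullet> incr \<omega>)^4)" (is ?m4)
    "expectation (\<lambda>\<omega>. (u \<bullet> incr \<omega>)^4) = 3 * ((t - s) * (u \<bullet> (A *v u)))\<^sup>2
      + 6 * ((t - s) * (u \<bullet> (A *v u))) * ((t - s) * (u \<bullet> mu))\<^sup>2 + ((t - s) * (u \<bullet> mu))^4" (is ?e4)
proof -
  have "?m1 \<and> ?e1 \<and> ?m2 \<and> ?e2 \<and> ?m4 \<and> ?e4"
  \<comment> \<open>The definition prescribes a law only for nonzero \<open>u\<close>, since the
    variance vanishes otherwise.\<close>
  proof (cases "u = 0")
    case False
    define v where "v = (t - s) * (u \<bullet> (A *v u))"
    have v: "v > 0" using A_pos[OF False] st by (simp add: v_def)
    have "distributed M lborel (\<lambda>\<omega>. u \<bullet> incr \<omega>) (normal_density ((t - s) * (u \<bullet> mu)) (sqrt v))"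
      using bm False st unfolding brownian_motion_def v_def by auto
    note n = normal_moments[OF this]
    have 4: "sqrt v ^ 4 = v\<^sup>2" using v power_mult[of "sqrt v" 2 2] by simp
    show ?thesis using n v by (simp add: v_def[symmetric] 4)
  qed simp
  then show ?m1 ?e1 ?m2 ?e2 ?m4 ?e4 by blast+
qed

lemma incr_coordinate:
  "integrable M (\<lambda>\<omega>. incr \<omega> $ k)" "expectation (\<lambda>\<omega>. incr \<omega> $ k) = (t - s) * mu $ k"
  using linear_incr_moments(1,2)[of "axis k 1"] by (simp_all add: inner_axis' )

text \<open>Only laws of single linear functionals are given, so mixed moments come by polarisation
  from the directions \<open>e_k\<close>, \<open>e_l\<close> and \<open>e_k + e_l\<close>.\<close>

lemma incr_covariance:
  "integrable M (\<lambda>\<omega>. incr \<omega> $ k * incr \<omega> $ l)"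
  "expectation (\<lambda>\<omega>. incr \<omega> $ k * incr \<omega> $ l) = (t - s) * A $ k $ l + (t - s)\<^sup>2 * mu $ k * mu $ l"
proof -
  let ?e = "\<lambda>i. axis i 1 :: real^'n"
  have Ae: "(A *v ?e j) $ i = A $ i $ j" for i j
    by (simp add: matrix_vector_mult_basis column_def)
  have symA: "A $ l $ k = A $ k $ l"
    using A_spd unfolding sym_pos_def_def transpose_def by (metis vec_lambda_beta)
  have eq: "incr \<omega> $ k * incr \<omega> $ l
      = (((?e k + ?e l) \<bullet> incr \<omega>)\<^sup>2 - (?e k \<bullet> incr \<omega>)\<^sup>2 - (?e l \<bullet> incr \<omega>)\<^sup>2) / 2" for \<omega>
    by (simp add: inner_add_left inner_axis' power2_eq_square algebra_simps)
  note m = linear_incr_moments(3,4)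
  show "integrable M (\<lambda>\<omega>. incr \<omega> $ k * incr \<omega> $ l)"
    unfolding eq by (intro integrable_divide Bochner_Integration.integrable_diff m)
  have "expectation (\<lambda>\<omega>. incr \<omega> $ k * incr \<omega> $ l) = (expectation (\<lambda>\<omega>. ((?e k + ?e l) \<bullet> incr \<omega>)\<^sup>2)
      - expectation (\<lambda>\<omega>. (?e k \<bullet> incr \<omega>)\<^sup>2) - expectation (\<lambda>\<omega>. (?e l \<bullet> incr \<omega>)\<^sup>2)) / 2"
    unfolding eq using m(1) by simp
  also have "\<dots> = (t - s) * A $ k $ l + (t - s)\<^sup>2 * mu $ k * mu $ l"
    unfolding m(2)
    by (simp add: matrix_vector_right_distrib inner_add_left inner_add_right Ae symA inner_axis'
        power2_eq_square field_simps)
  finally show "expectation (\<lambda>\<omega>. incr \<omega> $ k * incr \<omega> $ l) = (t - s) * A $ k $ l + (t - s)\<^sup>2 * mu $ k * mu $ l" .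
qed

lemma incr_indep:
  fixes g :: "'a \<Rightarrow> real" and \<psi> :: "real^'n \<Rightarrow> real"
  assumes "g \<in> borel_measurable (F s)" "\<And>\<omega>. \<omega> \<in> space M \<Longrightarrow> \<bar>g \<omega>\<bar> \<le> K"
    and "\<psi> \<in> borel_measurable borel" "integrable M (\<lambda>\<omega>. \<psi> (incr \<omega>))"
  shows "integrable M (\<lambda>\<omega>. g \<omega> * \<psi> (incr \<omega>))"
    "expectation (\<lambda>\<omega>. g \<omega> * \<psi> (incr \<omega>)) = expectation g * expectation (\<lambda>\<omega>. \<psi> (incr \<omega>))"
proof -
  have ind: "measure M (E \<inter> {\<omega>\<in>space M. incr \<omega> \<in> Y}) = measure M E * measure M {\<omega>\<in>space M. incr \<omega> \<in> Y}"
    if "E \<in> sets (F s)" "Y \<in> sets borel" for E Y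
    using bm st that unfolding brownian_motion_def by blast
  note * = indep_increment_expectation[where G = "F s" and X = incr and g = g and K = K and \<psi> = \<psi>]
  show "integrable M (\<lambda>\<omega>. g \<omega> * \<psi> (incr \<omega>))"
    "expectation (\<lambda>\<omega>. g \<omega> * \<psi> (incr \<omega>)) = expectation g * expectation (\<lambda>\<omega>. \<psi> (incr \<omega>))"
    by (rule *; (rule space_F F_sub incr_measurable assms ind; assumption?))+
qed

text \<open>Coefficients known at time \<open>s\<close> factor out of the Gaussian moments. The term
  of order \<open>(t - s)^2\<close> appears because the second moments of the increment are not
  centred.\<close>

lemma quadratic_incr_expectation:
  fixes g :: "'n \<Rightarrow> 'a \<Rightarrow> real" and G :: "'n \<Rightarrow> 'n \<Rightarrow> 'a \<Rightarrow> real"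
  assumes g: "\<And>k. g k \<in> borel_measurable (F s)" "\<And>k \<omega>. \<omega> \<in> space M \<Longrightarrow> \<bar>g k \<omega>\<bar> \<le> K"
    and G: "\<And>k l. G k l \<in> borel_measurable (F s)" "\<And>k l \<omega>. \<omega> \<in> space M \<Longrightarrow> \<bar>G k l \<omega>\<bar> \<le> K"
  defines "Y \<equiv> (\<lambda>\<omega>. (\<Sum>k\<in>UNIV. g k \<omega> * incr \<omega> $ k) + (\<Sum>k\<in>UNIV. \<Sum>l\<in>UNIV. G k l \<omega> * (incr \<omega> $ k * incr \<omega> $ l)))"
  shows "integrable M Y"
    "expectation Y = expectation (\<lambda>\<omega>. (t - s) * ((\<Sum>k\<in>UNIV. g k \<omega> * mu $ k) + (\<Sum>k\<in>UNIV. \<Sum>l\<in>UNIV. G k l \<omega> * A $ k $ l))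
        + (t - s)\<^sup>2 * (\<Sum>k\<in>UNIV. \<Sum>l\<in>UNIV. G k l \<omega> * mu $ k * mu $ l))"
proof -
  have gI: "integrable M (g k)" for k
    by (rule integrable_const_bound[of _ K]) (use g(2) F_measurable_M[OF g(1)] in auto)
  have GI: "integrable M (G k l)" for k l
    by (rule integrable_const_bound[of _ K]) (use G(2) F_measurable_M[OF G(1)] in auto)
  have 1: "integrable M (\<lambda>\<omega>. g k \<omega> * incr \<omega> $ k)"
    "expectation (\<lambda>\<omega>. g k \<omega> * incr \<omega> $ k) = expectation (g k) * ((t - s) * mu $ k)" for k
    using incr_indep[OF g, of "\<lambda>b. b $ k"] incr_coordinate[of k] by simp_all
  have 2: "integrable M (\<lambda>\<omega>. G k l \<omega> * (incr \<omega> $ k * incr \<omega> $ l))"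
    "expectation (\<lambda>\<omega>. G k l \<omega> * (incr \<omega> $ k * incr \<omega> $ l))
      = expectation (G k l) * ((t - s) * A $ k $ l + (t - s)\<^sup>2 * mu $ k * mu $ l)" for k l
    using incr_indep[OF G, of "\<lambda>b. b $ k * b $ l"] incr_covariance[of k l] by simp_all
  show "integrable M Y"
    unfolding Y_def by (intro Bochner_Integration.integrable_add Bochner_Integration.integrable_sum 1 2)
  have "expectation Y = (\<Sum>k\<in>UNIV. expectation (g k) * ((t - s) * mu $ k))
     + (\<Sum>k\<in>UNIV. \<Sum>l\<in>UNIV. expectation (G k l) * ((t - s) * A $ k $ l + (t - s)\<^sup>2 * mu $ k * mu $ l))"
    by (simp add: Y_def 1 2 del: vector_minus_component)
  also have "\<dots> = (t - s) * ((\<Sum>k\<in>UNIV. expectation (g k) * mu $ k) + (\<Sum>k\<in>UNIV. \<Sum>l\<in>UNIV. expectation (G k l) * A $ k $ l))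
        + (t - s)\<^sup>2 * (\<Sum>k\<in>UNIV. \<Sum>l\<in>UNIV. expectation (G k l) * mu $ k * mu $ l)"
    by (simp add: sum_distrib_left distrib_left distrib_right sum.distrib mult_ac)
  also have "\<dots> = expectation (\<lambda>\<omega>. (t - s) * ((\<Sum>k\<in>UNIV. g k \<omega> * mu $ k) + (\<Sum>k\<in>UNIV. \<Sum>l\<in>UNIV. G k l \<omega> * A $ k $ l))
        + (t - s)\<^sup>2 * (\<Sum>k\<in>UNIV. \<Sum>l\<in>UNIV. G k l \<omega> * mu $ k * mu $ l))"
    by (simp add: gI GI)
  finally show "expectation Y = \<dots>" .
qed

end

text \<open>One constant has to serve all steps; \<open>t - s \<le> 1\<close> lets the higher powers
  of the step length produced by \<open>mu\<close> be absorbed into the leading one.\<close>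

lemma incr_norm_moments:
  obtains C where "C > 0"
    "\<And>s t. 0 \<le> s \<Longrightarrow> s < t \<Longrightarrow> t - s \<le> 1 \<Longrightarrow>
      integrable M (\<lambda>\<omega>. (norm (B t \<omega> - B s \<omega>))\<^sup>2) \<and>
      expectation (\<lambda>\<omega>. (norm (B t \<omega> - B s \<omega>))\<^sup>2) \<le> C * (t - s) \<and>
      integrable M (\<lambda>\<omega>. (norm (B t \<omega> - B s \<omega>))^4) \<and>
      expectation (\<lambda>\<omega>. (norm (B t \<omega> - B s \<omega>))^4) \<le> C * (t - s)\<^sup>2"
proof -
  define e where "e = (\<lambda>i. axis i 1 :: real^'n)"
  define a where "a = (\<lambda>i. e i \<bullet> (A *v e i))"
  define m where "m = (\<lambda>i. e i \<bullet> mu)"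
  have a: "a i > 0" for i unfolding a_def by (rule A_pos) (simp add: e_def axis_eq_0_iff)
  define n where "n = real CARD('n)"
  define C where "C = 1 + (\<Sum>i\<in>UNIV. a i + (m i)\<^sup>2) + n * (\<Sum>i\<in>UNIV. 3 * (a i)\<^sup>2 + 6 * a i * (m i)\<^sup>2 + (m i)^4)"
  have nonneg: "0 \<le> (\<Sum>i\<in>UNIV. a i + (m i)\<^sup>2)" "0 \<le> n * (\<Sum>i\<in>UNIV. 3 * (a i)\<^sup>2 + 6 * a i * (m i)\<^sup>2 + (m i)^4)"
    using a by (auto intro!: sum_nonneg mult_nonneg_nonneg add_nonneg_nonneg simp: n_def less_imp_le)
  show ?thesis
  proof (rule that)
    show "C > 0" using nonneg by (simp add: C_def)
    fix s t :: real assume st: "0 \<le> s" "s < t" "t - s \<le> 1"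
    define h where "h = t - s"
    have h: "0 < h" "h \<le> 1" using st by (auto simp: h_def)
    have h2: "h\<^sup>2 \<le> h" "h^3 \<le> h\<^sup>2" "h^4 \<le> h\<^sup>2"
      using h power_decreasing[of 1 2 h] power_decreasing[of 2 3 h] power_decreasing[of 2 4 h] by auto
    let ?b = "\<lambda>\<omega>. B t \<omega> - B s \<omega>"
    have n2: "(norm x)\<^sup>2 = (\<Sum>i\<in>UNIV. (e i \<bullet> x)\<^sup>2)" for x :: "real^'n"
      by (simp add: e_def inner_axis' norm_vec_def L2_set_def sum_nonneg)
    have n4: "(norm x)^4 \<le> n * (\<Sum>i\<in>UNIV. (e i \<bullet> x)^4)" for x :: "real^'n"
    proof -
      have "(norm x)^4 = (\<Sum>i\<in>UNIV. (e i \<bullet> x)\<^sup>2)\<^sup>2" unfolding n2[symmetric] by (simp flip: power_mult)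
      also have "\<dots> \<le> (\<Sum>i\<in>UNIV. ((e i \<bullet> x)\<^sup>2)\<^sup>2) * n"
        unfolding n_def by (rule sum_squared_le_sum_of_squares)
      finally show ?thesis by (simp add: mult.commute flip: power_mult)
    qed
    note mom = linear_incr_moments[OF st(1,2)]
    have I4: "integrable M (\<lambda>\<omega>. n * (\<Sum>i\<in>UNIV. (e i \<bullet> ?b \<omega>)^4))"
      by (intro Bochner_Integration.integrable_sum integrable_mult_right mom)
    have I2: "integrable M (\<lambda>\<omega>. (norm (?b \<omega>))\<^sup>2)" unfolding n2
      by (intro Bochner_Integration.integrable_sum mom)
    moreover have "expectation (\<lambda>\<omega>. (norm (?b \<omega>))\<^sup>2) \<le> C * h"
    proof -
      have "expectation (\<lambda>\<omega>. (norm (?b \<omega>))\<^sup>2) = (\<Sum>i\<in>UNIV. h * a i + (h * m i)\<^sup>2)"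
        unfolding n2 a_def m_def h_def using mom by (simp add: Bochner_Integration.integral_sum)
      also have "\<dots> \<le> (\<Sum>i\<in>UNIV. a i + (m i)\<^sup>2) * h"
        unfolding sum_distrib_right
        by (rule sum_mono) (use h2(1) in \<open>auto simp: power_mult_distrib algebra_simps intro!: mult_right_mono\<close>)
      also have "\<dots> \<le> C * h" using nonneg h by (intro mult_right_mono) (auto simp: C_def)
      finally show ?thesis .
    qed
    moreover have I4': "integrable M (\<lambda>\<omega>. (norm (?b \<omega>))^4)"
      by (rule Bochner_Integration.integrable_bound[OF I4])
         (use n4 st in \<open>auto intro!: AE_I2 abs_ge_self[THEN order_trans[rotated]]\<close>)
    moreover have "expectation (\<lambda>\<omega>. (norm (?b \<omega>))^4) \<le> C * h\<^sup>2"
    proof -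
      have "expectation (\<lambda>\<omega>. (norm (?b \<omega>))^4) \<le> expectation (\<lambda>\<omega>. n * (\<Sum>i\<in>UNIV. (e i \<bullet> ?b \<omega>)^4))"
        by (rule integral_mono[OF I4' I4 n4])
      also have "\<dots> = n * (\<Sum>i\<in>UNIV. 3 * (h * a i)\<^sup>2 + 6 * (h * a i) * (h * m i)\<^sup>2 + (h * m i)^4)"
        unfolding a_def m_def h_def using mom by (simp add: Bochner_Integration.integral_sum)
      also have "\<dots> \<le> n * (\<Sum>i\<in>UNIV. (3 * (a i)\<^sup>2 + 6 * a i * (m i)\<^sup>2 + (m i)^4) * h\<^sup>2)"
      proof (intro mult_left_mono sum_mono)
        fix i
        have 1: "6 * (a i * (m i)\<^sup>2) * h^3 \<le> 6 * (a i * (m i)\<^sup>2) * h\<^sup>2"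
          using h2(2) a[of i] by (intro mult_left_mono) auto
        have 2: "(m i)^4 * h^4 \<le> (m i)^4 * h\<^sup>2"
          using h2(3) by (intro mult_left_mono) auto
        have "3 * (h * a i)\<^sup>2 + 6 * (h * a i) * (h * m i)\<^sup>2 + (h * m i)^4
           = 3 * (a i)\<^sup>2 * h\<^sup>2 + 6 * (a i * (m i)\<^sup>2) * h^3 + (m i)^4 * h^4"
          by (simp add: power_mult_distrib power2_eq_square power3_eq_cube)
        with 1 2 show "3 * (h * a i)\<^sup>2 + 6 * (h * a i) * (h * m i)\<^sup>2 + (h * m i)^4
          \<le> (3 * (a i)\<^sup>2 + 6 * a i * (m i)\<^sup>2 + (m i)^4) * h\<^sup>2"
          by (simp add: distrib_right mult.assoc)
      qed (simp add: n_def)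
      also have "\<dots> = n * (\<Sum>i\<in>UNIV. 3 * (a i)\<^sup>2 + 6 * a i * (m i)\<^sup>2 + (m i)^4) * h\<^sup>2"
        by (simp add: sum_distrib_right)
      also have "\<dots> \<le> C * h\<^sup>2" using nonneg h by (intro mult_right_mono) (auto simp: C_def)
      finally show ?thesis .
    qed
    ultimately show "integrable M (\<lambda>\<omega>. (norm (?b \<omega>))\<^sup>2) \<and>
      expectation (\<lambda>\<omega>. (norm (?b \<omega>))\<^sup>2) \<le> C * (t - s) \<and>
      integrable M (\<lambda>\<omega>. (norm (?b \<omega>))^4) \<and>
      expectation (\<lambda>\<omega>. (norm (?b \<omega>))^4) \<le> C * (t - s)\<^sup>2"
      by (simp add: h_def)
  qed
qed

end

section \<open>Second-order expansion of the quadratic form\<close>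

text \<open>\<open>f2\<close> is used on bounded regions, where continuity provides bounds, while
  \<open>f\<close> and \<open>f1\<close> must be controlled along arbitrarily large increments.
  Differentiability at 0 is two-sided, which the later shift of the argument by a positive amount
  provides.\<close>

locale test_function =
  fixes f f1 f2 :: "real \<Rightarrow> real" and K :: real
  assumes deriv1: "\<And>v. v \<ge> 0 \<Longrightarrow> (f has_real_derivative f1 v) (at v)"
    and deriv2: "\<And>v. v \<ge> 0 \<Longrightarrow> (f1 has_real_derivative f2 v) (at v)"
    and cont2: "continuous_on {0..} f2"
    and bound0: "\<And>v. v \<ge> 0 \<Longrightarrow> \<bar>f v\<bar> \<le> K"
    and bound1: "\<And>v. v \<ge> 0 \<Longrightarrow> \<bar>f1 v\<bar> \<le> K"
begin

lemma K_nonneg: "K \<ge> 0"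
  using bound0[of 0] by simp

lemma cont0: "continuous_on {0..} f"
  by (rule DERIV_continuous_on[where D = f1]) (auto intro: deriv1 has_field_derivative_at_within)

lemma cont1: "continuous_on {0..} f1"
  by (rule DERIV_continuous_on[where D = f2]) (auto intro: deriv2 has_field_derivative_at_within)

lemma lipschitz: "v \<ge> 0 \<Longrightarrow> w \<ge> 0 \<Longrightarrow> \<bar>f v - f w\<bar> \<le> K * \<bar>v - w\<bar>"
  using field_differentiable_bound[of "{0..}" f f1 K v w]
  by (auto intro: deriv1 has_field_derivative_at_within bound1)

text \<open>Lagrange's remainder evaluates \<open>f2\<close> at an intermediate point; uniform
  continuity of \<open>f2\<close> on a slightly larger interval turns this into an error
  \<open>o(a^2)\<close> uniform in \<open>v\<close>.\<close>

lemma taylor2: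
  assumes "\<eta> > 0"
  obtains \<delta> where "\<delta> > 0" "\<And>v a. 0 \<le> v \<Longrightarrow> v \<le> W \<Longrightarrow> 0 \<le> v + a \<Longrightarrow> \<bar>a\<bar> \<le> \<delta> \<Longrightarrow>
    \<bar>f (v + a) - f v - f1 v * a - f2 v * a\<^sup>2 / 2\<bar> \<le> \<eta> * a\<^sup>2"
proof -
  have "uniformly_continuous_on {0..W+1} f2"
    by (intro compact_uniformly_continuous continuous_on_subset[OF cont2]) auto
  then obtain d where d: "d > 0" "\<And>x y. x \<in> {0..W+1} \<Longrightarrow> y \<in> {0..W+1} \<Longrightarrow> \<bar>y - x\<bar> < d \<Longrightarrow> \<bar>f2 y - f2 x\<bar> < 2 * \<eta>"
    using assms unfolding uniformly_continuous_on_def dist_real_def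
    by (metis mult_2 add_pos_pos)
  show ?thesis
  \<comment> \<open>The \<open>1\<close> keeps the intermediate point inside
    \<open>[0, W+1]\<close>; halving \<open>d\<close> yields the strict inequality in the modulus of
    continuity.\<close>
  proof (rule that[of "min 1 (d/2)"])
    show "min 1 (d/2) > 0" using d by simp
    fix v a assume va: "0 \<le> v" "v \<le> W" "0 \<le> v + a" "\<bar>a\<bar> \<le> min 1 (d/2)"
    show "\<bar>f (v + a) - f v - f1 v * a - f2 v * a\<^sup>2 / 2\<bar> \<le> \<eta> * a\<^sup>2"
    proof (cases "a = 0")
      case False
      define D where "D = (\<lambda>m::nat. if m = 0 then f else if m = 1 then f1 else f2)"
      have "\<exists>t. (if v + a < v then v + a < t \<and> t < v else v < t \<and> t < v + a) \<and>
          f (v + a) = (\<Sum>m<2. (D m v / fact m) * ((v + a) - v)^m) + (D 2 t / fact 2) * ((v + a) - v)^2"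
        using va False
        by (intro Taylor[where a = "min v (v+a)" and b = "max v (v+a)"])
           (auto simp: D_def less_2_cases_iff intro: deriv1 deriv2)
      then obtain t where t0: "if v + a < v then v + a < t \<and> t < v else v < t \<and> t < v + a"
          "f (v + a) = (\<Sum>m<2. (D m v / fact m) * ((v + a) - v)^m) + (D 2 t / fact 2) * ((v + a) - v)^2"
        by blast
      have t: "\<bar>t - v\<bar> \<le> \<bar>a\<bar>" "t \<ge> 0" using t0(1) va by (auto split: if_splits)
      have t3: "f (v + a) = f v + f1 v * a + f2 t * a\<^sup>2 / 2"
        using t0(2) by (simp add: D_def numeral_2_eq_2)
      have "\<bar>f2 t - f2 v\<bar> < 2 * \<eta>" using t va d(1) by (intro d(2)) auto
      have "f (v + a) - f v - f1 v * a - f2 v * a\<^sup>2 / 2 = (f2 t - f2 v) / 2 * a\<^sup>2"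
        unfolding t3 by (simp add: field_simps)
      then have "\<bar>f (v + a) - f v - f1 v * a - f2 v * a\<^sup>2 / 2\<bar> = \<bar>(f2 t - f2 v) / 2\<bar> * a\<^sup>2"
        by (simp only: abs_mult abs_power2)
      also have "\<dots> \<le> \<eta> * a\<^sup>2" using \<open>\<bar>f2 t - f2 v\<bar> < 2 * \<eta>\<close> by (intro mult_right_mono) auto
      finally show ?thesis .
    qed simp
  qed
qed

end

text \<open>\<open>Om_R\<close> is the identity \<open>Om R = C^-1\<close>: through it Assumption
  (C) makes the boundary term of \<open>V\<close> diagonal.\<close>

locale reflection_data =
  fixes A Om R :: "real^'n^'n" and mu c :: "real^'n"
  assumes A_spd: "sym_pos_def A" and Om_spd: "sym_pos_def Om"
    and c_pos: "\<And>k. c $ k > 0"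
    and Om_R: "\<And>l. Om *v (R *v l) = (\<chi> k. l $ k / c $ k)"
begin

definition V :: "real^'n \<Rightarrow> real" where "V z = z \<bullet> (Om *v z)"
definition Q :: "real^'n \<Rightarrow> real" where "Q z = (Om *v z) \<bullet> (A *v (Om *v z))"
definition drift :: "real^'n \<Rightarrow> real" where "drift z = trace (Om ** A) + 2 * ((Om *v z) \<bullet> mu)"
text \<open>The operator \<open>1/2 tr(A D^2) + mu . grad\<close> applied to \<open>f\<close>
  composed with \<open>V\<close>: the gradient of \<open>V\<close> is \<open>2 Om z\<close> and its
  Hessian \<open>2 Om\<close>, so the gradient squared in the metric \<open>A\<close> is
  \<open>4 Q\<close>, of which half enters.\<close>

definition gen :: "(real \<Rightarrow> real) \<Rightarrow> (real \<Rightarrow> real) \<Rightarrow> real^'n \<Rightarrow> real" where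
  "gen f1 f2 z = f1 (V z) * drift z + 2 * f2 (V z) * Q z"

lemma V_nonneg [simp]: "V z \<ge> 0"
  using Om_spd unfolding V_def sym_pos_def_def by (cases "z = 0") (auto simp: less_imp_le)

lemma V_eq_0_iff [simp]: "V z = 0 \<longleftrightarrow> z = 0"
  using Om_spd unfolding V_def sym_pos_def_def by (metis inner_zero_left less_irrefl)

lemma Om_swap: "x \<bullet> (Om *v y) = y \<bullet> (Om *v x)"
  using Om_spd unfolding sym_pos_def_def by (intro inner_matrix_sym) auto

lemma V_add: "V (z + b) = V z + (2 * ((Om *v z) \<bullet> b) + b \<bullet> (Om *v b))"
  using Om_swap[of z b]
  by (simp add: V_def matrix_vector_right_distrib inner_add_left inner_add_right inner_commute)

lemma Om_cont [continuous_intros]: "continuous_on S g \<Longrightarrow> continuous_on S (\<lambda>x. Om *v g x)"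
  by (rule continuous_on_compose2[OF matrix_vector_mult_linear_continuous_on[of UNIV]]) auto

lemma A_cont [continuous_intros]: "continuous_on S g \<Longrightarrow> continuous_on S (\<lambda>x. A *v g x)"
  by (rule continuous_on_compose2[OF matrix_vector_mult_linear_continuous_on[of UNIV]]) auto

lemma V_cont [continuous_intros]: "continuous_on S V"
  unfolding V_def by (intro continuous_intros)

lemma Q_cont [continuous_intros]: "continuous_on S Q"
  unfolding Q_def by (intro continuous_intros)

lemma drift_cont [continuous_intros]: "continuous_on S drift"
  unfolding drift_def by (intro continuous_intros)

lemma comp_V_cont: "continuous_on {0..} g \<Longrightarrow> continuous_on S (\<lambda>z. g (V z))"
  by (rule continuous_on_compose2[of "{0..}" g]) (auto intro: V_cont)

lemma gen_cont: "continuous_on {0..} f1 \<Longrightarrow> continuous_on {0..} f2 \<Longrightarrow> continuous_on S (gen f1 f2)"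
  unfolding gen_def by (intro continuous_intros comp_V_cont)

lemma Om_bound:
  obtains \<kappa> where "\<kappa> > 0" "\<And>x. norm (Om *v x) \<le> \<kappa> * norm x"
  using matrix_norm_bound by blast

end

lemma continuous_bounded_on_cball:
  fixes g :: "real^'n \<Rightarrow> real"
  assumes "continuous_on UNIV g"
  obtains C where "C \<ge> 0" "\<And>z. norm z \<le> N \<Longrightarrow> \<bar>g z\<bar> \<le> C"
proof -
  have "compact (g ` cball 0 N)"
    by (intro compact_continuous_image continuous_on_subset[OF assms]) auto
  then obtain C where "\<And>y. y \<in> g ` cball 0 N \<Longrightarrow> norm y \<le> C"
    using compact_imp_bounded bounded_iff by metis
  then have "norm z \<le> N \<Longrightarrow> \<bar>g z\<bar> \<le> max C 0" for z by force
  then show ?thesis by (intro that[of "max C 0"]) auto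
qed

locale reflection_test = reflection_data A Om R mu c + test_function f f1 f2 K
  for A Om R :: "real^'n^'n" and mu c f f1 f2 K
begin

text \<open>The Taylor polynomial of degree two in \<open>b\<close>, not in the increment of
  \<open>V\<close>: the terms of degree three and four contained in the square of that increment are
  left to the remainder.\<close>

definition taylor_part :: "real^'n \<Rightarrow> real^'n \<Rightarrow> real" where
  "taylor_part z b = f1 (V z) * (2 * ((Om *v z) \<bullet> b) + b \<bullet> (Om *v b)) + 2 * f2 (V z) * ((Om *v z) \<bullet> b)\<^sup>2"

text \<open>Small increments obey a uniform second-order expansion with a factor
  \<open>\<eta>\<close>; for large ones every term is at most a multiple of \<open>|b|^4\<close>.
  The split matters because the mean of \<open>\<eta> |b|^2\<close> sums to a small total over a
  grid, while that of \<open>|b|^4\<close> is of order \<open>h^2\<close> per step.\<close>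

lemma taylor_V:
  assumes N: "N \<ge> 0" and \<eta>: "\<eta> > 0"
  obtains C where "C \<ge> 0" "\<And>z b. norm z \<le> N \<Longrightarrow>
    \<bar>f (V (z + b)) - f (V z) - taylor_part z b\<bar> \<le> \<eta> * (norm b)\<^sup>2 + C * (norm b)^4"
proof -
  obtain \<kappa> where \<kappa>: "\<kappa> > 0" "\<And>x. norm (Om *v x) \<le> \<kappa> * norm x" by (rule Om_bound) blast
  obtain F2 where F2: "F2 \<ge> 0" "\<And>z. norm z \<le> N \<Longrightarrow> \<bar>f2 (V z)\<bar> \<le> F2"
    using continuous_bounded_on_cball[OF comp_V_cont[OF cont2]] by metis
  obtain W where W: "W \<ge> 0" "\<And>z. norm z \<le> N \<Longrightarrow> \<bar>V z\<bar> \<le> W"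
    using continuous_bounded_on_cball[OF V_cont] by metis
  \<comment> \<open>For \<open>|b| \<le> 1\<close> the increment of \<open>V\<close> is at most
    \<open>p * |b|\<close>.\<close>
  define p where "p = 2 * \<kappa> * N + \<kappa>"
  have p: "p > 0" using \<kappa> N by (simp add: p_def add_nonneg_pos)
  have "\<eta> / (2 * p\<^sup>2) > 0" using \<eta> p by simp
  from taylor2[OF this, of W] obtain \<delta> where \<delta>: "\<delta> > 0"
    "\<And>v a. 0 \<le> v \<Longrightarrow> v \<le> W \<Longrightarrow> 0 \<le> v + a \<Longrightarrow> \<bar>a\<bar> \<le> \<delta> \<Longrightarrow>
    \<bar>f (v + a) - f v - f1 v * a - f2 v * a\<^sup>2 / 2\<bar> \<le> \<eta> / (2 * p\<^sup>2) * a\<^sup>2" by blast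
  \<comment> \<open>The discarded terms of degree three and four are at most
    \<open>q * |b|^3\<close> for \<open>|b| \<le> 1\<close>.\<close>
  define q where "q = F2 * (2 * \<kappa>\<^sup>2 * N + \<kappa>\<^sup>2) + 1"
  have q: "q > 0" using F2 \<kappa> N by (simp add: q_def add_nonneg_pos)
  \<comment> \<open>\<open>\<delta> / p\<close> keeps the increment of \<open>V\<close> in the range
    of the scalar expansion; \<open>\<eta> / (2 * q)\<close> lets the discarded terms cost at most
    half of \<open>\<eta> |b|^2\<close>.\<close>
  define \<beta> where "\<beta> = min 1 (min (\<delta> / p) (\<eta> / (2 * q)))"
  have \<beta>: "\<beta> > 0" "\<beta> \<le> 1" "p * \<beta> \<le> \<delta>" "q * \<beta> \<le> \<eta> / 2"
  proof -
    show "\<beta> > 0" "\<beta> \<le> 1" using \<delta> p q \<eta> by (auto simp: \<beta>_def)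
    have "\<beta> \<le> \<delta> / p" "\<beta> \<le> \<eta> / (2 * q)" by (auto simp: \<beta>_def)
    then show "p * \<beta> \<le> \<delta>" "q * \<beta> \<le> \<eta> / 2" using p q by (auto simp: field_simps)
  qed
  \<comment> \<open>For \<open>|b| > \<beta>\<close> the constant, linear and quadratic terms are
    traded for \<open>|b|^4\<close>, at the price of \<open>\<beta>^-4\<close>,
    \<open>\<beta>^-3\<close> and \<open>\<beta>^-2\<close>.\<close>
  define C where "C = 2 * K / \<beta>^4 + 2 * K * \<kappa> * N / \<beta>^3 + (K * \<kappa> + 2 * F2 * (\<kappa> * N)\<^sup>2) / \<beta>\<^sup>2"
  have C: "C \<ge> 0" unfolding C_def using K_nonneg F2 N \<kappa> \<beta> by (intro add_nonneg_nonneg divide_nonneg_nonneg) auto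
  show ?thesis
  proof (rule that[OF C])
    fix z b :: "real^'n" assume z: "norm z \<le> N"
    define r where "r = norm b"
    have r: "r \<ge> 0" by (simp add: r_def)
    define x where "x = (Om *v z) \<bullet> b"
    define y where "y = b \<bullet> (Om *v b)"
    define v where "v = V z"
    have x: "\<bar>x\<bar> \<le> \<kappa> * N * r"
    proof -
      have "\<bar>x\<bar> \<le> norm (Om *v z) * r" unfolding x_def r_def by (rule Cauchy_Schwarz_ineq2)
      also have "\<dots> \<le> (\<kappa> * norm z) * r" using \<kappa>(2) r by (intro mult_right_mono)
      also have "\<dots> \<le> \<kappa> * N * r" using z \<kappa>(1) r by (intro mult_right_mono mult_left_mono) auto
      finally show ?thesis .
    qed
    have y: "\<bar>y\<bar> \<le> \<kappa> * r\<^sup>2"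
    proof -
      have "\<bar>y\<bar> \<le> r * norm (Om *v b)" unfolding y_def r_def by (rule Cauchy_Schwarz_ineq2)
      also have "\<dots> \<le> r * (\<kappa> * r)" using \<kappa>(2)[of b] r by (intro mult_left_mono) (auto simp: r_def)
      finally show ?thesis by (simp add: power2_eq_square mult_ac)
    qed
    have x2: "x\<^sup>2 \<le> (\<kappa> * N)\<^sup>2 * r\<^sup>2"
      using power_mono[OF x, of 2] by (simp add: power_mult_distrib)
    have vb: "V (z + b) = v + (2 * x + y)" "0 \<le> v" "v \<le> W" "\<bar>f2 v\<bar> \<le> F2"
      using W(2)[OF z] F2(2)[OF z] by (auto simp: V_add v_def x_def y_def)
    have vb2: "0 \<le> v + (2 * x + y)" using V_nonneg[of "z+b"] unfolding vb(1) .
    have T: "taylor_part z b = f1 v * (2 * x + y) + 2 * f2 v * x\<^sup>2"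
      by (simp add: taylor_part_def v_def x_def y_def)
    show "\<bar>f (V (z + b)) - f (V z) - taylor_part z b\<bar> \<le> \<eta> * (norm b)\<^sup>2 + C * (norm b)^4"
    proof (cases "r \<le> \<beta>")
      case True
      then have r1: "r \<le> 1" using \<beta> by simp
      have r2: "r\<^sup>2 \<le> r" using r r1 power_decreasing[of 1 2 r] by simp
      have "\<bar>2 * x + y\<bar> \<le> 2 * (\<kappa> * N * r) + \<kappa> * r\<^sup>2" using x y by linarith
      also have "\<dots> \<le> 2 * (\<kappa> * N * r) + \<kappa> * r" using r2 \<kappa>(1) by simp
      finally have a: "\<bar>2 * x + y\<bar> \<le> p * r" by (simp add: p_def algebra_simps)
      also have "\<dots> \<le> p * \<beta>" using True p by simp
      finally have "\<bar>2 * x + y\<bar> \<le> \<delta>" using \<beta> by linarith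
      from \<delta>(2)[OF vb(2,3) vb2 this]
      have 1: "\<bar>f (v + (2 * x + y)) - f v - f1 v * (2 * x + y) - f2 v * (2 * x + y)\<^sup>2 / 2\<bar> \<le> \<eta> / (2 * p\<^sup>2) * (2 * x + y)\<^sup>2" .
      also have "\<dots> \<le> \<eta> / (2 * p\<^sup>2) * (p * r)\<^sup>2"
        using power_mono[OF a, of 2] \<eta> p by (intro mult_left_mono) auto
      also have "\<dots> = \<eta> / 2 * r\<^sup>2" using p by (simp add: field_simps)
      finally have 1: "\<bar>f (v + (2 * x + y)) - f v - f1 v * (2 * x + y) - f2 v * (2 * x + y)\<^sup>2 / 2\<bar> \<le> \<eta> / 2 * r\<^sup>2" .
      have "\<bar>4 * x * y + y\<^sup>2\<bar> \<le> 4 * (\<kappa> * N * r) * (\<kappa> * r\<^sup>2) + (\<kappa> * r\<^sup>2) * (\<kappa> * r\<^sup>2)"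
      proof -
        have "\<bar>x\<bar> * \<bar>y\<bar> \<le> (\<kappa> * N * r) * (\<kappa> * r\<^sup>2)" by (rule mult_mono[OF x y]) (use \<kappa> N r in auto)
        moreover have "\<bar>y\<bar> * \<bar>y\<bar> \<le> (\<kappa> * r\<^sup>2) * (\<kappa> * r\<^sup>2)" by (rule mult_mono[OF y y]) (use \<kappa> r in auto)
        moreover have "\<bar>4 * x * y + y\<^sup>2\<bar> \<le> 4 * (\<bar>x\<bar> * \<bar>y\<bar>) + \<bar>y\<bar> * \<bar>y\<bar>"
          using abs_triangle_ineq[of "4 * x * y" "y\<^sup>2"] by (simp add: abs_mult power2_eq_square)
        ultimately show ?thesis by linarith
      qed
      also have "\<dots> = (4 * \<kappa>\<^sup>2 * N + \<kappa>\<^sup>2 * r) * (r * r\<^sup>2)" by (simp add: power2_eq_square algebra_simps)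
      also have "\<dots> \<le> 2 * (2 * \<kappa>\<^sup>2 * N + \<kappa>\<^sup>2) * (r * r\<^sup>2)"
      proof (rule mult_right_mono)
        have "\<kappa>\<^sup>2 * r \<le> \<kappa>\<^sup>2 * 1" using r1 by (rule mult_left_mono) simp
        also have "\<kappa>\<^sup>2 * 1 \<le> 2 * \<kappa>\<^sup>2" by simp
        finally have "\<kappa>\<^sup>2 * r \<le> 2 * \<kappa>\<^sup>2" .
        then show "4 * \<kappa>\<^sup>2 * N + \<kappa>\<^sup>2 * r \<le> 2 * (2 * \<kappa>\<^sup>2 * N + \<kappa>\<^sup>2)" by (simp add: algebra_simps)
      qed (use r in simp)
      finally have xy: "\<bar>4 * x * y + y\<^sup>2\<bar> \<le> 2 * (2 * \<kappa>\<^sup>2 * N + \<kappa>\<^sup>2) * (r * r\<^sup>2)" .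
      have "\<bar>f2 v * (2 * x + y)\<^sup>2 / 2 - 2 * f2 v * x\<^sup>2\<bar> = \<bar>f2 v\<bar> * \<bar>4 * x * y + y\<^sup>2\<bar> / 2"
      proof -
        have "f2 v * (2 * x + y)\<^sup>2 / 2 - 2 * f2 v * x\<^sup>2 = f2 v * (4 * x * y + y\<^sup>2) / 2"
          by (simp add: power2_eq_square field_simps)
        then show ?thesis by (simp only: abs_divide abs_mult abs_numeral)
      qed
      also have "\<dots> \<le> F2 * (2 * (2 * \<kappa>\<^sup>2 * N + \<kappa>\<^sup>2) * (r * r\<^sup>2)) / 2"
        using vb(4) xy F2(1) by (intro divide_right_mono mult_mono) auto
      also have "\<dots> = (F2 * (2 * \<kappa>\<^sup>2 * N + \<kappa>\<^sup>2)) * (r * r\<^sup>2)" by simp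
      also have "\<dots> \<le> q * (r * r\<^sup>2)" using r by (intro mult_right_mono) (auto simp: q_def)
      also have "\<dots> \<le> (q * \<beta>) * r\<^sup>2" using True q r by (simp add: mult_left_mono mult_right_mono)
      also have "\<dots> \<le> \<eta> / 2 * r\<^sup>2" using \<beta> by (intro mult_right_mono) auto
      finally have 2: "\<bar>f2 v * (2 * x + y)\<^sup>2 / 2 - 2 * f2 v * x\<^sup>2\<bar> \<le> \<eta> / 2 * r\<^sup>2" .
      have 3: "C * r^4 \<ge> 0" using C r by simp
      have 4: "\<bar>D + E\<bar> \<le> \<eta> * r\<^sup>2 + C * r^4" if "\<bar>D\<bar> \<le> \<eta> / 2 * r\<^sup>2" "\<bar>E\<bar> \<le> \<eta> / 2 * r\<^sup>2" for D E
        using that 3 by linarith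
      show ?thesis
        unfolding T vb(1) v_def[symmetric] r_def[symmetric]
        using 4[OF 1 2] by (simp add: diff_diff_eq)
    next
      case False
      then have rb: "r / \<beta> \<ge> 1" using \<beta> by (simp add: field_simps)
      have pw: "r^j \<le> r^4 / \<beta>^(4-j)" if "j \<le> 4" for j
      proof -
        have "r^j * 1 \<le> r^j * (r / \<beta>)^(4-j)" using rb r by (intro mult_left_mono one_le_power) auto
        also have "\<dots> = r^4 / \<beta>^(4-j)" using that by (simp add: power_divide flip: power_add)
        finally show ?thesis by simp
      qed
      have pw0: "1 \<le> r^4 / \<beta>^4" and pw1: "r \<le> r^4 / \<beta>^3" and pw2: "r\<^sup>2 \<le> r^4 / \<beta>\<^sup>2"
        using pw[of 0] pw[of 1] pw[of 2] by auto
      have 1: "\<bar>f1 v * (2 * x + y)\<bar> \<le> K * (2 * (\<kappa> * N * r) + \<kappa> * r\<^sup>2)"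
        unfolding abs_mult using bound1[OF vb(2)] x y K_nonneg by (intro mult_mono) auto
      have 2: "\<bar>2 * f2 v * x\<^sup>2\<bar> \<le> 2 * F2 * ((\<kappa> * N)\<^sup>2 * r\<^sup>2)"
        unfolding abs_mult using x2 vb(4) F2 by (intro mult_mono) auto
      have 3: "\<bar>f (v + (2 * x + y))\<bar> \<le> K" "\<bar>f v\<bar> \<le> K" using bound0 vb vb2 by auto
      have "\<bar>f (V (z + b)) - f (V z) - taylor_part z b\<bar> \<le> 2 * K * 1 + 2 * K * \<kappa> * N * r + (K * \<kappa> + 2 * F2 * (\<kappa> * N)\<^sup>2) * r\<^sup>2"
      proof -
        have "\<bar>a - a' - (p + q)\<bar> \<le> \<bar>a\<bar> + \<bar>a'\<bar> + \<bar>p\<bar> + \<bar>q\<bar>" for a a' p q :: real by linarith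
        then have "\<bar>f (V (z + b)) - f (V z) - taylor_part z b\<bar>
            \<le> K + K + K * (2 * (\<kappa> * N * r) + \<kappa> * r\<^sup>2) + 2 * F2 * ((\<kappa> * N)\<^sup>2 * r\<^sup>2)"
          unfolding T vb(1) v_def[symmetric] using 1 2 3 by (meson add_mono order_trans)
        then show ?thesis by (simp add: algebra_simps)
      qed
      also have "\<dots> \<le> 2 * K * (r^4 / \<beta>^4) + 2 * K * \<kappa> * N * (r^4 / \<beta>^3) + (K * \<kappa> + 2 * F2 * (\<kappa> * N)\<^sup>2) * (r^4 / \<beta>\<^sup>2)"
        using K_nonneg \<kappa> N F2 by (intro add_mono mult_left_mono pw0 pw1 pw2) auto
      also have "\<dots> = C * r^4" by (simp add: C_def algebra_simps add_divide_distrib)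
      also have "\<dots> \<le> \<eta> * r\<^sup>2 + C * r^4" using \<eta> by simp
      finally show ?thesis by (simp add: r_def)
    qed
  qed
qed

text \<open>Gradient and, in \<open>quad_coeff\<close>, half the Hessian of \<open>f\<close>
  composed with \<open>V\<close>, by coordinates so that each coefficient multiplies a monomial in
  the increment.\<close>

definition lin_coeff :: "'n \<Rightarrow> real^'n \<Rightarrow> real" where
  "lin_coeff k z = 2 * f1 (V z) * (Om *v z) $ k"
definition quad_coeff :: "'n \<Rightarrow> 'n \<Rightarrow> real^'n \<Rightarrow> real" where
  "quad_coeff k l z = f1 (V z) * Om $ k $ l + 2 * f2 (V z) * (Om *v z) $ k * (Om *v z) $ l"

lemma taylor_part_coeff:
  "taylor_part z b = (\<Sum>k\<in>UNIV. lin_coeff k z * b $ k)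
     + (\<Sum>k\<in>UNIV. \<Sum>l\<in>UNIV. quad_coeff k l z * (b $ k * b $ l))"
proof -
  have 1: "b \<bullet> (Om *v b) = (\<Sum>k\<in>UNIV. \<Sum>l\<in>UNIV. Om $ k $ l * (b $ k * b $ l))"
    by (simp add: inner_vec_def matrix_vector_mult_def sum_distrib_left mult_ac)
  have 2: "((Om *v z) \<bullet> b)\<^sup>2 = (\<Sum>k\<in>UNIV. \<Sum>l\<in>UNIV. (Om *v z) $ k * (Om *v z) $ l * (b $ k * b $ l))"
    by (simp add: inner_vec_def power2_eq_square sum_product mult_ac)
  have 3: "(Om *v z) \<bullet> b = (\<Sum>k\<in>UNIV. (Om *v z) $ k * b $ k)" by (simp add: inner_vec_def)
  show ?thesis
    unfolding taylor_part_def 2 1 unfolding 3 lin_coeff_def quad_coeff_def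
    by (simp add: sum_distrib_left distrib_left distrib_right sum.distrib mult_ac)
qed

lemma gen_coeff:
  "gen f1 f2 z = (\<Sum>k\<in>UNIV. lin_coeff k z * mu $ k) + (\<Sum>k\<in>UNIV. \<Sum>l\<in>UNIV. quad_coeff k l z * A $ k $ l)"
proof -
  have symA: "A $ l $ k = A $ k $ l" for k l
    using A_spd unfolding sym_pos_def_def transpose_def by (metis vec_lambda_beta)
  have 1: "trace (Om ** A) = (\<Sum>k\<in>UNIV. \<Sum>l\<in>UNIV. Om $ k $ l * A $ k $ l)"
    by (simp add: trace_def matrix_matrix_mult_def symA[of _ _])
  have 2: "Q z = (\<Sum>k\<in>UNIV. \<Sum>l\<in>UNIV. (Om *v z) $ k * (Om *v z) $ l * A $ k $ l)"
    unfolding Q_def inner_vec_def by (subst matrix_vector_mult_def) (simp add: sum_distrib_left mult_ac)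
  have 3: "(Om *v z) \<bullet> mu = (\<Sum>k\<in>UNIV. (Om *v z) $ k * mu $ k)" by (simp add: inner_vec_def)
  show ?thesis
    unfolding gen_def drift_def 1 2 3 lin_coeff_def quad_coeff_def
    by (simp add: sum_distrib_left distrib_left distrib_right sum.distrib mult_ac)
qed

lemma coeff_cont: "continuous_on S (lin_coeff k)" "continuous_on S (quad_coeff k l)"
  unfolding lin_coeff_def quad_coeff_def
  by (intro continuous_intros comp_V_cont cont1 cont2)+

end

section \<open>Expected change over one unreflected step\<close>

locale reflection_brownian = reflection_test A Om R mu c f f1 f2 K + brownian M F mu A z0 B
  for A Om R :: "real^'n^'n" and mu c f f1 f2 K and M :: "'a measure" and F z0 B
begin

text \<open>The step starts from an arbitrary point known at time \<open>s\<close> and adds a free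
  Brownian increment; \<open>E\<close> carries the stopping decision. Over \<open>n\<close> steps of
  length \<open>T / n\<close> the errors add up to \<open>\<eta> T + C T^2 / n\<close>.\<close>

lemma one_step:
  assumes N: "N \<ge> 0" and \<eta>: "\<eta> > 0"
  obtains C where "C \<ge> 0"
    "\<And>s t E Z. 0 \<le> s \<Longrightarrow> s < t \<Longrightarrow> t - s \<le> 1 \<Longrightarrow> E \<in> sets (F s) \<Longrightarrow> Z \<in> borel_measurable (F s) \<Longrightarrow>
      (\<And>\<omega>. \<omega> \<in> E \<Longrightarrow> norm (Z \<omega>) \<le> N) \<Longrightarrow>
      \<bar>expectation (\<lambda>\<omega>. indicator E \<omega> * (f (V (Z \<omega> + (B t \<omega> - B s \<omega>))) - f (V (Z \<omega>)) - (t - s) * gen f1 f2 (Z \<omega>)))\<bar>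
      \<le> \<eta> * (t - s) + C * (t - s)\<^sup>2"
proof -
  obtain Cb where Cb: "Cb > 0" "\<And>s t. 0 \<le> s \<Longrightarrow> s < t \<Longrightarrow> t - s \<le> 1 \<Longrightarrow>
      integrable M (\<lambda>\<omega>. (norm (B t \<omega> - B s \<omega>))\<^sup>2) \<and>
      expectation (\<lambda>\<omega>. (norm (B t \<omega> - B s \<omega>))\<^sup>2) \<le> Cb * (t - s) \<and>
      integrable M (\<lambda>\<omega>. (norm (B t \<omega> - B s \<omega>))^4) \<and>
      expectation (\<lambda>\<omega>. (norm (B t \<omega> - B s \<omega>))^4) \<le> Cb * (t - s)\<^sup>2"
    by (rule incr_norm_moments) blast
  \<comment> \<open>Dividing by \<open>Cb\<close> cancels the second moment constant, so that the
    first error becomes \<open>\<eta> * (t - s)\<close>.\<close>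
  have "\<eta> / Cb > 0" using \<eta> Cb by simp
  from taylor_V[OF N this] obtain Ct where Ct: "Ct \<ge> 0" "\<And>z b. norm z \<le> N \<Longrightarrow>
    \<bar>f (V (z + b)) - f (V z) - taylor_part z b\<bar> \<le> \<eta> / Cb * (norm b)\<^sup>2 + Ct * (norm b)^4" by blast
  \<comment> \<open>The surplus of order \<open>(t - s)^2\<close> left by the nonzero mean of the
    increment.\<close>
  define G where "G = (\<lambda>z. \<Sum>k\<in>UNIV. \<Sum>l\<in>UNIV. quad_coeff k l z * mu $ k * mu $ l)"
  have "continuous_on UNIV G" unfolding G_def by (intro continuous_intros coeff_cont)
  then obtain Cg where Cg: "Cg \<ge> 0" "\<And>z. norm z \<le> N \<Longrightarrow> \<bar>G z\<bar> \<le> Cg"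
    by (rule continuous_bounded_on_cball[of _ N]) blast
  have "continuous_on UNIV (\<lambda>z. (\<Sum>k\<in>UNIV. \<bar>lin_coeff k z\<bar>) + (\<Sum>k\<in>UNIV. \<Sum>l\<in>UNIV. \<bar>quad_coeff k l z\<bar>))"
    by (intro continuous_intros coeff_cont)
  then obtain Cq where Cq: "Cq \<ge> 0" "\<And>z. norm z \<le> N \<Longrightarrow>
      \<bar>(\<Sum>k\<in>UNIV. \<bar>lin_coeff k z\<bar>) + (\<Sum>k\<in>UNIV. \<Sum>l\<in>UNIV. \<bar>quad_coeff k l z\<bar>)\<bar> \<le> Cq"
    by (rule continuous_bounded_on_cball[of _ N]) blast
  have Cl: "\<bar>lin_coeff k z\<bar> \<le> Cq" "\<bar>quad_coeff k l z\<bar> \<le> Cq" if "norm z \<le> N" for k l z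
  proof -
    have 1: "\<bar>lin_coeff k z\<bar> \<le> (\<Sum>k\<in>UNIV. \<bar>lin_coeff k z\<bar>)" by (rule member_le_sum) auto
    have "\<bar>quad_coeff k l z\<bar> \<le> (\<Sum>l\<in>UNIV. \<bar>quad_coeff k l z\<bar>)" by (rule member_le_sum) auto
    also have 2: "\<dots> \<le> (\<Sum>k\<in>UNIV. \<Sum>l\<in>UNIV. \<bar>quad_coeff k l z\<bar>)"
      by (rule member_le_sum[of k UNIV "\<lambda>k. \<Sum>l\<in>UNIV. \<bar>quad_coeff k l z\<bar>"]) (auto simp: sum_nonneg)
    finally have 2: "\<bar>quad_coeff k l z\<bar> \<le> (\<Sum>k\<in>UNIV. \<Sum>l\<in>UNIV. \<bar>quad_coeff k l z\<bar>)" .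
    have "0 \<le> (\<Sum>k\<in>UNIV. \<bar>lin_coeff k z\<bar>)" "0 \<le> (\<Sum>k\<in>UNIV. \<Sum>l\<in>UNIV. \<bar>quad_coeff k l z\<bar>)"
      by (auto intro!: sum_nonneg)
    with 1 2 Cq(2)[OF that] show "\<bar>lin_coeff k z\<bar> \<le> Cq" "\<bar>quad_coeff k l z\<bar> \<le> Cq" by linarith+
  qed
  show ?thesis
  proof (rule that[of "Ct * Cb + Cg"])
    show "Ct * Cb + Cg \<ge> 0" using Ct Cb Cg by simp
    fix s t E and Z :: "'a \<Rightarrow> real^'n"
    assume st: "0 \<le> s" "s < t" "t - s \<le> 1" and E: "E \<in> sets (F s)" and Z: "Z \<in> borel_measurable (F s)"
      and EN: "\<And>\<omega>. \<omega> \<in> E \<Longrightarrow> norm (Z \<omega>) \<le> N"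
    define h where "h = t - s"
    have h: "h > 0" "h \<le> 1" using st by (auto simp: h_def)
    let ?b = "\<lambda>\<omega>. B t \<omega> - B s \<omega>"
    define g where "g = (\<lambda>k \<omega>. indicator E \<omega> * lin_coeff k (Z \<omega>) :: real)"
    define H where "H = (\<lambda>k l \<omega>. indicator E \<omega> * quad_coeff k l (Z \<omega>) :: real)"
    have compZ: "(\<lambda>\<omega>. \<phi> (Z \<omega>)) \<in> borel_measurable (F s)" if "continuous_on UNIV \<phi>" for \<phi> :: "real^'n \<Rightarrow> real"
      using measurable_compose[OF Z borel_measurable_continuous_onI[OF that]] .
    have indE: "indicator E \<in> borel_measurable (F s)" using E by simp
    have g: "g k \<in> borel_measurable (F s)" "\<And>\<omega>. \<omega> \<in> space M \<Longrightarrow> \<bar>g k \<omega>\<bar> \<le> Cq" for k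
      subgoal unfolding g_def by (intro borel_measurable_times indE compZ coeff_cont)
      subgoal unfolding g_def using Cl EN Cq(1) by (auto simp: indicator_def)
      done
    have H: "H k l \<in> borel_measurable (F s)" "\<And>\<omega>. \<omega> \<in> space M \<Longrightarrow> \<bar>H k l \<omega>\<bar> \<le> Cq" for k l
      subgoal unfolding H_def by (intro borel_measurable_times indE compZ coeff_cont)
      subgoal unfolding H_def using Cl EN Cq(1) by (auto simp: indicator_def)
      done
    have bM: "?b \<in> borel_measurable M" using B_measurable_M[of s] B_measurable_M[of t] st by simp
    have ZM: "Z \<in> borel_measurable M" using Z by (rule F_measurable_M)
    have EM: "E \<in> sets M" using E F_sub by auto
    define T where "T = (\<lambda>\<omega>. indicator E \<omega> * taylor_part (Z \<omega>) (?b \<omega>) :: real)"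
    have Teq: "T = (\<lambda>\<omega>. (\<Sum>k\<in>UNIV. g k \<omega> * ?b \<omega> $ k) + (\<Sum>k\<in>UNIV. \<Sum>l\<in>UNIV. H k l \<omega> * (?b \<omega> $ k * ?b \<omega> $ l)))"
      unfolding T_def taylor_part_coeff g_def H_def
      by (simp add: sum_distrib_left distrib_left mult.assoc)
    have geneq: "(\<lambda>\<omega>. h * ((\<Sum>k\<in>UNIV. g k \<omega> * mu $ k) + (\<Sum>k\<in>UNIV. \<Sum>l\<in>UNIV. H k l \<omega> * A $ k $ l))
        + h\<^sup>2 * (\<Sum>k\<in>UNIV. \<Sum>l\<in>UNIV. H k l \<omega> * mu $ k * mu $ l))
        = (\<lambda>\<omega>. h * (indicator E \<omega> * gen f1 f2 (Z \<omega>)) + h\<^sup>2 * (indicator E \<omega> * G (Z \<omega>)))"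
      unfolding gen_coeff G_def g_def H_def
      by (simp add: sum_distrib_left distrib_left mult.assoc)
    have qi1: "integrable M T"
      unfolding Teq by (rule quadratic_incr_expectation(1)[OF st(1,2) g H])
    have "expectation T = expectation (\<lambda>\<omega>. h * ((\<Sum>k\<in>UNIV. g k \<omega> * mu $ k) + (\<Sum>k\<in>UNIV. \<Sum>l\<in>UNIV. H k l \<omega> * A $ k $ l))
        + h\<^sup>2 * (\<Sum>k\<in>UNIV. \<Sum>l\<in>UNIV. H k l \<omega> * mu $ k * mu $ l))"
      unfolding Teq h_def by (rule quadratic_incr_expectation(2)[OF st(1,2) g H])
    then have qi2: "expectation T = expectation (\<lambda>\<omega>. h * (indicator E \<omega> * gen f1 f2 (Z \<omega>)) + h\<^sup>2 * (indicator E \<omega> * G (Z \<omega>)))"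
      unfolding geneq .
    have gI: "integrable M (\<lambda>\<omega>. indicator E \<omega> * \<phi> (Z \<omega>))" if \<phi>: "continuous_on UNIV \<phi>" for \<phi> :: "real^'n \<Rightarrow> real"
    proof -
      obtain D where "D \<ge> 0" "\<And>z. norm z \<le> N \<Longrightarrow> \<bar>\<phi> z\<bar> \<le> D"
        using continuous_bounded_on_cball[OF \<phi>] by metis
      then show ?thesis
        using EN F_measurable_M[OF compZ[OF \<phi>]] EM
        by (intro integrable_const_bound[of _ D]) (auto simp: indicator_def intro!: AE_I2)
    qed
    have genI: "integrable M (\<lambda>\<omega>. indicator E \<omega> * gen f1 f2 (Z \<omega>))"
      by (rule gI) (rule gen_cont[OF cont1 cont2])
    have GI: "integrable M (\<lambda>\<omega>. indicator E \<omega> * G (Z \<omega>))"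
      by (rule gI) fact
    have fVc: "continuous_on UNIV (\<lambda>z. f (V z))" by (rule comp_V_cont[OF cont0])
    have f0I: "integrable M (\<lambda>\<omega>. indicator E \<omega> * f (V (Z \<omega>)))" by (rule gI[OF fVc])
    have f1I: "integrable M (\<lambda>\<omega>. indicator E \<omega> * f (V (Z \<omega> + ?b \<omega>)))"
    proof (rule integrable_const_bound[of _ K])
      show "AE x in M. norm (indicator E x * f (V (Z x + ?b x))) \<le> K"
        using bound0 K_nonneg by (auto simp: indicator_def)
      have "(\<lambda>\<omega>. f (V (Z \<omega> + ?b \<omega>))) \<in> borel_measurable M"
        by (rule measurable_compose[OF _ borel_measurable_continuous_onI[OF fVc]]) (use ZM bM in simp)
      then show "(\<lambda>x. indicator E x * f (V (Z x + ?b x))) \<in> borel_measurable M"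
        using EM by simp
    qed
    define Y where "Y = (\<lambda>\<omega>. indicator E \<omega> * (f (V (Z \<omega> + ?b \<omega>)) - f (V (Z \<omega>)) - taylor_part (Z \<omega>) (?b \<omega>)))"
    have Yeq: "Y = (\<lambda>\<omega>. indicator E \<omega> * f (V (Z \<omega> + ?b \<omega>)) - indicator E \<omega> * f (V (Z \<omega>)) - T \<omega>)"
      by (simp add: Y_def T_def algebra_simps)
    have YI: "integrable M Y" unfolding Yeq by (intro Bochner_Integration.integrable_diff f1I f0I qi1)
    have bI: "integrable M (\<lambda>\<omega>. (norm (?b \<omega>))\<^sup>2)" "expectation (\<lambda>\<omega>. (norm (?b \<omega>))\<^sup>2) \<le> Cb * h"
      "integrable M (\<lambda>\<omega>. (norm (?b \<omega>))^4)" "expectation (\<lambda>\<omega>. (norm (?b \<omega>))^4) \<le> Cb * h\<^sup>2"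
      using Cb(2)[OF st] by (auto simp: h_def)
    have "\<bar>expectation Y\<bar> \<le> expectation (\<lambda>\<omega>. \<bar>Y \<omega>\<bar>)" by (rule integral_abs_bound)
    also have "\<dots> \<le> expectation (\<lambda>\<omega>. \<eta> / Cb * (norm (?b \<omega>))\<^sup>2 + Ct * (norm (?b \<omega>))^4)"
    proof (rule integral_mono)
      show "\<bar>Y \<omega>\<bar> \<le> \<eta> / Cb * (norm (?b \<omega>))\<^sup>2 + Ct * (norm (?b \<omega>))^4" for \<omega>
        using Ct EN \<eta> Cb(1) by (auto simp: Y_def indicator_def)
    qed (use YI bI in auto)
    also have "\<dots> = \<eta> / Cb * expectation (\<lambda>\<omega>. (norm (?b \<omega>))\<^sup>2) + Ct * expectation (\<lambda>\<omega>. (norm (?b \<omega>))^4)"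
      using bI by simp
    also have "\<dots> \<le> \<eta> / Cb * (Cb * h) + Ct * (Cb * h\<^sup>2)"
      using \<eta> Cb(1) Ct(1) bI by (intro add_mono mult_left_mono) auto
    finally have 1: "\<bar>expectation Y\<bar> \<le> \<eta> * h + Ct * Cb * h\<^sup>2" using Cb(1) by simp
    have "\<bar>expectation (\<lambda>\<omega>. indicator E \<omega> * G (Z \<omega>))\<bar> \<le> expectation (\<lambda>\<omega>. \<bar>indicator E \<omega> * G (Z \<omega>)\<bar>)"
      by (rule integral_abs_bound)
    also have "\<dots> \<le> expectation (\<lambda>\<omega>. Cg)"
      by (rule integral_mono) (use GI Cg EN in \<open>auto simp: indicator_def\<close>)
    finally have 2: "\<bar>expectation (\<lambda>\<omega>. indicator E \<omega> * G (Z \<omega>))\<bar> \<le> Cg" by (simp add: prob_space)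
    have "expectation (\<lambda>\<omega>. indicator E \<omega> * (f (V (Z \<omega> + ?b \<omega>)) - f (V (Z \<omega>)) - h * gen f1 f2 (Z \<omega>)))
        = expectation (\<lambda>\<omega>. Y \<omega> + (T \<omega> - h * (indicator E \<omega> * gen f1 f2 (Z \<omega>))))"
      by (intro Bochner_Integration.integral_cong) (auto simp: Y_def T_def algebra_simps)
    also have "\<dots> = expectation Y + (expectation T - h * expectation (\<lambda>\<omega>. indicator E \<omega> * gen f1 f2 (Z \<omega>)))"
      using YI qi1 genI by simp
    also have "\<dots> = expectation Y + h\<^sup>2 * expectation (\<lambda>\<omega>. indicator E \<omega> * G (Z \<omega>))"
      unfolding qi2 using genI GI by simp
    finally have "\<bar>expectation (\<lambda>\<omega>. indicator E \<omega> * (f (V (Z \<omega> + ?b \<omega>)) - f (V (Z \<omega>)) - h * gen f1 f2 (Z \<omega>)))\<bar>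
       \<le> \<bar>expectation Y\<bar> + \<bar>h\<^sup>2 * expectation (\<lambda>\<omega>. indicator E \<omega> * G (Z \<omega>))\<bar>" by linarith
    also have "\<dots> \<le> (\<eta> * h + Ct * Cb * h\<^sup>2) + h\<^sup>2 * Cg"
      using 1 2 by (intro add_mono) (auto simp: abs_mult mult_left_mono)
    finally show "\<bar>expectation (\<lambda>\<omega>. indicator E \<omega> * (f (V (Z \<omega> + ?b \<omega>)) - f (V (Z \<omega>)) - (t - s) * gen f1 f2 (Z \<omega>)))\<bar>
      \<le> \<eta> * (t - s) + (Ct * Cb + Cg) * (t - s)\<^sup>2" by (simp add: h_def algebra_simps)
  qed
qed

end

section \<open>The discrete Dynkin formula\<close>

lemma interval_modulus:
  fixes g :: "real \<Rightarrow> 'b::metric_space"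
  assumes "continuous_on {a..b} g" and "\<rho> > 0"
  obtains d where "d > 0" "\<And>u v. u \<in> {a..b} \<Longrightarrow> v \<in> {a..b} \<Longrightarrow> \<bar>v - u\<bar> < d \<Longrightarrow> dist (g v) (g u) < \<rho>"
proof -
  have "uniformly_continuous_on {a..b} g" using assms(1) by (rule compact_uniformly_continuous) simp
  then have "\<exists>d>0. \<forall>u\<in>{a..b}. \<forall>v\<in>{a..b}. dist v u < d \<longrightarrow> dist (g v) (g u) < \<rho>"
    using assms(2) unfolding uniformly_continuous_on_def by (elim allE[of _ \<rho>]) simp
  then show ?thesis using that by (auto simp: dist_real_def)
qed

text \<open>Before the last localised step the increments telescope against \<open>l\<close>; the single step that
  leaves the localisation region is only controlled by \<open>D\<close>.\<close>
lemma localized_sum_bound: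
  fixes l d :: "nat \<Rightarrow> real"
  assumes "\<And>j. P j \<Longrightarrow> l j \<le> N" and "\<And>j. P j \<Longrightarrow> P (Suc j) \<Longrightarrow> d j \<le> a * (l (Suc j) - l j)"
    and "\<And>j. d j \<le> D" and "0 \<le> l 0" "0 \<le> a" "0 \<le> D" "0 \<le> N"
  shows "(\<Sum>i<m. if \<forall>j\<le>i. P j then d i else 0) \<le> a * N + D"
proof -
  \<comment> \<open>Strengthened for the induction: while the condition holds the bound follows
    \<open>l m\<close>; at the first failure it switches to the final value and stays there, since
    all later terms vanish.\<close>
  have "(\<Sum>i<m. if \<forall>j\<le>i. P j then d i else 0) \<le> (if \<forall>j\<le>m. P j then a * l m else a * N + D)"
  proof (induction m)
    case 0
    then show ?case using assms by auto
  next
    case (Suc m)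
    show ?case
    proof (cases "\<forall>j\<le>m. P j")
      case True
      then have IH: "(\<Sum>i<m. if \<forall>j\<le>i. P j then d i else 0) \<le> a * l m" using Suc by simp
      show ?thesis
      proof (cases "P (Suc m)")
        case True2: True
        then have "\<forall>j\<le>Suc m. P j" using True by (simp add: le_Suc_eq)
        moreover have "d m \<le> a * (l (Suc m) - l m)" using True True2 by (intro assms(2)) auto
        ultimately show ?thesis using IH True by (simp add: right_diff_distrib)
      next
        case False
        have "a * l m \<le> a * N" using True assms(1,5) by (intro mult_left_mono) auto
        with False show ?thesis using IH True assms(3)[of m] by auto
      qed
    next
      case False
      then have "\<not> (\<forall>j\<le>Suc m. P j)" using le_SucI by blast
      have "(\<Sum>i<m. if \<forall>j\<le>i. P j then d i else 0) \<le> a * N + D"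
        using Suc unfolding if_not_P[OF False] .
      then show ?thesis
        unfolding if_not_P[OF \<open>\<not> (\<forall>j\<le>Suc m. P j)\<close>] sum.lessThan_Suc if_not_P[OF False] by simp
    qed
  qed
  also have "\<dots> \<le> a * N + D" using assms(1)[of m] assms(5,6) by (auto intro: add_increasing2 mult_left_mono)
  finally show ?thesis .
qed

section \<open>Reflected paths and the error made at the boundary\<close>

locale reflected = reflection_data A Om R mu c + brownian M F mu A z0 B
  for A Om R :: "real^'n^'n" and mu c and M :: "'a measure" and F z0 B +
  fixes Z L :: "real \<Rightarrow> 'a \<Rightarrow> real^'n"
  assumes Z_adapted: "adapted_cont F (space M) Z" and L_adapted: "adapted_cont F (space M) L"
    and Z_orthant: "\<And>t \<omega>. t \<ge> 0 \<Longrightarrow> \<omega> \<in> space M \<Longrightarrow> Z t \<omega> \<in> orthant"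
    and Z_eq: "\<And>t \<omega>. t \<ge> 0 \<Longrightarrow> \<omega> \<in> space M \<Longrightarrow> Z t \<omega> = B t \<omega> + R *v L t \<omega>"
    and L_0: "\<And>\<omega> k. \<omega> \<in> space M \<Longrightarrow> L 0 \<omega> $ k = 0"
    and L_mono: "\<And>\<omega> k s t. \<omega> \<in> space M \<Longrightarrow> 0 \<le> s \<Longrightarrow> s \<le> t \<Longrightarrow> L s \<omega> $ k \<le> L t \<omega> $ k"
    and L_compl: "\<And>\<omega> k. \<omega> \<in> space M \<Longrightarrow> (\<integral>\<^sup>+ t. ennreal (indicator {0..} t * Z t \<omega> $ k)
              \<partial>interval_measure (\<lambda>t. L (max t 0) \<omega> $ k)) = 0"
begin

text \<open>Total pushing on all faces: its increments dominate the norm of those of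
  \<open>L\<close>, and they telescope.\<close>

definition ell :: "real \<Rightarrow> 'a \<Rightarrow> real" where "ell t \<omega> = (\<Sum>k\<in>UNIV. L t \<omega> $ k)"

lemma Z_measurable: "t \<ge> 0 \<Longrightarrow> Z t \<in> borel_measurable (F t)"
  using Z_adapted unfolding adapted_cont_def by auto

lemma ell_measurable: "t \<ge> 0 \<Longrightarrow> ell t \<in> borel_measurable (F t)"
proof -
  assume "t \<ge> 0"
  then have "L t \<in> borel_measurable (F t)" using L_adapted unfolding adapted_cont_def by auto
  then have "(\<lambda>\<omega>. L t \<omega> $ k) \<in> borel_measurable (F t)" for k
    by (rule measurable_compose) (intro borel_measurable_continuous_onI continuous_intros)
  then show ?thesis unfolding ell_def by (intro borel_measurable_sum)
qed

lemma Z_path: "\<omega> \<in> space M \<Longrightarrow> continuous_on {0..} (\<lambda>t. Z t \<omega>)"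
  using Z_adapted unfolding adapted_cont_def by auto

lemma L_path: "\<omega> \<in> space M \<Longrightarrow> continuous_on {0..} (\<lambda>t. L t \<omega>)"
  using L_adapted unfolding adapted_cont_def by auto

lemma ell_path: "\<omega> \<in> space M \<Longrightarrow> continuous_on {0..} (\<lambda>t. ell t \<omega>)"
  unfolding ell_def by (intro continuous_intros L_path)

lemma ell_mono: "\<omega> \<in> space M \<Longrightarrow> 0 \<le> s \<Longrightarrow> s \<le> t \<Longrightarrow> ell s \<omega> \<le> ell t \<omega>"
  unfolding ell_def by (intro sum_mono L_mono)

lemma ell_nonneg: "\<omega> \<in> space M \<Longrightarrow> 0 \<le> t \<Longrightarrow> 0 \<le> ell t \<omega>"
  using ell_mono[of \<omega> 0 t] L_0 by (simp add: ell_def)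

text \<open>If \<open>Z_k\<close> stayed at or above some \<open>m > 0\<close> on
  \<open>[s, t]\<close>, the complementarity integral would be at least \<open>m\<close> times the
  growth of \<open>L_k\<close>. Continuity of \<open>L_k\<close> identifies the Stieltjes mass of
  the half-open interval with that growth.\<close>

lemma L_grows_on_face:
  assumes \<omega>: "\<omega> \<in> space M" and st: "0 \<le> s" "s \<le> t" and grow: "L s \<omega> $ k < L t \<omega> $ k"
  shows "\<exists>u\<in>{s..t}. Z u \<omega> $ k = 0"
proof (rule ccontr)
  assume "\<not> ?thesis"
  then have pos: "Z u \<omega> $ k > 0" if "u \<in> {s..t}" for u
    using Z_orthant[of u \<omega>] \<omega> st that by (force simp: orthant_def le_less)
  have "continuous_on {s..t} (\<lambda>u. Z u \<omega> $ k)"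
    by (intro continuous_on_component continuous_on_subset[OF Z_path[OF \<omega>]]) (use st in auto)
  moreover have "{s..t} \<noteq> {}" using st by auto
  ultimately obtain v where v: "v \<in> {s..t}" "\<And>u. u \<in> {s..t} \<Longrightarrow> Z v \<omega> $ k \<le> Z u \<omega> $ k"
    using continuous_attains_inf[of "{s..t}" "\<lambda>u. Z u \<omega> $ k"] by auto
  define m where "m = Z v \<omega> $ k"
  have m: "m > 0" using pos v by (simp add: m_def)
  let ?F = "\<lambda>t. L (max t 0) \<omega> $ k"
  have monoF: "?F x \<le> ?F y" if "x \<le> y" for x y using that by (intro L_mono \<omega>) auto
  have "continuous_on UNIV ?F"
    by (intro continuous_on_component continuous_on_compose2[OF L_path[OF \<omega>]] continuous_intros) auto
  then have "isCont ?F a" for a by (simp add: continuous_on_eq_continuous_at)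
  then have contF: "continuous (at_right a) ?F" for a by (rule continuous_at_imp_continuous_at_within)
  have "ennreal m * ennreal (?F t - ?F s) = ennreal m * emeasure (interval_measure ?F) {s<..t}"
    by (subst emeasure_interval_measure_Ioc[OF st(2) monoF contF]) auto
  also have "\<dots> = (\<integral>\<^sup>+ u. ennreal m * indicator {s<..t} u \<partial>interval_measure ?F)"
    by (subst nn_integral_cmult_indicator) auto
  also have "\<dots> \<le> (\<integral>\<^sup>+ u. ennreal (indicator {0..} u * Z u \<omega> $ k) \<partial>interval_measure ?F)"
  proof (rule nn_integral_mono)
    fix u
    show "ennreal m * indicator {s<..t} u \<le> ennreal (indicator {0..} u * Z u \<omega> $ k)"
      using v(2)[of u] st by (auto simp: indicator_def m_def intro!: ennreal_leI)
  qed
  also have "\<dots> = 0" by (rule L_compl[OF \<omega>])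
  finally have "ennreal (m * (?F t - ?F s)) \<le> 0" using m by (simp add: ennreal_mult')
  moreover have "m * (?F t - ?F s) > 0" using m grow st by simp
  ultimately show False by (simp add: ennreal_eq_0_iff)
qed

text \<open>Expanding around the end point \<open>Z t\<close> leaves a cross term
  \<open>2 Z' C^-1 dL\<close>, small because the coordinates being pushed are at most
  \<open>\<rho>\<close>, and a term quadratic in the pushing. A free \<open>\<rho>\<close> serves
  both a crude bound and a limit.\<close>

lemma boundary_error:
  obtains \<kappa> where "\<kappa> > 0" "\<And>\<omega> s t \<rho>. \<omega> \<in> space M \<Longrightarrow> 0 \<le> s \<Longrightarrow> s \<le> t \<Longrightarrow> 0 \<le> \<rho> \<Longrightarrow>
    (\<And>k. L s \<omega> $ k < L t \<omega> $ k \<Longrightarrow> Z t \<omega> $ k \<le> \<rho>) \<Longrightarrow>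
    \<bar>V (Z t \<omega>) - V (Z s \<omega> + (B t \<omega> - B s \<omega>))\<bar> \<le> \<kappa> * (\<rho> + (ell t \<omega> - ell s \<omega>)) * (ell t \<omega> - ell s \<omega>)"
proof -
  obtain K1 where K1: "K1 > 0" "\<And>x. norm (R *v x) \<le> K1 * norm x" using matrix_norm_bound by blast
  obtain K2 where K2: "K2 > 0" "\<And>x. norm (Om *v x) \<le> K2 * norm x" using matrix_norm_bound by blast
  define \<kappa> where "\<kappa> = 2 * (\<Sum>k\<in>UNIV. 1 / c $ k) + K1 * K2 * K1"
  have cs: "(\<Sum>k\<in>UNIV. 1 / c $ k) \<ge> 0" using c_pos by (auto intro!: sum_nonneg simp: less_imp_le)
  show ?thesis
  proof (rule that[of \<kappa>])
    show "\<kappa> > 0" unfolding \<kappa>_def using cs K1 K2 by (intro add_nonneg_pos) auto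
    fix \<omega> s t \<rho>
    assume \<omega>: "\<omega> \<in> space M" and st: "0 \<le> s" "s \<le> t" and \<rho>: "0 \<le> \<rho>"
      and face: "\<And>k. L s \<omega> $ k < L t \<omega> $ k \<Longrightarrow> Z t \<omega> $ k \<le> \<rho>"
    define D where "D = L t \<omega> - L s \<omega>"
    define d where "d = ell t \<omega> - ell s \<omega>"
    have D: "D $ k \<ge> 0" for k using L_mono[OF \<omega> st] by (simp add: D_def)
    have d: "d = (\<Sum>k\<in>UNIV. D $ k)" by (simp add: d_def ell_def D_def sum_subtractf)
    have d0: "d \<ge> 0" unfolding d by (intro sum_nonneg D)
    have Dk: "D $ k \<le> d" for k unfolding d by (rule member_le_sum) (auto simp: D)
    have Dn: "norm D \<le> d" using norm_le_l1_cart[of D] D by (simp add: d)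
    have "Z s \<omega> + (B t \<omega> - B s \<omega>) = Z t \<omega> + R *v (- D)"
      using Z_eq[of s \<omega>] Z_eq[of t \<omega>] \<omega> st by (simp add: D_def matrix_vector_mult_diff_distrib)
    then have "V (Z s \<omega> + (B t \<omega> - B s \<omega>)) = V (Z t \<omega>)
        + (2 * ((Om *v Z t \<omega>) \<bullet> (R *v (- D))) + (R *v (- D)) \<bullet> (Om *v (R *v (- D))))"
      by (simp only: V_add)
    moreover have "(Om *v Z t \<omega>) \<bullet> (R *v (- D)) = - (\<Sum>k\<in>UNIV. Z t \<omega> $ k * (D $ k / c $ k))"
      unfolding inner_commute[of "Om *v Z t \<omega>"] Om_swap[of "R *v (- D)"] Om_R
      by (simp add: inner_vec_def sum_negf)
    ultimately have e: "V (Z t \<omega>) - V (Z s \<omega> + (B t \<omega> - B s \<omega>))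
       = 2 * (\<Sum>k\<in>UNIV. Z t \<omega> $ k * (D $ k / c $ k)) - (R *v (- D)) \<bullet> (Om *v (R *v (- D)))" by simp
    have 1: "0 \<le> (\<Sum>k\<in>UNIV. Z t \<omega> $ k * (D $ k / c $ k))"
      using Z_orthant[of t \<omega>] \<omega> st D c_pos
      by (auto intro!: sum_nonneg mult_nonneg_nonneg divide_nonneg_pos simp: orthant_def)
    have "(\<Sum>k\<in>UNIV. Z t \<omega> $ k * (D $ k / c $ k)) \<le> (\<Sum>k\<in>UNIV. \<rho> * d * (1 / c $ k))"
    proof (rule sum_mono)
      fix k
      have "Z t \<omega> $ k * D $ k \<le> \<rho> * d"
      proof (cases "D $ k = 0")
        case False
        then have "L s \<omega> $ k < L t \<omega> $ k" using D[of k] by (simp add: D_def)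
        then show ?thesis using face[of k] Dk[of k] D[of k] \<rho> by (intro mult_mono) auto
      qed (use \<rho> d0 in simp)
      then show "Z t \<omega> $ k * (D $ k / c $ k) \<le> \<rho> * d * (1 / c $ k)"
        using c_pos[of k] by (simp add: divide_right_mono)
    qed
    also have "\<dots> = (\<Sum>k\<in>UNIV. 1 / c $ k) * (\<rho> * d)" by (simp add: sum_distrib_left mult.commute)
    finally have 2: "(\<Sum>k\<in>UNIV. Z t \<omega> $ k * (D $ k / c $ k)) \<le> (\<Sum>k\<in>UNIV. 1 / c $ k) * (\<rho> * d)" .
    have "\<bar>(R *v (- D)) \<bullet> (Om *v (R *v (- D)))\<bar> \<le> norm (R *v (- D)) * norm (Om *v (R *v (- D)))"
      by (rule Cauchy_Schwarz_ineq2)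
    also have "\<dots> \<le> (K1 * d) * (K2 * (K1 * d))"
    proof (intro mult_mono)
      show r: "norm (R *v (- D)) \<le> K1 * d"
        using order_trans[OF K1(2)[of "- D"], of "K1 * d"] Dn K1(1) by simp
      show "norm (Om *v (R *v (- D))) \<le> K2 * (K1 * d)"
        by (rule order_trans[OF K2(2)]) (use r K2(1) in simp)
    qed (use K1 K2 d0 in auto)
    also have "\<dots> = (K1 * K2 * K1) * (d * d)" by simp
    finally have 3: "\<bar>(R *v (- D)) \<bullet> (Om *v (R *v (- D)))\<bar> \<le> (K1 * K2 * K1) * (d * d)" .
    have "\<bar>V (Z t \<omega>) - V (Z s \<omega> + (B t \<omega> - B s \<omega>))\<bar> \<le> 2 * ((\<Sum>k\<in>UNIV. 1 / c $ k) * (\<rho> * d)) + (K1 * K2 * K1) * (d * d)"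
      unfolding e using 1 2 3 by linarith
    also have "\<dots> \<le> 2 * ((\<Sum>k\<in>UNIV. 1 / c $ k) * ((\<rho> + d) * d)) + (K1 * K2 * K1) * ((\<rho> + d) * d)"
      using cs d0 \<rho> K1 K2 by (intro add_mono mult_left_mono mult_right_mono) auto
    also have "\<dots> = \<kappa> * (\<rho> + d) * d" by (simp add: \<kappa>_def algebra_simps)
    finally show "\<bar>V (Z t \<omega>) - V (Z s \<omega> + (B t \<omega> - B s \<omega>))\<bar> \<le> \<kappa> * (\<rho> + (ell t \<omega> - ell s \<omega>)) * (ell t \<omega> - ell s \<omega>)"
      by (simp add: d_def)
  qed
qed

end

section \<open>Sums over uniform time grids\<close>

definition grid :: "real \<Rightarrow> real \<Rightarrow> nat \<Rightarrow> nat \<Rightarrow> real" where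
  "grid s T n i = s + T * real i / real n"

lemma grid_0 [simp]: "grid s T n 0 = s" by (simp add: grid_def)

lemma grid_last [simp]: "n > 0 \<Longrightarrow> grid s T n n = s + T" by (simp add: grid_def)

lemma grid_Suc: "grid s T n (Suc i) = grid s T n i + T / real n"
  by (simp add: grid_def add_divide_distrib distrib_left)

lemma grid_ge: "0 \<le> T \<Longrightarrow> s \<le> grid s T n i" by (simp add: grid_def)

lemma grid_mono: "0 \<le> T \<Longrightarrow> i \<le> j \<Longrightarrow> grid s T n i \<le> grid s T n j"
  by (auto simp: grid_def intro!: divide_right_mono mult_left_mono)

lemma grid_le: "0 \<le> T \<Longrightarrow> i \<le> n \<Longrightarrow> n > 0 \<Longrightarrow> grid s T n i \<le> s + T"
  using grid_mono[of T i n s n] by simp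

locale reflected_test = reflected A Om R mu c M F z0 B Z L + test_function f f1 f2 K
  for A Om R :: "real^'n^'n" and mu c and M :: "'a measure" and F z0 B Z L and f f1 f2 K
begin

sublocale reflection_brownian A Om R mu c f f1 f2 K M F z0 B
  by unfold_locales

text \<open>The error of replacing the reflected step by the free Gaussian step from the same
  point.\<close>

definition jump :: "real \<Rightarrow> real \<Rightarrow> 'a \<Rightarrow> real" where
  "jump s t \<omega> = f (V (Z t \<omega>)) - f (V (Z s \<omega> + (B t \<omega> - B s \<omega>)))"

text \<open>A discrete stochastic integral of the indicators of \<open>E i\<close>. The number
  \<open>m\<close> of summed steps is separate from the mesh index \<open>n\<close>, so that shorter
  horizons on the same grid can be treated.\<close>

definition gain :: "real \<Rightarrow> real \<Rightarrow> nat \<Rightarrow> (nat \<Rightarrow> 'a set) \<Rightarrow> nat \<Rightarrow> 'a \<Rightarrow> real" where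
  "gain s T n E m = (\<lambda>\<omega>. \<Sum>i<m. indicator (E i) \<omega> *
     (f (V (Z (grid s T n (Suc i)) \<omega>)) - f (V (Z (grid s T n i) \<omega>))))"

definition compensator :: "real \<Rightarrow> real \<Rightarrow> nat \<Rightarrow> (nat \<Rightarrow> 'a set) \<Rightarrow> nat \<Rightarrow> 'a \<Rightarrow> real" where
  "compensator s T n E m = (\<lambda>\<omega>. \<Sum>i<m. indicator (E i) \<omega> * (T / n * gen f1 f2 (Z (grid s T n i) \<omega>)))"

text \<open>Checked at grid points up to \<open>i\<close> only, so that the event is known at time
  \<open>grid s T n i\<close>. The bound on \<open>ell\<close> gives the boundary errors a constant
  dominating bound.\<close>

definition localized :: "real \<Rightarrow> real \<Rightarrow> nat \<Rightarrow> real \<Rightarrow> nat \<Rightarrow> 'a set" where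
  "localized s T n N i = {\<omega>\<in>space M. \<forall>j\<le>i. norm (Z (grid s T n j) \<omega>) \<le> N \<and> ell (grid s T n j) \<omega> \<le> N}"

lemma localized_measurable:
  assumes "0 \<le> s" "0 \<le> T"
  shows "localized s T n N i \<in> sets (F (grid s T n i))"
proof -
  have "{\<omega>\<in>space M. norm (Z (grid s T n j) \<omega>) \<le> N \<and> ell (grid s T n j) \<omega> \<le> N} \<in> sets (F (grid s T n i))"
    if "j \<le> i" for j
  proof -
    have g0: "0 \<le> grid s T n j" using grid_ge[of T s n j] assms by simp
    have [measurable]: "Z (grid s T n j) \<in> borel_measurable (F (grid s T n i))"
      by (rule F_measurable_mono[OF grid_mono Z_measurable]) (use assms that g0 in auto)
    have [measurable]: "ell (grid s T n j) \<in> borel_measurable (F (grid s T n i))"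
      by (rule F_measurable_mono[OF grid_mono ell_measurable]) (use assms that g0 in auto)
    show ?thesis unfolding space_F[of "grid s T n i", symmetric] by measurable
  qed
  moreover have "localized s T n N i = (\<Inter>j\<in>{..i}. {\<omega>\<in>space M. norm (Z (grid s T n j) \<omega>) \<le> N \<and> ell (grid s T n j) \<omega> \<le> N})"
    by (auto simp: localized_def)
  ultimately show ?thesis by (simp add: sets.finite_INT)
qed

lemma jump_measurable:
  assumes "0 \<le> s" "0 \<le> t"
  shows "jump s t \<in> borel_measurable M"
proof -
  have c: "(\<lambda>z. f (V z)) \<in> borel_measurable borel"
    by (intro borel_measurable_continuous_onI comp_V_cont cont0)
  have "Z s \<in> borel_measurable M" "Z t \<in> borel_measurable M"
    using Z_measurable F_measurable_M assms by blast+
  moreover have "B s \<in> borel_measurable M" "B t \<in> borel_measurable M" using assms by auto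
  ultimately show ?thesis unfolding jump_def
    by (intro borel_measurable_diff measurable_compose[OF _ c]) auto
qed

lemma jump_bound: "\<bar>jump s t \<omega>\<bar> \<le> 2 * K"
proof -
  have "\<bar>f (V z)\<bar> \<le> K" for z by (intro bound0) simp
  from this[of "Z t \<omega>"] this[of "Z s \<omega> + (B t \<omega> - B s \<omega>)"] show ?thesis by (simp add: jump_def)
qed

text \<open>On each path a pushed coordinate vanishes somewhere within the step, so the modulus of
  continuity makes the errors a small multiple of the total pushing. Domination comes from the
  localisation, with \<open>2 * K\<close> for the one step that leaves the region.\<close>

lemma jump_sum_tendsto_0:
  assumes s: "0 \<le> s" and T: "0 < T" and N: "0 \<le> N"
  shows "(\<lambda>n. expectation (\<lambda>\<omega>. \<Sum>i<n. indicator (localized s T n N i) \<omega> *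
      \<bar>jump (grid s T n i) (grid s T n (Suc i)) \<omega>\<bar>)) \<longlonglongrightarrow> 0"
proof -
  obtain \<kappa> where \<kappa>: "\<kappa> > 0" "\<And>\<omega> s t \<rho>. \<omega> \<in> space M \<Longrightarrow> 0 \<le> s \<Longrightarrow> s \<le> t \<Longrightarrow> 0 \<le> \<rho> \<Longrightarrow>
    (\<And>k. L s \<omega> $ k < L t \<omega> $ k \<Longrightarrow> Z t \<omega> $ k \<le> \<rho>) \<Longrightarrow>
    \<bar>V (Z t \<omega>) - V (Z s \<omega> + (B t \<omega> - B s \<omega>))\<bar> \<le> \<kappa> * (\<rho> + (ell t \<omega> - ell s \<omega>)) * (ell t \<omega> - ell s \<omega>)"
    by (rule boundary_error) blast
  have jump_le: "\<bar>jump u t \<omega>\<bar> \<le> K * \<kappa> * (\<rho> + (ell t \<omega> - ell u \<omega>)) * (ell t \<omega> - ell u \<omega>)"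
    if "\<omega> \<in> space M" "0 \<le> u" "u \<le> t" "0 \<le> \<rho>" "\<And>k. L u \<omega> $ k < L t \<omega> $ k \<Longrightarrow> Z t \<omega> $ k \<le> \<rho>" for \<omega> u t \<rho>
  proof -
    have "\<bar>jump u t \<omega>\<bar> \<le> K * \<bar>V (Z t \<omega>) - V (Z u \<omega> + (B t \<omega> - B u \<omega>))\<bar>"
      unfolding jump_def by (rule lipschitz) auto
    also have "\<dots> \<le> K * (\<kappa> * (\<rho> + (ell t \<omega> - ell u \<omega>)) * (ell t \<omega> - ell u \<omega>))"
      using \<kappa>(2)[OF that] K_nonneg by (rule mult_left_mono)
    finally show ?thesis by (simp add: mult.assoc)
  qed
  let ?X = "\<lambda>n \<omega>. \<Sum>i<n. indicator (localized s T n N i) \<omega> * \<bar>jump (grid s T n i) (grid s T n (Suc i)) \<omega>\<bar>"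
  have g0: "0 \<le> grid s T n i" for n i using grid_ge[of T s n i] s T by simp
  have gS: "grid s T n i \<le> grid s T n (Suc i)" for n i using T by (intro grid_mono) auto
  have X0: "0 \<le> ?X n \<omega>" for n \<omega> by (intro sum_nonneg mult_nonneg_nonneg) auto
  have bnd: "?X n \<omega> \<le> K * \<kappa> * (2 * N) * N + 2 * K" if \<omega>: "\<omega> \<in> space M" for n \<omega>
  proof -
    let ?P = "\<lambda>j. norm (Z (grid s T n j) \<omega>) \<le> N \<and> ell (grid s T n j) \<omega> \<le> N"
    have "?X n \<omega> = (\<Sum>i<n. if \<forall>j\<le>i. ?P j then \<bar>jump (grid s T n i) (grid s T n (Suc i)) \<omega>\<bar> else 0)"
      using \<omega> by (intro sum.cong refl) (simp add: localized_def indicator_def)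
    also have "\<dots> \<le> (K * \<kappa> * (2 * N)) * N + 2 * K"
    proof (rule localized_sum_bound[where l = "\<lambda>j. ell (grid s T n j) \<omega>"])
      fix j assume P: "?P j" "?P (Suc j)"
      let ?d = "ell (grid s T n (Suc j)) \<omega> - ell (grid s T n j) \<omega>"
      have d: "0 \<le> ?d" "?d \<le> N"
        using ell_mono[OF \<omega> g0 gS, of n j] ell_nonneg[OF \<omega> g0, of n j] P by auto
      have "\<bar>jump (grid s T n j) (grid s T n (Suc j)) \<omega>\<bar> \<le> K * \<kappa> * (N + ?d) * ?d"
      proof (rule jump_le[OF \<omega> g0 gS N])
        fix k
        show "Z (grid s T n (Suc j)) \<omega> $ k \<le> N"
          using component_le_norm_cart[of "Z (grid s T n (Suc j)) \<omega>" k] P by linarith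
      qed
      also have "\<dots> \<le> K * \<kappa> * (2 * N) * ?d"
        using d K_nonneg \<kappa>(1) by (intro mult_right_mono mult_left_mono) auto
      finally show "\<bar>jump (grid s T n j) (grid s T n (Suc j)) \<omega>\<bar> \<le> K * \<kappa> * (2 * N) * ?d" .
    qed (use jump_bound K_nonneg \<kappa>(1) N ell_nonneg[OF \<omega> s] in auto)
    finally show ?thesis .
  qed
  have lim: "(\<lambda>n. ?X n \<omega>) \<longlonglongrightarrow> 0" if \<omega>: "\<omega> \<in> space M" for \<omega>
  proof (rule LIMSEQ_I)
    fix r :: real assume r: "r > 0"
    define l where "l = ell (s + T) \<omega> - ell s \<omega>"
    have l: "l \<ge> 0" using ell_mono[OF \<omega> s, of "s+T"] T by (simp add: l_def)
    \<comment> \<open>Chosen so that the final sum is at most \<open>r / 2\<close>; the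
      \<open>+1\<close> avoids division by 0.\<close>
    define \<rho> where "\<rho> = r / (2 * K * \<kappa> * l + 1) / 2"
    have pos: "2 * K * \<kappa> * l + 1 > 0" using K_nonneg \<kappa>(1) l by (intro add_nonneg_pos) auto
    have \<rho>: "\<rho> > 0" using r pos by (simp add: \<rho>_def)
    have "continuous_on {s..s+T} (\<lambda>t. Z t \<omega>)"
      by (intro continuous_on_subset[OF Z_path[OF \<omega>]]) (use s in auto)
    from interval_modulus[OF this \<rho>] obtain d1 where d1: "d1 > 0"
      "\<And>u v. u \<in> {s..s+T} \<Longrightarrow> v \<in> {s..s+T} \<Longrightarrow> \<bar>v - u\<bar> < d1 \<Longrightarrow> dist (Z v \<omega>) (Z u \<omega>) < \<rho>" by blast
    have "continuous_on {s..s+T} (\<lambda>t. ell t \<omega>)"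
      by (intro continuous_on_subset[OF ell_path[OF \<omega>]]) (use s in auto)
    from interval_modulus[OF this \<rho>] obtain d2 where d2: "d2 > 0"
      "\<And>u v. u \<in> {s..s+T} \<Longrightarrow> v \<in> {s..s+T} \<Longrightarrow> \<bar>v - u\<bar> < d2 \<Longrightarrow> dist (ell v \<omega>) (ell u \<omega>) < \<rho>" by blast
    have "(\<lambda>n. T / real n) \<longlonglongrightarrow> 0" by (rule lim_const_over_n)
    from LIMSEQ_D[OF this, of "min d1 d2"] d1(1) d2(1)
    obtain n0 where n0: "\<And>n. n \<ge> n0 \<Longrightarrow> \<bar>T / real n\<bar> < min d1 d2" by auto
    show "\<exists>no. \<forall>n\<ge>no. norm (?X n \<omega> - 0) < r"
    proof (intro exI allI impI)
      fix n assume n: "n \<ge> max 1 n0"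
      then have npos: "n > 0" by simp
      have mesh: "\<bar>T / real n\<bar> < min d1 d2" using n by (intro n0) simp
      have "?X n \<omega> \<le> (\<Sum>i<n. K * \<kappa> * (2 * \<rho>) * (ell (grid s T n (Suc i)) \<omega> - ell (grid s T n i) \<omega>))"
      proof (rule sum_mono)
        fix i assume "i \<in> {..<n}"
        then have i: "i < n" by simp
        let ?u = "grid s T n i" and ?v = "grid s T n (Suc i)"
        have uv: "?u \<in> {s..s+T}" "?v \<in> {s..s+T}" using i T grid_le[of T _ n s] grid_ge[of T s n] by auto
        have gap: "?v - ?u = T / real n" by (simp add: grid_Suc)
        let ?d = "ell ?v \<omega> - ell ?u \<omega>"
        have d: "0 \<le> ?d" using ell_mono[OF \<omega> g0 gS, of n i] by simp
        have d': "?d \<le> \<rho>" using d2(2)[OF uv] gap mesh by (auto simp: dist_real_def)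
        have "\<bar>jump ?u ?v \<omega>\<bar> \<le> K * \<kappa> * (\<rho> + ?d) * ?d"
        proof (rule jump_le[OF \<omega> g0 gS])
          fix k assume "L ?u \<omega> $ k < L ?v \<omega> $ k"
          from L_grows_on_face[OF \<omega> g0 gS this] obtain w where w: "w \<in> {?u..?v}" "Z w \<omega> $ k = 0" by auto
          then have "dist (Z ?v \<omega>) (Z w \<omega>) < \<rho>" using uv gap mesh by (intro d1(2)) auto
          then show "Z ?v \<omega> $ k \<le> \<rho>"
            using component_le_norm_cart[of "Z ?v \<omega> - Z w \<omega>" k] w(2) by (simp add: dist_norm)
        qed (use \<rho> in simp)
        also have "\<dots> \<le> K * \<kappa> * (2 * \<rho>) * ?d"
          using d d' K_nonneg \<kappa>(1) by (intro mult_right_mono mult_left_mono) auto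
        finally show "indicator (localized s T n N i) \<omega> * \<bar>jump ?u ?v \<omega>\<bar> \<le> K * \<kappa> * (2 * \<rho>) * ?d"
          by (auto simp: indicator_def)
      qed
      also have "\<dots> = K * \<kappa> * (2 * \<rho>) * l"
        unfolding sum_distrib_left[symmetric] using npos
        by (simp add: l_def sum_lessThan_telescope[of "\<lambda>i. ell (grid s T n i) \<omega>"])
      also have "\<dots> = (2 * K * \<kappa> * l) * \<rho>" by simp
      also have "\<dots> \<le> (2 * K * \<kappa> * l + 1) * \<rho>" using \<rho> by simp
      also have "\<dots> = r / 2" using pos unfolding \<rho>_def by (simp add: field_simps)
      also have "\<dots> < r" using r by simp
      finally have "?X n \<omega> < r" .
      then show "norm (?X n \<omega> - 0) < r" using X0[of n \<omega>] by simp
    qed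
  qed
  have "(\<lambda>n. expectation (?X n)) \<longlonglongrightarrow> expectation (\<lambda>\<omega>. 0)"
  proof (rule integral_dominated_convergence[where w = "\<lambda>_. K * \<kappa> * (2 * N) * N + 2 * K"])
    fix n
    have "localized s T n N i \<in> sets M" for i
      by (rule subsetD[OF F_sub localized_measurable]) (use s T in auto)
    then show "?X n \<in> borel_measurable M"
      by (intro borel_measurable_sum borel_measurable_times borel_measurable_abs jump_measurable g0) auto
    show "AE x in M. norm (?X n x) \<le> K * \<kappa> * (2 * N) * N + 2 * K"
      using bnd X0 by (auto intro!: AE_I2)
  qed (use lim in auto)
  then show ?thesis by simp
qed

text \<open>The grid size is chosen uniformly in the stopping rule \<open>E\<close>, which makes the estimate available
  at all truncated horizons at once.\<close>
lemma dynkin: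
  assumes s: "0 \<le> s" and T: "0 < T" and N: "0 \<le> N" and \<eta>: "\<eta> > 0"
  shows "\<forall>\<^sub>F n in sequentially. \<forall>E. (\<forall>i<n. E i \<in> sets (F (grid s T n i)) \<and> E i \<subseteq> localized s T n N i) \<longrightarrow>
    integrable M (gain s T n E n) \<and> integrable M (compensator s T n E n) \<and>
    \<bar>expectation (gain s T n E n) - expectation (compensator s T n E n)\<bar> \<le> \<eta>"
proof -
  \<comment> \<open>One third of the tolerance each for the second-order error, the terms of order
    \<open>h^2\<close> and the boundary jumps.\<close>
  define \<eta>' where "\<eta>' = \<eta> / (3 * T)"
  have "\<eta>' > 0" using \<eta> T by (simp add: \<eta>'_def)
  from one_step[OF N this] obtain C where C: "C \<ge> 0"
    "\<And>s t E Z. 0 \<le> s \<Longrightarrow> s < t \<Longrightarrow> t - s \<le> 1 \<Longrightarrow> E \<in> sets (F s) \<Longrightarrow> Z \<in> borel_measurable (F s) \<Longrightarrow>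
      (\<And>\<omega>. \<omega> \<in> E \<Longrightarrow> norm (Z \<omega>) \<le> N) \<Longrightarrow>
      \<bar>expectation (\<lambda>\<omega>. indicator E \<omega> * (f (V (Z \<omega> + (B t \<omega> - B s \<omega>))) - f (V (Z \<omega>)) - (t - s) * gen f1 f2 (Z \<omega>)))\<bar>
      \<le> \<eta>' * (t - s) + C * (t - s)\<^sup>2" by blast
  let ?X = "\<lambda>n \<omega>. \<Sum>i<n. indicator (localized s T n N i) \<omega> * \<bar>jump (grid s T n i) (grid s T n (Suc i)) \<omega>\<bar>"
  have gc: "continuous_on UNIV (gen f1 f2)" by (rule gen_cont[OF cont1 cont2])
  obtain Cg where Cg: "Cg \<ge> 0" "\<And>z. norm z \<le> N \<Longrightarrow> \<bar>gen f1 f2 z\<bar> \<le> Cg"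
    by (rule continuous_bounded_on_cball[OF gc, of N]) blast
  have fc: "(\<lambda>z. f (V z)) \<in> borel_measurable borel"
    by (intro borel_measurable_continuous_onI comp_V_cont cont0)
  have fb: "\<bar>f (V z)\<bar> \<le> K" for z by (intro bound0) simp
  have g0: "0 \<le> grid s T n i" for n i using grid_ge[of T s n i] s T by simp
  have ev1: "\<forall>\<^sub>F n in sequentially. expectation (?X n) < \<eta> / 3"
    using order_tendstoD(2)[OF jump_sum_tendsto_0[OF s T N], of "\<eta>/3"] \<eta> by simp
  have "(\<lambda>n. C * T\<^sup>2 / real n) \<longlonglongrightarrow> 0" by (rule lim_const_over_n)
  then have ev2: "\<forall>\<^sub>F n in sequentially. C * T\<^sup>2 / real n < \<eta> / 3"
    by (rule order_tendstoD(2)) (use \<eta> in simp)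
  have "(\<lambda>n. T / real n) \<longlonglongrightarrow> 0" by (rule lim_const_over_n)
  then have ev3: "\<forall>\<^sub>F n in sequentially. T / real n < 1"
    by (rule order_tendstoD(2)) simp
  show ?thesis
    using ev1 ev2 ev3 eventually_gt_at_top[of 0]
  proof eventually_elim
    case (elim n)
    show ?case
    proof (intro allI impI)
      fix E :: "nat \<Rightarrow> 'a set"
      assume E: "\<forall>i<n. E i \<in> sets (F (grid s T n i)) \<and> E i \<subseteq> localized s T n N i"
      define h where "h = T / real n"
      have h: "h > 0" "h \<le> 1" "real n * h = T" using elim T by (auto simp: h_def)
      have gap: "grid s T n (Suc i) - grid s T n i = h" for i by (simp add: grid_Suc h_def)
      let ?Z = "\<lambda>i. Z (grid s T n i)" and ?b = "\<lambda>i \<omega>. B (grid s T n (Suc i)) \<omega> - B (grid s T n i) \<omega>"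
      have EM: "E i \<in> sets M" if "i < n" for i using E F_sub that by blast
      have EN: "norm (?Z i \<omega>) \<le> N" if "i < n" "\<omega> \<in> E i" for i \<omega>
        using E that unfolding localized_def by blast
      have ZM: "?Z i \<in> borel_measurable M" for i using Z_measurable[OF g0] by (rule F_measurable_M)
      have I1: "integrable M (\<lambda>\<omega>. indicator (E i) \<omega> * f (V (?Z j \<omega>)))" if "i < n" for i j
        using EM[OF that] measurable_compose[OF ZM fc, of j] fb K_nonneg
        by (intro integrable_const_bound[of _ K]) (auto simp: indicator_def intro!: AE_I2)
      have I2: "integrable M (\<lambda>\<omega>. indicator (E i) \<omega> * jump (grid s T n i) (grid s T n (Suc i)) \<omega>)" if "i < n" for i
        using EM[OF that] jump_measurable[OF g0 g0, of n i n "Suc i"] jump_bound K_nonneg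
        by (intro integrable_const_bound[of _ "2 * K"]) (auto simp: indicator_def intro!: AE_I2)
      have I3: "integrable M (\<lambda>\<omega>. indicator (E i) \<omega> * (h * gen f1 f2 (?Z i \<omega>)))" if "i < n" for i
      proof (rule integrable_const_bound[of _ "h * Cg"])
        show "AE x in M. norm (indicator (E i) x * (h * gen f1 f2 (?Z i x))) \<le> h * Cg"
          using Cg EN[OF that] h by (auto simp: indicator_def abs_mult intro!: AE_I2)
        show "(\<lambda>\<omega>. indicator (E i) \<omega> * (h * gen f1 f2 (?Z i \<omega>))) \<in> borel_measurable M"
          using EM[OF that] measurable_compose[OF ZM borel_measurable_continuous_onI[OF gc], of i] by simp
      qed
      let ?S1 = "\<lambda>i \<omega>. indicator (E i) \<omega> * (f (V (?Z (Suc i) \<omega>)) - f (V (?Z i \<omega>)))"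
      let ?S2 = "\<lambda>i \<omega>. indicator (E i) \<omega> * (h * gen f1 f2 (?Z i \<omega>))"
      let ?S3 = "\<lambda>i \<omega>. indicator (E i) \<omega> * jump (grid s T n i) (grid s T n (Suc i)) \<omega>"
      \<comment> \<open>Gain minus compensator, \<open>?S1 - ?S2\<close>, splits into the boundary
        jumps \<open>?S3\<close> and the compensated free steps \<open>?S4\<close>.\<close>
      let ?S4 = "\<lambda>i \<omega>. indicator (E i) \<omega> * (f (V (?Z i \<omega> + ?b i \<omega>)) - f (V (?Z i \<omega>)) - h * gen f1 f2 (?Z i \<omega>))"
      have S1I: "integrable M (?S1 i)" if "i < n" for i
        unfolding right_diff_distrib by (intro Bochner_Integration.integrable_diff I1 that)
      have S4eq: "?S4 i = (\<lambda>\<omega>. ?S1 i \<omega> - ?S3 i \<omega> - ?S2 i \<omega>)" for i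
        by (auto simp: jump_def algebra_simps)
      have S4I: "integrable M (?S4 i)" if "i < n" for i
        unfolding S4eq by (intro Bochner_Integration.integrable_diff S1I I2 I3 that)
      have S4b: "\<bar>expectation (?S4 i)\<bar> \<le> \<eta>' * h + C * h\<^sup>2" if "i < n" for i
        using C(2)[of "grid s T n i" "grid s T n (Suc i)" "E i" "?Z i"] E EN that h g0 Z_measurable[OF g0] gap[of i]
        by (simp add: gap)
      have S1s: "integrable M (\<lambda>\<omega>. \<Sum>i<n. ?S1 i \<omega>)" and S2s: "integrable M (\<lambda>\<omega>. \<Sum>i<n. ?S2 i \<omega>)"
        and S3s: "integrable M (\<lambda>\<omega>. \<Sum>i<n. ?S3 i \<omega>)" and S4s: "integrable M (\<lambda>\<omega>. \<Sum>i<n. ?S4 i \<omega>)"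
        by (intro Bochner_Integration.integrable_sum S1I I3 I2 S4I; simp)+
      have "expectation (\<lambda>\<omega>. \<Sum>i<n. ?S1 i \<omega>) - expectation (\<lambda>\<omega>. \<Sum>i<n. ?S2 i \<omega>)
          = expectation (\<lambda>\<omega>. (\<Sum>i<n. ?S1 i \<omega>) - (\<Sum>i<n. ?S2 i \<omega>))"
        using S1s S2s by (rule Bochner_Integration.integral_diff[symmetric])
      also have "(\<lambda>\<omega>. (\<Sum>i<n. ?S1 i \<omega>) - (\<Sum>i<n. ?S2 i \<omega>)) = (\<lambda>\<omega>. (\<Sum>i<n. ?S3 i \<omega>) + (\<Sum>i<n. ?S4 i \<omega>))"
      proof
        fix \<omega>
        show "(\<Sum>i<n. ?S1 i \<omega>) - (\<Sum>i<n. ?S2 i \<omega>) = (\<Sum>i<n. ?S3 i \<omega>) + (\<Sum>i<n. ?S4 i \<omega>)"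
          unfolding sum_subtractf[symmetric] sum.distrib[symmetric]
          by (intro sum.cong refl) (simp add: jump_def algebra_simps)
      qed
      also have "expectation \<dots> = expectation (\<lambda>\<omega>. \<Sum>i<n. ?S3 i \<omega>) + expectation (\<lambda>\<omega>. \<Sum>i<n. ?S4 i \<omega>)"
        using S3s S4s by (rule Bochner_Integration.integral_add)
      finally have eq: "expectation (\<lambda>\<omega>. \<Sum>i<n. ?S1 i \<omega>) - expectation (\<lambda>\<omega>. \<Sum>i<n. ?S2 i \<omega>)
         = expectation (\<lambda>\<omega>. \<Sum>i<n. ?S3 i \<omega>) + expectation (\<lambda>\<omega>. \<Sum>i<n. ?S4 i \<omega>)" .
      have "\<bar>expectation (\<lambda>\<omega>. \<Sum>i<n. ?S3 i \<omega>)\<bar> \<le> expectation (\<lambda>\<omega>. \<bar>\<Sum>i<n. ?S3 i \<omega>\<bar>)"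
        by (rule integral_abs_bound)
      also have "\<dots> \<le> expectation (?X n)"
      proof (rule integral_mono)
        show "integrable M (\<lambda>\<omega>. \<bar>\<Sum>i<n. ?S3 i \<omega>\<bar>)" using S3s by simp
        show "integrable M (?X n)"
        proof (rule Bochner_Integration.integrable_sum)
          fix i
          have "localized s T n N i \<in> sets M" by (rule subsetD[OF F_sub localized_measurable]) (use s T in auto)
          then show "integrable M (\<lambda>\<omega>. indicator (localized s T n N i) \<omega> * \<bar>jump (grid s T n i) (grid s T n (Suc i)) \<omega>\<bar>)"
            using jump_measurable[OF g0 g0, of n i n "Suc i"] jump_bound K_nonneg
            by (intro integrable_const_bound[of _ "2 * K"]) (auto simp: indicator_def intro!: AE_I2)
        qed
        fix \<omega> assume \<omega>: "\<omega> \<in> space M"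
        have "\<bar>\<Sum>i<n. ?S3 i \<omega>\<bar> \<le> (\<Sum>i<n. \<bar>?S3 i \<omega>\<bar>)" by (rule sum_abs)
        also have "\<dots> \<le> ?X n \<omega>"
          by (rule sum_mono) (use E in \<open>auto simp: indicator_def\<close>)
        finally show "\<bar>\<Sum>i<n. ?S3 i \<omega>\<bar> \<le> ?X n \<omega>" .
      qed
      finally have b3: "\<bar>expectation (\<lambda>\<omega>. \<Sum>i<n. ?S3 i \<omega>)\<bar> < \<eta> / 3" using elim(1) by simp
      have "\<bar>expectation (\<lambda>\<omega>. \<Sum>i<n. ?S4 i \<omega>)\<bar> = \<bar>\<Sum>i<n. expectation (?S4 i)\<bar>"
        by (subst Bochner_Integration.integral_sum) (use S4I in auto)
      also have "\<dots> \<le> (\<Sum>i<n. \<eta>' * h + C * h\<^sup>2)"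
        by (rule order_trans[OF sum_abs sum_mono]) (use S4b in auto)
      also have "\<dots> = \<eta>' * (real n * h) + C * (real n * h) * h"
        by (simp add: power2_eq_square distrib_left mult_ac)
      also have "\<dots> = \<eta> / 3 + C * T\<^sup>2 / real n" unfolding h(3) using T by (simp add: \<eta>'_def h_def power2_eq_square)
      also have "\<dots> < \<eta> / 3 + \<eta> / 3" using elim(2) by simp
      finally have b4: "\<bar>expectation (\<lambda>\<omega>. \<Sum>i<n. ?S4 i \<omega>)\<bar> < \<eta> / 3 + \<eta> / 3" .
      have "\<bar>expectation (\<lambda>\<omega>. \<Sum>i<n. ?S1 i \<omega>) - expectation (\<lambda>\<omega>. \<Sum>i<n. ?S2 i \<omega>)\<bar> \<le> \<eta>"
        using eq b3 b4 by linarith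
      then show "integrable M (gain s T n E n) \<and> integrable M (compensator s T n E n) \<and>
        \<bar>expectation (gain s T n E n) - expectation (compensator s T n E n)\<bar> \<le> \<eta>"
        unfolding gain_def compensator_def
        using S1s S2s unfolding h_def by (intro conjI)
    qed
  qed
qed

end

section \<open>The barrier function and grid stopping rules\<close>

text \<open>Optional stopping on a grid: the sum telescopes up to the first index at which
  \<open>P\<close> fails, or up to \<open>n\<close> if there is none before.\<close>

lemma stopped_sum:
  fixes x :: "nat \<Rightarrow> real"
  shows "\<exists>k\<le>n. (\<Sum>i<n. if \<forall>j\<le>i. P j then x (Suc i) - x i else 0) = x k - x 0
    \<and> (\<forall>j<k. P j) \<and> (k < n \<longrightarrow> \<not> P k)"
proof (induction n)
  case (Suc n)
  then obtain k where k: "k \<le> n" "(\<Sum>i<n. if \<forall>j\<le>i. P j then x (Suc i) - x i else 0) = x k - x 0"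
    "\<forall>j<k. P j" "k < n \<longrightarrow> \<not> P k" by blast
  show ?case
  proof (cases "\<forall>j\<le>n. P j")
    case True
    then have "k = n" using k by (meson le_neq_implies_less)
    then show ?thesis using True k by (intro exI[of _ "Suc n"]) (auto simp: less_Suc_eq_le)
  next
    case False
    then have "\<not> P k" using k by (metis le_neq_implies_less)
    then show ?thesis unfolding sum.lessThan_Suc if_not_P[OF False] using k by (intro exI[of _ k]) auto
  qed
qed auto

text \<open>\<open>Q\<close> will be a statement about whole paths, possibly not measurable. The set
  of points lying in all \<open>H n\<close> from some index on is measurable, contains every point
  satisfying \<open>Q\<close>, and has probability at most \<open>\<eta>\<close> by a monotone
  limit; \<open>\<eta>\<close> then runs through a null sequence.\<close>

lemma (in prob_space) AE_not_by_eventual_cover: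
  assumes "\<And>\<eta>::real. \<eta> > 0 \<Longrightarrow> \<exists>H. (\<forall>n. H n \<in> events) \<and> (\<forall>\<^sub>F n in sequentially. prob (H n) \<le> \<eta>) \<and>
     (\<forall>\<omega>\<in>space M. Q \<omega> \<longrightarrow> (\<forall>\<^sub>F n in sequentially. \<omega> \<in> H n))"
  shows "AE \<omega> in M. \<not> Q \<omega>"
proof -
  have "\<exists>U. U \<in> events \<and> prob U \<le> \<eta> \<and> (\<forall>\<omega>\<in>space M. Q \<omega> \<longrightarrow> \<omega> \<in> U)" if "\<eta> > 0" for \<eta> :: real
  proof -
    obtain H where H: "\<And>n. H n \<in> events" "\<forall>\<^sub>F n in sequentially. prob (H n) \<le> \<eta>"
      "\<And>\<omega>. \<omega> \<in> space M \<Longrightarrow> Q \<omega> \<Longrightarrow> \<forall>\<^sub>F n in sequentially. \<omega> \<in> H n"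
      using assms[OF \<open>\<eta> > 0\<close>] by blast
    define I where "I = (\<lambda>m. \<Inter>n\<in>{m..}. H n)"
    have I: "I m \<in> events" for m unfolding I_def by (intro sets.countable_INT') (use H in auto)
    have "prob (I m) \<le> \<eta>" for m
    proof -
      obtain n where "n \<ge> m" "prob (H n) \<le> \<eta>"
        using H(2) unfolding eventually_sequentially by (metis max.cobounded1 max.cobounded2)
      then show ?thesis using finite_measure_mono[of "I m" "H n"] H(1)[of n] by (force simp: I_def)
    qed
    moreover have "(\<lambda>m. prob (I m)) \<longlonglongrightarrow> prob (\<Union>m. I m)"
      by (rule finite_Lim_measure_incseq) (use I in \<open>auto simp: incseq_def I_def\<close>)
    ultimately have "prob (\<Union>m. I m) \<le> \<eta>" by (intro LIMSEQ_le_const2) auto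
    moreover have "\<omega> \<in> (\<Union>m. I m)" if "\<omega> \<in> space M" "Q \<omega>" for \<omega>
      using H(3)[OF that] by (auto simp: I_def eventually_sequentially)
    ultimately show ?thesis using I by (intro exI[of _ "\<Union>m. I m"]) auto
  qed
  then have "\<forall>k::nat. \<exists>U. U \<in> events \<and> prob U \<le> 1 / real (Suc k) \<and> (\<forall>\<omega>\<in>space M. Q \<omega> \<longrightarrow> \<omega> \<in> U)" by simp
  then obtain U where U: "\<And>k. U k \<in> events" "\<And>k::nat. prob (U k) \<le> 1 / real (Suc k)"
    "\<And>k \<omega>. \<omega> \<in> space M \<Longrightarrow> Q \<omega> \<Longrightarrow> \<omega> \<in> U k" by metis
  define J where "J = (\<Inter>k. U k)"
  have J: "J \<in> events" unfolding J_def using U by auto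
  have "prob J \<le> 1 / real (Suc k)" for k
  proof -
    have "J \<subseteq> U k" by (auto simp: J_def)
    then show ?thesis using finite_measure_mono[OF _ U(1), of J k] U(2)[of k] by linarith
  qed
  moreover have "(\<lambda>k. 1 / real (Suc k)) \<longlonglongrightarrow> 0" by (rule LIMSEQ_Suc[OF lim_const_over_n])
  ultimately have "prob J \<le> 0" by (intro LIMSEQ_le_const) auto
  then have "prob J = 0" using measure_nonneg[of M J] by simp
  then have "J \<in> null_sets M" using J by (simp add: null_sets_def emeasure_eq_measure)
  then have "AE \<omega> in M. \<omega> \<notin> J" by (rule AE_not_in)
  then show ?thesis
  proof (rule AE_mp, intro AE_I2 impI notI)
    fix \<omega> assume \<omega>: "\<omega> \<in> space M" "\<omega> \<notin> J" "Q \<omega>"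
    then have "\<omega> \<in> U k" for k using U(3) by blast
    with \<omega> show False by (simp add: J_def)
  qed
qed

lemma grid_near:
  assumes "u \<in> {s..s+T}" "T > 0" "n > 0"
  obtains j where "j \<le> n" "\<bar>u - grid s T n j\<bar> \<le> T / real n"
proof -
  define y where "y = (u - s) * real n / T"
  have "(u - s) * real n \<le> T * real n" using assms by (intro mult_right_mono) auto
  then have y: "0 \<le> y" "y \<le> real n" using assms by (auto simp: y_def divide_le_eq mult.commute)
  define j where "j = nat \<lfloor>y\<rfloor>"
  have j: "real j \<le> y" "y < real j + 1" using y by (auto simp: j_def)
  have "u - grid s T n j = (y - real j) * (T / real n)"
    using assms by (simp add: grid_def y_def field_simps)
  moreover have "\<bar>(y - real j) * (T / real n)\<bar> \<le> 1 * (T / real n)"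
    unfolding abs_mult using j assms by (intro mult_mono) auto
  ultimately have "\<bar>u - grid s T n j\<bar> \<le> T / real n" by simp
  moreover have "j \<le> n" using j y by linarith
  ultimately show ?thesis by (rule that[rotated])
qed

lemma grid_mem: "0 \<le> T \<Longrightarrow> i \<le> n \<Longrightarrow> n > 0 \<Longrightarrow> grid s T n i \<in> {s..s+T}"
  using grid_ge[of T s n i] grid_le[of T i n s] by auto

lemma grid_rational: "s \<in> \<rat> \<Longrightarrow> T \<in> \<rat> \<Longrightarrow> grid s T n i \<in> \<rat>"
  unfolding grid_def by (intro Rats_add Rats_divide Rats_mult Rats_of_nat)

section \<open>The logarithmic barrier and its generator bound\<close>

definition barrier :: "real \<Rightarrow> real \<Rightarrow> real" where
  "barrier a w = ln (1 + w) - ln w + a * exp (- sqrt w)"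
definition barrier1 :: "real \<Rightarrow> real \<Rightarrow> real" where
  "barrier1 a w = 1 / (1 + w) - 1 / w - a * exp (- sqrt w) / (2 * sqrt w)"
definition barrier2 :: "real \<Rightarrow> real \<Rightarrow> real" where
  "barrier2 a w = 1 / w\<^sup>2 - 1 / (1 + w)\<^sup>2 + a * exp (- sqrt w) * (1 / (4 * w) + 1 / (4 * w * sqrt w))"

lemma barrier_deriv:
  assumes "w > 0"
  shows "(barrier a has_real_derivative barrier1 a w) (at w)"
    "(barrier1 a has_real_derivative barrier2 a w) (at w)"
proof -
  show "(barrier a has_real_derivative barrier1 a w) (at w)"
    unfolding barrier_def[abs_def] barrier1_def
    apply (rule derivative_eq_intros refl | use assms in simp; fail)+
    subgoal
    proof -
      have "E * - (inverse r / 2 * 1) * a = - (a * E / (2 * r))" for E r :: real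
        by (cases "r = 0") (simp_all add: field_simps)
      then show ?thesis by simp
    qed
    done
  have w: "w = sqrt w * sqrt w" "sqrt w > 0" using assms by auto
  show "(barrier1 a has_real_derivative barrier2 a w) (at w)"
    unfolding barrier1_def[abs_def] barrier2_def
    apply (rule derivative_eq_intros refl | use assms in simp; fail)+
    subgoal
    proof -
      have "((0 * E + E * - (inverse r / 2 * 1) * a) * (2 * r) - a * E * (0 * r + inverse r / 2 * 1 * 2)) /
         (2 * r * (2 * r)) = - (a * E * (1 / (4 * (r * r)) + 1 / (4 * (r * r) * r)))" if "r > 0" for E r :: real
        using that by (simp add: field_simps)
      from this[OF w(2), folded w(1)]
      show ?thesis by (simp add: power2_eq_square)
    qed
    done
qed

lemma barrier_bounds:
  assumes "w > 0" "a \<ge> 0"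
  shows "ln (1 + 1 / w) \<le> barrier a w" "barrier a w \<le> ln (1 + 1 / w) + a" "0 \<le> barrier a w"
proof -
  have "1 + 1 / w = (1 + w) / w" using assms by (simp add: field_simps)
  then have e: "ln (1 + 1 / w) = ln (1 + w) - ln w" using assms by (simp add: ln_div)
  show "ln (1 + 1 / w) \<le> barrier a w" using assms by (simp add: e barrier_def)
  moreover have "0 \<le> ln (1 + 1 / w)" using assms by (intro ln_ge_zero) auto
  ultimately show "0 \<le> barrier a w" by simp
  have "a * exp (- sqrt w) \<le> a * 1" using assms by (intro mult_left_mono) auto
  then show "barrier a w \<le> ln (1 + 1 / w) + a" by (simp add: e barrier_def)
qed

text \<open>The bound degenerates as \<open>\<epsilon>\<close> tends to 0, but it serves only for a
  fixed \<open>\<epsilon>\<close>, in integrability and error estimates. The generator bound, by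
  contrast, is uniform in \<open>\<epsilon>\<close>.\<close>

lemma barrier_test_function:
  assumes "\<epsilon> > 0" "a \<ge> 0"
  shows "test_function (\<lambda>v. barrier a (v + \<epsilon>)) (\<lambda>v. barrier1 a (v + \<epsilon>)) (\<lambda>v. barrier2 a (v + \<epsilon>))
    (ln (1 + 1 / \<epsilon>) + a + 1 / \<epsilon> + a / (2 * sqrt \<epsilon>))"
proof
  fix v :: real assume v: "v \<ge> 0"
  then have w: "v + \<epsilon> > 0" using assms by simp
  show "((\<lambda>v. barrier a (v + \<epsilon>)) has_real_derivative barrier1 a (v + \<epsilon>)) (at v)"
    using barrier_deriv(1)[OF w, of a] by (simp add: DERIV_shift)
  show "((\<lambda>v. barrier1 a (v + \<epsilon>)) has_real_derivative barrier2 a (v + \<epsilon>)) (at v)"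
    using barrier_deriv(2)[OF w, of a] by (simp add: DERIV_shift)
  have "ln (1 + 1 / (v + \<epsilon>)) \<le> ln (1 + 1 / \<epsilon>)"
    using v assms w by (subst ln_le_cancel_iff) (auto simp: field_simps intro: add_pos_pos)
  moreover have l: "0 \<le> ln (1 + 1 / \<epsilon>)" using assms by (intro ln_ge_zero) auto
  moreover have p: "0 \<le> 1 / \<epsilon>" "0 \<le> a / (2 * sqrt \<epsilon>)" using assms by auto
  ultimately show "\<bar>barrier a (v + \<epsilon>)\<bar> \<le> ln (1 + 1 / \<epsilon>) + a + 1 / \<epsilon> + a / (2 * sqrt \<epsilon>)"
    using barrier_bounds[OF w assms(2)] by linarith
  have 1: "0 \<le> 1 / (v + \<epsilon>) - 1 / (1 + (v + \<epsilon>))" "0 \<le> 1 / (1 + (v + \<epsilon>))" "1 / (v + \<epsilon>) \<le> 1 / \<epsilon>"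
    using v w assms by (auto simp: field_simps)
  have 2: "0 \<le> a * exp (- sqrt (v + \<epsilon>)) / (2 * sqrt (v + \<epsilon>))" using assms w by simp
  have "a * exp (- sqrt (v + \<epsilon>)) / (2 * sqrt (v + \<epsilon>)) \<le> a * 1 / (2 * sqrt \<epsilon>)"
    using assms v w by (intro frac_le mult_left_mono) auto
  then show "\<bar>barrier1 a (v + \<epsilon>)\<bar> \<le> ln (1 + 1 / \<epsilon>) + a + 1 / \<epsilon> + a / (2 * sqrt \<epsilon>)"
    unfolding barrier1_def using 1 2 l assms(2) by linarith
next
  show "continuous_on {0..} (\<lambda>v. barrier2 a (v + \<epsilon>))"
    unfolding barrier2_def using assms
    by (intro continuous_intros) (auto simp: add_nonneg_eq_0_iff)
qed

text \<open>The logarithm alone produces a drift error of order \<open>2 * k / sqrt w\<close>, which the summand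
  \<open>a * exp (- sqrt w)\<close> with \<open>a * \<tau> = 8 * k\<close> absorbs.\<close>
lemma barrier_generator_le:
  fixes \<tau> k D q w a :: real
  assumes w: "w > 0" and \<tau>: "\<tau> > 0" and k: "k \<ge> 0" and a: "a = 8 * k / \<tau>"
    and D: "D \<ge> \<tau> - 2 * k * sqrt w" and q: "0 \<le> q" "2 * q \<le> \<tau> * w"
  shows "barrier1 a w * D + 2 * barrier2 a w * q \<le> \<tau> + a * (\<tau> / 2 + k)"
proof -
  define r where "r = sqrt w"
  have r: "w = r * r" "r > 0" using w by (auto simp: r_def)
  have a0: "a \<ge> 0" using a k \<tau> by simp
  define e where "e = exp (- r)"
  have e: "0 < e" "e \<le> 1" "1 - r \<le> e" using r exp_ge_add_one_self[of "- r"] by (auto simp: e_def)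
  \<comment> \<open>\<open>-P\<close> and \<open>S\<close> are the first and second derivatives of
    the logarithmic part.\<close>
  define P where "P = 1 / w - 1 / (1 + w)"
  define S where "S = 1 / w\<^sup>2 - 1 / (1 + w)\<^sup>2"
  have P: "P \<ge> 0" "P \<le> 1 / w" using w by (auto simp: P_def intro!: frac_le)
  have S0: "S \<ge> 0" using w by (auto simp: S_def intro!: frac_le power_mono)
  \<comment> \<open>The cancellation behind the critical case: the singular parts of
    \<open>w * S\<close> and \<open>P\<close> agree, leaving a bounded remainder.\<close>
  have wS: "w * S = P + 1 / (1 + w)\<^sup>2"
  proof -
    have nz: "w \<noteq> 0" "1 + w \<noteq> 0" using w by auto
    show ?thesis using nz unfolding S_def P_def
      by (simp add: divide_simps) (simp add: algebra_simps power2_eq_square)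
  qed
  have "- P * D + 2 * S * q \<le> - P * (\<tau> - 2 * k * r) + S * (\<tau> * w)"
    using mult_left_mono[OF D P(1)] mult_left_mono[OF q(2) S0] by (simp add: r_def[symmetric] mult_ac)
  also have "\<dots> = 2 * k * r * P + \<tau> * (w * S - P)" by (simp add: algebra_simps)
  also have "\<dots> = 2 * k * r * P + \<tau> * (1 / (1 + w)\<^sup>2)" by (simp add: wS)
  also have "\<dots> \<le> 2 * k * r * (1 / w) + \<tau> * 1"
    using P k r \<tau> w by (intro add_mono mult_left_mono) (auto simp: divide_le_eq_1 one_le_power)
  also have "\<dots> = 2 * k / r + \<tau>" using r by simp
  finally have 1: "- P * D + 2 * S * q \<le> 2 * k / r + \<tau>" .
  have "- D / (2 * r) + 2 * q * (1 / (4 * w) + 1 / (4 * w * r))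
     \<le> - (\<tau> - 2 * k * r) / (2 * r) + (\<tau> * w) * (1 / (4 * w) + 1 / (4 * w * r))"
    using D q r w by (intro add_mono divide_right_mono mult_right_mono) (auto simp: r_def[symmetric])
  also have "\<dots> = - (\<tau> / (4 * r)) + k + \<tau> / 4" using r by (simp add: field_simps)
  finally have "e * (- D / (2 * r) + 2 * q * (1 / (4 * w) + 1 / (4 * w * r))) \<le> e * (- (\<tau> / (4 * r)) + k + \<tau> / 4)"
    using e by (intro mult_left_mono) auto
  also have "\<dots> = - (e * (\<tau> / (4 * r))) + e * (k + \<tau> / 4)" by (simp add: algebra_simps)
  \<comment> \<open>Replacing \<open>e\<close> by \<open>1 - r\<close> in the negative term costs
    only the constant \<open>\<tau> / 4\<close>.\<close>
  also have "\<dots> \<le> - ((1 - r) * (\<tau> / (4 * r))) + 1 * (k + \<tau> / 4)"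
    using e r \<tau> k by (intro add_mono le_imp_neg_le mult_right_mono) auto
  also have "\<dots> = - (\<tau> / (4 * r)) + (\<tau> / 2 + k)" using r by (simp add: field_simps)
  finally have 2: "a * (e * (- D / (2 * r) + 2 * q * (1 / (4 * w) + 1 / (4 * w * r)))) \<le> a * (- (\<tau> / (4 * r)) + (\<tau> / 2 + k))"
    using a0 by (intro mult_left_mono)
  \<comment> \<open>This fixes \<open>a = 8 * k / \<tau>\<close>: the two terms of order
    \<open>1 / r\<close> cancel exactly.\<close>
  have 3: "a * (\<tau> / (4 * r)) = 2 * k / r" using \<tau> by (simp add: a)
  have "barrier1 a w * D + 2 * barrier2 a w * q = (- P * D + 2 * S * q)
      + a * (e * (- D / (2 * r) + 2 * q * (1 / (4 * w) + 1 / (4 * w * r))))"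
    unfolding barrier1_def barrier2_def P_def S_def e_def r_def by (simp add: algebra_simps diff_divide_distrib)
  also have "\<dots> \<le> (2 * k / r + \<tau>) + a * (- (\<tau> / (4 * r)) + (\<tau> / 2 + k))" using 1 2 by (rule add_mono)
  also have "\<dots> = (2 * k / r + \<tau>) + (- (a * (\<tau> / (4 * r))) + a * (\<tau> / 2 + k))" by (simp only: distrib_left mult_minus_right)
  also have "\<dots> = \<tau> + a * (\<tau> / 2 + k)" unfolding 3 by simp
  finally show ?thesis .
qed

text \<open>At the origin the shifted generator reduces to \<open>barrier1\<close> times the trace;
  its size \<open>1 / \<epsilon>\<close> is what makes resting at 0 too costly.\<close>

lemma barrier1_at: "\<epsilon> > 0 \<Longrightarrow> a \<ge> 0 \<Longrightarrow> barrier1 a \<epsilon> \<le> 1 - 1 / \<epsilon>"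
proof -
  assume e: "\<epsilon> > 0" "a \<ge> 0"
  have "1 / (1 + \<epsilon>) \<le> 1" "0 \<le> a * exp (- sqrt \<epsilon>) / (2 * sqrt \<epsilon>)" using e by (auto simp: field_simps)
  then show ?thesis unfolding barrier1_def by linarith
qed

context reflection_data
begin

text \<open>The norm of \<open>z\<close> is at most a multiple of \<open>sqrt (V z)\<close>, so near
  the origin the contribution of \<open>mu\<close> is of lower order than a positive trace.\<close>

lemma drift_bound:
  obtains k where "k \<ge> 0" "\<And>z. \<bar>(Om *v z) \<bullet> mu\<bar> \<le> k * sqrt (V z)"
proof -
  obtain \<kappa> where \<kappa>: "\<kappa> > 0" "\<And>x. norm (Om *v x) \<le> \<kappa> * norm x" by (rule Om_bound) blast
  obtain l where l: "l > 0" "\<And>x. l * (norm x)\<^sup>2 \<le> V x"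
    using pos_def_coercive[of Om] Om_spd unfolding sym_pos_def_def V_def by metis
  show ?thesis
  proof (rule that[of "\<kappa> * norm mu / sqrt l"])
    show "\<kappa> * norm mu / sqrt l \<ge> 0" using \<kappa> l by simp
    fix z
    have "sqrt l * norm z \<le> sqrt (V z)"
      using real_sqrt_le_mono[OF l(2)[of z]] by (simp add: real_sqrt_mult)
    then have n: "norm z \<le> sqrt (V z) / sqrt l" using l by (simp add: field_simps)
    have "\<bar>(Om *v z) \<bullet> mu\<bar> \<le> norm (Om *v z) * norm mu" by (rule Cauchy_Schwarz_ineq2)
    also have "\<dots> \<le> (\<kappa> * (sqrt (V z) / sqrt l)) * norm mu"
      using n \<kappa> by (intro mult_right_mono order_trans[OF \<kappa>(2)] mult_left_mono) auto
    finally show "\<bar>(Om *v z) \<bullet> mu\<bar> \<le> \<kappa> * norm mu / sqrt l * sqrt (V z)" by (simp add: mult_ac)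
  qed
qed

lemma Q_nonneg: "Q z \<ge> 0"
  using A_spd unfolding Q_def sym_pos_def_def by (cases "Om *v z = 0") (auto simp: less_imp_le)

lemma V_0 [simp]: "V 0 = 0" by simp

lemma Q_0 [simp]: "Q 0 = 0" by (simp add: Q_def)

lemma drift_0 [simp]: "drift 0 = trace (Om ** A)" by (simp add: drift_def)

end

section \<open>Stopping at the exit from a region, observed on the grid\<close>

context reflected
begin

text \<open>\<open>E0\<close> is an event decided at the start, \<open>S\<close> the region in which
  the path must have stayed so far. The set is known at the current grid time, as the one-step
  estimate demands.\<close>

definition stopped :: "real \<Rightarrow> real \<Rightarrow> nat \<Rightarrow> real \<Rightarrow> 'a set \<Rightarrow> (real^'n) set \<Rightarrow> nat \<Rightarrow> 'a set" where
  "stopped s T n N E0 S i = {\<omega>\<in>E0. \<forall>j\<le>i. norm (Z (grid s T n j) \<omega>) \<le> N \<and> ell (grid s T n j) \<omega> \<le> N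
     \<and> Z (grid s T n j) \<omega> \<in> S}"

lemma stopped_measurable:
  assumes "0 \<le> s" "0 \<le> T" and E0: "E0 \<in> sets (F s)" and S: "S \<in> sets borel"
  shows "stopped s T n N E0 S i \<in> sets (F (grid s T n i))"
proof -
  let ?P = "\<lambda>j \<omega>. norm (Z (grid s T n j) \<omega>) \<le> N \<and> ell (grid s T n j) \<omega> \<le> N \<and> Z (grid s T n j) \<omega> \<in> S"
  have "{\<omega>\<in>space M. ?P j \<omega>} \<in> sets (F (grid s T n i))" if "j \<le> i" for j
  proof -
    have g0: "0 \<le> grid s T n j" using grid_ge[of T s n j] assms by simp
    have [measurable]: "Z (grid s T n j) \<in> borel_measurable (F (grid s T n i))"
      by (rule F_measurable_mono[OF grid_mono Z_measurable]) (use assms that g0 in auto)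
    have [measurable]: "ell (grid s T n j) \<in> borel_measurable (F (grid s T n i))"
      by (rule F_measurable_mono[OF grid_mono ell_measurable]) (use assms that g0 in auto)
    note S[measurable]
    show ?thesis unfolding space_F[of "grid s T n i", symmetric] by measurable
  qed
  then have "(\<Inter>j\<in>{..i}. {\<omega>\<in>space M. ?P j \<omega>}) \<in> sets (F (grid s T n i))"
    by (intro sets.finite_INT) auto
  moreover have "E0 \<in> sets (F (grid s T n i))" using E0 F_mono[OF grid_ge[of T s n i]] assms by auto
  moreover have "stopped s T n N E0 S i = E0 \<inter> (\<Inter>j\<in>{..i}. {\<omega>\<in>space M. ?P j \<omega>})"
    using sets.sets_into_space[OF E0] by (auto simp: stopped_def space_F)
  ultimately show ?thesis by simp
qed

lemma stopped_events:
  assumes "0 \<le> s" "0 \<le> T" "E0 \<in> sets (F s)" "S \<in> sets borel"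
  shows "stopped s T n N E0 S i \<in> events"
  using stopped_measurable[OF assms] F_sub by blast

end

lemma (in reflected_test) stopped_localized:
  assumes "E0 \<subseteq> space M"
  shows "stopped s T n N E0 S i \<subseteq> localized s T n N i"
  using assms by (auto simp: stopped_def localized_def)

text \<open>A shorter horizon is the stopping rule that is empty from step \<open>m\<close> on;
  uniformity over stopping rules therefore lets one grid serve all \<open>m\<close>.\<close>

lemma (in reflected_test) dynkin_stopped:
  assumes "0 \<le> s" "0 < T" "0 \<le> N" "\<eta> > 0" and E0: "E0 \<in> sets (F s)" and S: "S \<in> sets borel"
  shows "\<forall>\<^sub>F n in sequentially. \<forall>m\<le>n.
    integrable M (gain s T n (stopped s T n N E0 S) m) \<and> integrable M (compensator s T n (stopped s T n N E0 S) m) \<and>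
    \<bar>expectation (gain s T n (stopped s T n N E0 S) m) - expectation (compensator s T n (stopped s T n N E0 S) m)\<bar> \<le> \<eta>"
  using dynkin[OF assms(1-4)]
proof eventually_elim
  case (elim n)
  have E0M: "E0 \<subseteq> space M" using sets.sets_into_space[OF E0] by (simp add: space_F)
  show ?case
  proof (intro allI impI)
    fix m assume m: "m \<le> n"
    define E where "E = (\<lambda>i. if i < m then stopped s T n N E0 S i else {})"
    have "\<forall>i<n. E i \<in> sets (F (grid s T n i)) \<and> E i \<subseteq> localized s T n N i"
      using stopped_measurable[OF assms(1) _ E0 S] stopped_localized[OF E0M] assms(2) by (auto simp: E_def)
    note D = elim[rule_format, OF this[rule_format]]
    have *: "(\<Sum>i<n. indicator (E i) \<omega> * g i) = (\<Sum>i<m. indicator (stopped s T n N E0 S i) \<omega> * g i)" for \<omega> and g :: "nat \<Rightarrow> real"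
    proof -
      have "(\<Sum>i<n. indicator (E i) \<omega> * g i) = (\<Sum>i<m. indicator (E i) \<omega> * g i)"
        by (rule sum.mono_neutral_right) (use m in \<open>auto simp: E_def\<close>)
      then show ?thesis by (simp add: E_def)
    qed
    show "integrable M (gain s T n (stopped s T n N E0 S) m) \<and> integrable M (compensator s T n (stopped s T n N E0 S) m) \<and>
      \<bar>expectation (gain s T n (stopped s T n N E0 S) m) - expectation (compensator s T n (stopped s T n N E0 S) m)\<bar> \<le> \<eta>"
      using D unfolding gain_def compensator_def * by blast
  qed
qed

lemma (in reflected) stopped_path:
  fixes g :: "real \<Rightarrow> real"
  assumes "\<omega> \<in> E0"
  obtains k where "k \<le> m"
    "(\<Sum>i<m. indicator (stopped s T n N E0 S i) \<omega> * (g (V (Z (grid s T n (Suc i)) \<omega>)) - g (V (Z (grid s T n i) \<omega>))))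
      = g (V (Z (grid s T n k) \<omega>)) - g (V (Z s \<omega>))"
    "\<And>j. j < k \<Longrightarrow> norm (Z (grid s T n j) \<omega>) \<le> N \<and> ell (grid s T n j) \<omega> \<le> N \<and> Z (grid s T n j) \<omega> \<in> S"
    "k < m \<Longrightarrow> \<not> (norm (Z (grid s T n k) \<omega>) \<le> N \<and> ell (grid s T n k) \<omega> \<le> N \<and> Z (grid s T n k) \<omega> \<in> S)"
proof -
  let ?P = "\<lambda>j. norm (Z (grid s T n j) \<omega>) \<le> N \<and> ell (grid s T n j) \<omega> \<le> N \<and> Z (grid s T n j) \<omega> \<in> S"
  let ?x = "\<lambda>i. g (V (Z (grid s T n i) \<omega>))"
  have "(\<Sum>i<m. indicator (stopped s T n N E0 S i) \<omega> * (?x (Suc i) - ?x i)) = (\<Sum>i<m. if \<forall>j\<le>i. ?P j then ?x (Suc i) - ?x i else 0)"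
    using assms by (intro sum.cong refl) (auto simp: stopped_def indicator_def)
  with stopped_sum[of m ?P ?x] that show ?thesis by auto
qed

section \<open>The origin is avoided\<close>

locale supercritical = reflected A Om R mu c M F z0 B Z L
  for A Om R :: "real^'n^'n" and mu c and M :: "'a measure" and F z0 B Z L +
  assumes trace_pos: "trace (Om ** A) > 0"
    and supercrit: "\<And>z. z \<in> orthant \<Longrightarrow> 2 * Q z \<le> trace (Om ** A) * V z"
begin

text \<open>Since \<open>2 * Q \<le> \<tau> * V\<close> implies
  \<open>2 * Q \<le> \<tau> * (V + \<epsilon>)\<close>, the bound does not depend on
  \<open>\<epsilon>\<close>. This is essential: a small \<open>\<epsilon>\<close> raises the barrier
  while \<open>C\<close> stays fixed.\<close>

lemma barrier_generator_bounded:
  obtains a C where "a \<ge> 0" "C \<ge> 0" "\<And>\<epsilon> z. \<epsilon> > 0 \<Longrightarrow> z \<in> orthant \<Longrightarrow>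
    gen (\<lambda>v. barrier1 a (v + \<epsilon>)) (\<lambda>v. barrier2 a (v + \<epsilon>)) z \<le> C"
proof -
  obtain k where k: "k \<ge> 0" "\<And>z. \<bar>(Om *v z) \<bullet> mu\<bar> \<le> k * sqrt (V z)" by (rule drift_bound) blast
  define \<tau> where "\<tau> = trace (Om ** A)"
  have \<tau>: "\<tau> > 0" using trace_pos by (simp add: \<tau>_def)
  define a where "a = 8 * k / \<tau>"
  have a: "a \<ge> 0" using k \<tau> by (simp add: a_def)
  show ?thesis
  proof (rule that[OF a])
    show "\<tau> + a * (\<tau> / 2 + k) \<ge> 0" using a \<tau> k by simp
    fix \<epsilon> :: real and z :: "real^'n" assume \<epsilon>: "\<epsilon> > 0" and z: "z \<in> orthant"
    have w: "V z + \<epsilon> > 0" using \<epsilon> V_nonneg[of z] by linarith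
    have "k * sqrt (V z) \<le> k * sqrt (V z + \<epsilon>)" using k \<epsilon> by (intro mult_left_mono) auto
    then have D: "drift z \<ge> \<tau> - 2 * k * sqrt (V z + \<epsilon>)"
      using k(2)[of z] unfolding drift_def \<tau>_def by linarith
    have "\<tau> * V z \<le> \<tau> * (V z + \<epsilon>)" using \<tau> \<epsilon> by (intro mult_left_mono) auto
    then have q: "2 * Q z \<le> \<tau> * (V z + \<epsilon>)" using supercrit[OF z] by (simp add: \<tau>_def)
    show "gen (\<lambda>v. barrier1 a (v + \<epsilon>)) (\<lambda>v. barrier2 a (v + \<epsilon>)) z \<le> \<tau> + a * (\<tau> / 2 + k)"
      unfolding gen_def by (rule barrier_generator_le[OF w \<tau> k(1) a_def D Q_nonneg q])
  qed
qed

text \<open>A maximal inequality: the barrier starts below \<open>C\<delta>\<close>, its stopped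
  mean grows by at most \<open>C * T + 1\<close>, and it is nonnegative everywhere and at least
  \<open>m\<close> once \<open>V \<le> \<epsilon>\<close>. Coming that close has probability at most
  \<open>(C\<delta> + C * T + 1) / m\<close>, and \<open>m\<close> can be made as large as
  desired.\<close>

lemma no_hit_after_leaving:
  assumes s: "0 \<le> s" and T: "0 < T" and \<delta>: "0 < \<delta>" and N: "0 \<le> N"
  shows "AE \<omega> in M. \<not> (V (Z s \<omega>) \<ge> \<delta> \<and> (\<exists>u\<in>{s..s+T}. Z u \<omega> = 0) \<and>
    (\<forall>u\<in>{s..s+T}. norm (Z u \<omega>) \<le> N \<and> ell u \<omega> \<le> N))"
proof (rule AE_not_by_eventual_cover)
  fix \<eta> :: real assume \<eta>: "\<eta> > 0"
  obtain a C where aC: "a \<ge> 0" "C \<ge> 0" "\<And>\<epsilon> z. \<epsilon> > 0 \<Longrightarrow> z \<in> orthant \<Longrightarrow>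
    gen (\<lambda>v. barrier1 a (v + \<epsilon>)) (\<lambda>v. barrier2 a (v + \<epsilon>)) z \<le> C" by (rule barrier_generator_bounded) blast
  define C\<delta> where "C\<delta> = ln (1 + 1 / \<delta>) + a"
  have C\<delta>: "C\<delta> \<ge> 0" using \<delta> aC by (auto simp: C\<delta>_def intro!: add_nonneg_nonneg ln_ge_zero)
  define m where "m = (C\<delta> + C * T + 1) / \<eta>"
  have m: "m > 0" using C\<delta> aC T \<eta> by (simp add: m_def add_nonneg_pos)
  \<comment> \<open>If \<open>V \<le> \<epsilon>\<close> then
    \<open>V + \<epsilon> \<le> exp (- m)\<close>, so the logarithm alone is at least
    \<open>m\<close>.\<close>
  define \<epsilon> where "\<epsilon> = exp (- m) / 2"
  have \<epsilon>: "\<epsilon> > 0" by (simp add: \<epsilon>_def)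
  let ?f = "\<lambda>v. barrier a (v + \<epsilon>)" and ?f1 = "\<lambda>v. barrier1 a (v + \<epsilon>)" and ?f2 = "\<lambda>v. barrier2 a (v + \<epsilon>)"
  interpret T: reflected_test A Om R mu c M F z0 B Z L ?f ?f1 ?f2
      "ln (1 + 1 / \<epsilon>) + a + 1 / \<epsilon> + a / (2 * sqrt \<epsilon>)"
    using reflected_axioms barrier_test_function[OF \<epsilon> aC(1)] by (rule reflected_test.intro)
  have low: "?f v \<ge> m" if "0 \<le> v" "v \<le> \<epsilon>" for v
  proof -
    have w: "v + \<epsilon> > 0" "v + \<epsilon> \<le> exp (- m)" using that \<epsilon> by (linarith, simp add: \<epsilon>_def)
    have "exp m \<le> 1 / (v + \<epsilon>)" using w by (simp add: exp_minus field_simps)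
    then have "m \<le> ln (1 + 1 / (v + \<epsilon>))" using w by (subst ln_ge_iff) (auto intro: add_pos_pos)
    then show ?thesis using barrier_bounds(1)[OF w(1) aC(1)] by linarith
  qed
  have high: "?f v \<le> C\<delta>" if "v \<ge> \<delta>" for v
  proof -
    have w: "v + \<epsilon> \<ge> \<delta>" "v + \<epsilon> > 0" using that \<epsilon> \<delta> by auto
    have "ln (1 + 1 / (v + \<epsilon>)) \<le> ln (1 + 1 / \<delta>)"
      using w \<delta> by (subst ln_le_cancel_iff) (auto intro!: add_pos_pos frac_le)
    then show ?thesis using barrier_bounds(2)[OF w(2) aC(1)] by (simp add: C\<delta>_def)
  qed
  have pos: "?f v \<ge> 0" if "v \<ge> 0" for v using barrier_bounds(3)[of "v + \<epsilon>" a] that \<epsilon> aC by simp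
  define S :: "(real^'n) set" where "S = {z. V z > \<epsilon>}"
  have "open S" unfolding S_def by (intro open_Collect_less continuous_intros)
  then have S: "S \<in> sets borel" by simp
  define E0 where "E0 = {\<omega>\<in>space M. V (Z s \<omega>) \<ge> \<delta>}"
  have VZ: "(\<lambda>\<omega>. V (Z t \<omega>)) \<in> borel_measurable (F t)" if "0 \<le> t" for t
    using measurable_compose[OF Z_measurable[OF that] borel_measurable_continuous_onI[OF V_cont]] .
  have E0: "E0 \<in> sets (F s)"
    using VZ[OF s] unfolding E0_def space_F[of s, symmetric] by measurable
  \<comment> \<open>Paths within the localisation bounds at all grid points that come down to
    \<open>V \<le> \<epsilon>\<close> at one of them.\<close>
  define H where "H = (\<lambda>n. {\<omega>\<in>E0. (\<forall>j\<le>n. norm (Z (grid s T n j) \<omega>) \<le> N \<and> ell (grid s T n j) \<omega> \<le> N)}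
      - {\<omega>\<in>E0. \<forall>j\<le>n. norm (Z (grid s T n j) \<omega>) \<le> N \<and> ell (grid s T n j) \<omega> \<le> N \<and> Z (grid s T n j) \<omega> \<in> S})"
  have Heq: "H n = stopped s T n N E0 UNIV n - stopped s T n N E0 S n" for n
    by (simp add: H_def stopped_def)
  have Hm: "H n \<in> events" for n
    unfolding Heq using stopped_events[OF s _ E0] S T by auto
  have HE0: "H n \<subseteq> E0" for n by (auto simp: H_def)
  have g0: "0 \<le> grid s T n i" for n i using grid_ge[of T s n i] s T by simp
  show "\<exists>H. (\<forall>n. H n \<in> events) \<and> (\<forall>\<^sub>F n in sequentially. prob (H n) \<le> \<eta>) \<and>
     (\<forall>\<omega>\<in>space M. (V (Z s \<omega>) \<ge> \<delta> \<and> (\<exists>u\<in>{s..s+T}. Z u \<omega> = 0) \<and>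
    (\<forall>u\<in>{s..s+T}. norm (Z u \<omega>) \<le> N \<and> ell u \<omega> \<le> N)) \<longrightarrow> (\<forall>\<^sub>F n in sequentially. \<omega> \<in> H n))"
  proof (intro exI conjI allI ballI impI)
    show "H n \<in> events" for n by (rule Hm)
    show "\<forall>\<^sub>F n in sequentially. prob (H n) \<le> \<eta>"
      using T.dynkin_stopped[OF s T N zero_less_one E0 S] eventually_gt_at_top[of 0]
    proof eventually_elim
      case (elim n)
      let ?S1 = "\<lambda>\<omega>. \<Sum>i<n. indicator (stopped s T n N E0 S i) \<omega> * (?f (V (Z (grid s T n (Suc i)) \<omega>)) - ?f (V (Z (grid s T n i) \<omega>)))"
      let ?S2 = "\<lambda>\<omega>. \<Sum>i<n. indicator (stopped s T n N E0 S i) \<omega> * (T / n * gen ?f1 ?f2 (Z (grid s T n i) \<omega>))"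
      have D: "integrable M ?S1" "integrable M ?S2" "\<bar>expectation ?S1 - expectation ?S2\<bar> \<le> 1"
        using elim(1)[rule_format, OF order.refl] unfolding T.gain_def T.compensator_def by blast+
      have "expectation ?S2 \<le> expectation (\<lambda>\<omega>. C * T)"
      proof (rule integral_mono[OF D(2)])
        fix \<omega> assume \<omega>: "\<omega> \<in> space M"
        have "?S2 \<omega> \<le> (\<Sum>i<n. T / n * C)"
        proof (rule sum_mono)
          fix i
          have "T / n * gen ?f1 ?f2 (Z (grid s T n i) \<omega>) \<le> T / n * C"
            using T by (intro mult_left_mono aC(3)[OF \<epsilon>] Z_orthant g0 \<omega>) auto
          then show "indicator (stopped s T n N E0 S i) \<omega> * (T / n * gen ?f1 ?f2 (Z (grid s T n i) \<omega>)) \<le> T / n * C"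
            using T aC(2) by (auto simp: indicator_def)
        qed
        also have "\<dots> = C * T" using elim(2) by simp
        finally show "?S2 \<omega> \<le> C * T" .
      qed auto
      then have up: "expectation ?S1 \<le> C * T + 1" using D(3) by (simp add: prob_space)
      have HI: "integrable M (\<lambda>\<omega>. m * indicator (H n) \<omega>)" using Hm[of n]
        by (intro integrable_mult_right integrable_real_indicator) (auto simp: emeasure_eq_measure)
      have "m * prob (H n) - C\<delta> = expectation (\<lambda>\<omega>. m * indicator (H n) \<omega> - C\<delta>)"
        using HI by (subst Bochner_Integration.integral_diff) (use Hm[of n] in \<open>auto simp: prob_space\<close>)
      also have "\<dots> \<le> expectation ?S1"
      proof (rule integral_mono[OF _ D(1)])
        show "integrable M (\<lambda>\<omega>. m * indicator (H n) \<omega> - C\<delta>)"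
          using HI by (rule Bochner_Integration.integrable_diff) simp
        fix \<omega> assume \<omega>: "\<omega> \<in> space M"
        show "m * indicator (H n) \<omega> - C\<delta> \<le> ?S1 \<omega>"
        proof (cases "\<omega> \<in> E0")
          case False
          then have "\<omega> \<notin> H n" "\<And>i. \<omega> \<notin> stopped s T n N E0 S i" using HE0 by (auto simp: stopped_def)
          then show ?thesis using C\<delta> by simp
        next
          case True
          from stopped_path[OF True, of n s T n N S ?f] obtain k where k: "k \<le> n"
            "?S1 \<omega> = ?f (V (Z (grid s T n k) \<omega>)) - ?f (V (Z s \<omega>))"
            "\<And>j. j < k \<Longrightarrow> norm (Z (grid s T n j) \<omega>) \<le> N \<and> ell (grid s T n j) \<omega> \<le> N \<and> Z (grid s T n j) \<omega> \<in> S"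
            "k < n \<Longrightarrow> \<not> (norm (Z (grid s T n k) \<omega>) \<le> N \<and> ell (grid s T n k) \<omega> \<le> N \<and> Z (grid s T n k) \<omega> \<in> S)"
            by blast
          have f0: "?f (V (Z s \<omega>)) \<le> C\<delta>" using True by (intro high) (simp add: E0_def)
          show ?thesis
          proof (cases "\<omega> \<in> H n")
            case True
            have "Z (grid s T n k) \<omega> \<notin> S"
            proof (cases "k < n")
              case True
              then show ?thesis using k(4) \<open>\<omega> \<in> H n\<close> by (auto simp: H_def)
            next
              case False
              then have "k = n" using k(1) by simp
              show ?thesis
              proof
                assume "Z (grid s T n k) \<omega> \<in> S"
                then have "\<forall>j\<le>n. Z (grid s T n j) \<omega> \<in> S" using k(3) \<open>k = n\<close> by (metis le_neq_implies_less)
                then show False using \<open>\<omega> \<in> H n\<close> by (auto simp: H_def)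
              qed
            qed
            then have "?f (V (Z (grid s T n k) \<omega>)) \<ge> m" by (intro low) (auto simp: S_def)
            then show ?thesis using k(2) f0 True by simp
          next
            case False
            have "?f (V (Z (grid s T n k) \<omega>)) \<ge> 0" by (rule pos) simp
            then show ?thesis using k(2) f0 False by simp
          qed
        qed
      qed
      finally have "m * prob (H n) \<le> C\<delta> + C * T + 1" using up by simp
      also have "\<dots> = m * \<eta>" using \<eta> by (simp add: m_def)
      finally show ?case using m by simp
    qed
    fix \<omega> assume \<omega>: "\<omega> \<in> space M" and bad: "V (Z s \<omega>) \<ge> \<delta> \<and> (\<exists>u\<in>{s..s+T}. Z u \<omega> = 0) \<and>
      (\<forall>u\<in>{s..s+T}. norm (Z u \<omega>) \<le> N \<and> ell u \<omega> \<le> N)"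
    then obtain u where u: "u \<in> {s..s+T}" "Z u \<omega> = 0" by blast
    have "continuous_on {s..s+T} (\<lambda>t. V (Z t \<omega>))"
      by (rule continuous_on_compose2[OF V_cont continuous_on_subset[OF Z_path[OF \<omega>]]]) (use s in auto)
    from interval_modulus[OF this \<epsilon>] obtain d where d: "d > 0"
      "\<And>u v. u \<in> {s..s+T} \<Longrightarrow> v \<in> {s..s+T} \<Longrightarrow> \<bar>v - u\<bar> < d \<Longrightarrow> dist (V (Z v \<omega>)) (V (Z u \<omega>)) < \<epsilon>" by blast
    have "(\<lambda>n. T / real n) \<longlonglongrightarrow> 0" by (rule lim_const_over_n)
    then have "\<forall>\<^sub>F n in sequentially. T / real n < d" by (rule order_tendstoD(2)) (rule d)
    then show "\<forall>\<^sub>F n in sequentially. \<omega> \<in> H n"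
      using eventually_gt_at_top[of 0]
    proof eventually_elim
      case (elim n)
      from grid_near[OF u(1) T elim(2)] obtain j where j: "j \<le> n" "\<bar>u - grid s T n j\<bar> \<le> T / real n" .
      have gm: "i \<le> n \<Longrightarrow> grid s T n i \<in> {s..s+T}" for i using T elim by (intro grid_mem) auto
      have "dist (V (Z (grid s T n j) \<omega>)) (V (Z u \<omega>)) < \<epsilon>"
        using j elim by (intro d(2) u gm) auto
      then have "Z (grid s T n j) \<omega> \<notin> S" using u(2) by (simp add: S_def dist_real_def)
      then show ?case using bad gm j \<omega> by (auto simp: H_def E0_def)
    qed
  qed
qed

text \<open>Staying at 0 for a time \<open>T\<close> would lower the mean of the barrier by about
  \<open>T * \<tau> / \<epsilon>\<close>, whereas its value there is at most of order
  \<open>1 / sqrt \<epsilon>\<close>. Rational times are what a countable union of exceptional sets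
  yields later; rationality of \<open>T\<close> puts all grid points among them.\<close>

lemma no_sojourn:
  assumes T: "0 < T" and TQ: "T \<in> \<rat>" and N: "0 \<le> N"
  shows "AE \<omega> in M. \<not> ((\<forall>u\<in>\<rat> \<inter> {0..T}. Z u \<omega> = 0) \<and> ell T \<omega> \<le> N)"
proof (rule AE_not_by_eventual_cover)
  fix \<eta> :: real assume \<eta>: "\<eta> > 0"
  \<comment> \<open>The correction for \<open>mu\<close> is switched off: at the origin the drift is
    the trace alone.\<close>
  define a :: real where "a = 0"
  have aC: "a \<ge> 0" by (simp add: a_def)
  define \<tau> where "\<tau> = trace (Om ** A)"
  have \<tau>: "\<tau> > 0" using trace_pos by (simp add: \<tau>_def)
  \<comment> \<open>This quotient will be the final bound on the probability; it tends to 0 with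
    \<open>\<epsilon>\<close>.\<close>
  have "((\<lambda>\<epsilon>. (\<epsilon> * (1 + a) + 2 * sqrt \<epsilon>) / (T * \<tau> / 2)) \<longlongrightarrow> (0 * (1 + a) + 2 * sqrt 0) / (T * \<tau> / 2)) (at_right 0)"
    using T \<tau> by (intro tendsto_intros) auto
  then have "\<forall>\<^sub>F \<epsilon> in at_right 0. (\<epsilon> * (1 + a) + 2 * sqrt \<epsilon>) / (T * \<tau> / 2) < \<eta>"
    by (rule order_tendstoD(2)) (use \<eta> in simp)
  then have "\<forall>\<^sub>F \<epsilon> in at_right 0. (\<epsilon> * (1 + a) + 2 * sqrt \<epsilon>) / (T * \<tau> / 2) < \<eta> \<and> \<epsilon> \<in> {0<..<1/2}"
    by (intro eventually_conj eventually_at_right_real) auto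
  from eventually_happens'[OF trivial_limit_at_right_real this]
  obtain \<epsilon> where \<epsilon>: "0 < \<epsilon>" "\<epsilon> < 1/2" "(\<epsilon> * (1 + a) + 2 * sqrt \<epsilon>) / (T * \<tau> / 2) < \<eta>"
    unfolding greaterThanLessThan_iff by blast
  let ?f = "\<lambda>v. barrier a (v + \<epsilon>)" and ?f1 = "\<lambda>v. barrier1 a (v + \<epsilon>)" and ?f2 = "\<lambda>v. barrier2 a (v + \<epsilon>)"
  interpret T: reflected_test A Om R mu c M F z0 B Z L ?f ?f1 ?f2
      "ln (1 + 1 / \<epsilon>) + a + 1 / \<epsilon> + a / (2 * sqrt \<epsilon>)"
    using reflected_axioms barrier_test_function[OF \<epsilon>(1) aC] by (rule reflected_test.intro)
  have pos: "?f v \<ge> 0" if "v \<ge> 0" for v using barrier_bounds(3)[of "v + \<epsilon>" a] that \<epsilon> aC by simp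
  \<comment> \<open>What matters is growth slower than \<open>1 / \<epsilon>\<close>; comparing
    \<open>1 + 1 / \<epsilon>\<close> with the square of \<open>1 + 1 / sqrt \<epsilon>\<close>
    gives \<open>2 / sqrt \<epsilon>\<close>.\<close>
  define b where "b = 2 / sqrt \<epsilon> + a"
  have f0: "?f 0 \<le> b"
  proof -
    have "1 + 1 / \<epsilon> \<le> (1 + 1 / sqrt \<epsilon>)\<^sup>2" using \<epsilon> by (simp add: power2_sum power_divide)
    moreover have "1 + 1 / \<epsilon> > 0" "1 + 1 / sqrt \<epsilon> > 0" using \<epsilon> by (auto intro: add_pos_pos)
    ultimately have "ln (1 + 1 / \<epsilon>) \<le> ln ((1 + 1 / sqrt \<epsilon>)\<^sup>2)" by (subst ln_le_cancel_iff) auto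
    also have "\<dots> = 2 * ln (1 + 1 / sqrt \<epsilon>)" using \<epsilon> by (subst ln_realpow) (auto intro: add_pos_pos)
    also have "\<dots> \<le> 2 * (1 / sqrt \<epsilon>)" using \<epsilon> by (intro mult_left_mono ln_add_one_self_le_self) auto
    finally show ?thesis using barrier_bounds(2)[of \<epsilon> a] \<epsilon> aC by (simp add: b_def)
  qed
  have b0: "b \<ge> 0" using \<epsilon> aC by (simp add: b_def)
  define S :: "(real^'n) set" where "S = {0}"
  have S: "S \<in> sets borel" by (simp add: S_def)
  have E0: "space M \<in> sets (F 0)" using sets.top[of "F 0"] by (simp add: space_F)
  define p where "p = \<tau> * (1 / \<epsilon> - 1)"
  \<comment> \<open>\<open>\<epsilon> < 1/2\<close> gives
    \<open>1 / \<epsilon> - 1 \<ge> 1 / (2 * \<epsilon>)\<close>.\<close>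
  have p: "p \<ge> \<tau> / (2 * \<epsilon>)" "p > 0" using \<epsilon> \<tau> by (auto simp: p_def field_simps)
  have gen0: "gen ?f1 ?f2 0 \<le> - p"
  proof -
    have "gen ?f1 ?f2 0 = barrier1 a \<epsilon> * \<tau>" by (simp add: gen_def \<tau>_def)
    also have "\<dots> \<le> (1 - 1 / \<epsilon>) * \<tau>" using barrier1_at[OF \<epsilon>(1) aC] \<tau> by (intro mult_right_mono) auto
    finally show ?thesis by (simp add: p_def algebra_simps)
  qed
  let ?H = "\<lambda>n. stopped 0 T n N (space M) S n"
  have Hm: "?H n \<in> events" for n using stopped_events[OF _ _ E0 S] T by auto
  show "\<exists>H. (\<forall>n. H n \<in> events) \<and> (\<forall>\<^sub>F n in sequentially. prob (H n) \<le> \<eta>) \<and>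
     (\<forall>\<omega>\<in>space M. ((\<forall>u\<in>\<rat> \<inter> {0..T}. Z u \<omega> = 0) \<and> ell T \<omega> \<le> N) \<longrightarrow> (\<forall>\<^sub>F n in sequentially. \<omega> \<in> H n))"
  proof (intro exI[of _ ?H] conjI allI ballI impI)
    show "?H n \<in> events" for n by (rule Hm)
    show "\<forall>\<^sub>F n in sequentially. prob (?H n) \<le> \<eta>"
      using T.dynkin_stopped[OF order.refl T N zero_less_one E0 S] eventually_gt_at_top[of 0]
    proof eventually_elim
      case (elim n)
      let ?S1 = "\<lambda>\<omega>. \<Sum>i<n. indicator (stopped 0 T n N (space M) S i) \<omega> * (?f (V (Z (grid 0 T n (Suc i)) \<omega>)) - ?f (V (Z (grid 0 T n i) \<omega>)))"
      let ?S2 = "\<lambda>\<omega>. \<Sum>i<n. indicator (stopped 0 T n N (space M) S i) \<omega> * (T / n * gen ?f1 ?f2 (Z (grid 0 T n i) \<omega>))"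
      have D: "integrable M ?S1" "integrable M ?S2" "\<bar>expectation ?S1 - expectation ?S2\<bar> \<le> 1"
        using elim(1)[rule_format, OF order.refl] unfolding T.gain_def T.compensator_def by blast+
      have "expectation ?S2 \<le> expectation (\<lambda>\<omega>. - (T * p) * indicator (?H n) \<omega>)"
      proof (rule integral_mono[OF D(2)])
        show "integrable M (\<lambda>\<omega>. - (T * p) * indicator (?H n) \<omega>)" using Hm[of n]
          by (intro integrable_mult_right integrable_real_indicator) (auto simp: emeasure_eq_measure)
        fix \<omega> assume \<omega>: "\<omega> \<in> space M"
        have "?S2 \<omega> \<le> (\<Sum>i<n. T / n * (- p) * indicator (?H n) \<omega>)"
        proof (rule sum_mono)
          fix i assume "i \<in> {..<n}"
          then have sub: "?H n \<subseteq> stopped 0 T n N (space M) S i" by (auto simp: stopped_def)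
          show "indicator (stopped 0 T n N (space M) S i) \<omega> * (T / n * gen ?f1 ?f2 (Z (grid 0 T n i) \<omega>)) \<le> T / n * (- p) * indicator (?H n) \<omega>"
          proof (cases "\<omega> \<in> stopped 0 T n N (space M) S i")
            case True
            then have "Z (grid 0 T n i) \<omega> = 0" by (auto simp: stopped_def S_def)
            then have "T / n * gen ?f1 ?f2 (Z (grid 0 T n i) \<omega>) \<le> T / n * (- p)"
              using gen0 T by (simp only:) (intro mult_left_mono, auto)
            moreover have "T / n * (- p) \<le> 0" using T p by (simp add: mult_nonneg_nonneg)
            ultimately show ?thesis using True by (auto simp: indicator_def)
          next
            case False
            then have "\<omega> \<notin> ?H n" using sub by blast
            then show ?thesis using False by simp
          qed
        qed
        then show "?S2 \<omega> \<le> - (T * p) * indicator (?H n) \<omega>" using elim(2) by simp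
      qed
      also have "\<dots> = - (T * p) * prob (?H n)" using Hm[of n] by simp
      finally have up: "expectation ?S1 \<le> 1 - T * p * prob (?H n)" using D(3) by simp
      have "- b = expectation (\<lambda>\<omega>. - b)" by (simp add: prob_space)
      also have "\<dots> \<le> expectation ?S1"
      proof (rule integral_mono[OF _ D(1)])
        fix \<omega> assume \<omega>: "\<omega> \<in> space M"
        show "- b \<le> ?S1 \<omega>"
        proof (cases "Z 0 \<omega> = 0")
          case False
          then have "\<And>i. \<omega> \<notin> stopped 0 T n N (space M) S i" by (force simp: stopped_def S_def)
          then show ?thesis using b0 by simp
        next
          case True
          from stopped_path[OF \<omega>, of n 0 T n N S ?f] obtain k where k: "k \<le> n"
            "?S1 \<omega> = ?f (V (Z (grid 0 T n k) \<omega>)) - ?f (V (Z 0 \<omega>))" by blast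
          have "?f (V (Z (grid 0 T n k) \<omega>)) \<ge> 0" by (rule pos) simp
          then show ?thesis using k(2) f0 True by simp
        qed
      qed auto
      finally have 1: "T * p * prob (?H n) \<le> 1 + b" using up by simp
      have "T * (\<tau> / (2 * \<epsilon>)) * prob (?H n) \<le> T * p * prob (?H n)"
        using p T by (intro mult_right_mono mult_left_mono) auto
      with 1 have "T * \<tau> / 2 * prob (?H n) / \<epsilon> \<le> 1 + b" by simp
      then have "T * \<tau> / 2 * prob (?H n) \<le> \<epsilon> * (1 + b)" using \<epsilon> by (simp add: divide_le_eq mult_ac)
      also have "\<dots> = \<epsilon> * (1 + a) + 2 * sqrt \<epsilon>"
      proof -
        have "\<epsilon> / sqrt \<epsilon> = sqrt \<epsilon>" using \<epsilon> by (simp add: real_div_sqrt)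
        moreover have "\<epsilon> * (1 + b) = \<epsilon> * (1 + a) + 2 * (\<epsilon> / sqrt \<epsilon>)"
          by (simp add: b_def distrib_left)
        ultimately show ?thesis by simp
      qed
      finally have "prob (?H n) \<le> (\<epsilon> * (1 + a) + 2 * sqrt \<epsilon>) / (T * \<tau> / 2)"
        using T \<tau> by (simp add: pos_le_divide_eq mult.commute)
      then show ?case using \<epsilon>(3) by linarith
    qed
    fix \<omega> assume \<omega>: "\<omega> \<in> space M" and bad: "(\<forall>u\<in>\<rat> \<inter> {0..T}. Z u \<omega> = 0) \<and> ell T \<omega> \<le> N"
    show "\<forall>\<^sub>F n in sequentially. \<omega> \<in> ?H n"
      using eventually_gt_at_top[of 0]
    proof eventually_elim
      case (elim n)
      have "Z (grid 0 T n j) \<omega> = 0 \<and> ell (grid 0 T n j) \<omega> \<le> N" if "j \<le> n" for j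
      proof -
        have g: "grid 0 T n j \<in> {0..0+T}" using T elim that by (intro grid_mem) auto
        moreover have "grid 0 T n j \<in> \<rat>" using TQ by (intro grid_rational) auto
        moreover have "ell (grid 0 T n j) \<omega> \<le> ell T \<omega>" using g by (intro ell_mono \<omega>) auto
        ultimately show ?thesis using bad by auto
      qed
      then show ?case using \<omega> N by (auto simp: stopped_def S_def)
    qed
  qed
qed

text \<open>If \<open>Z t = 0\<close> with \<open>t > 0\<close>, then \<open>Z s = 0\<close> at
  every rational \<open>s \<le> t\<close>, for otherwise the path would hit 0 after being away from
  it. Vanishing at all rational times up to some \<open>T < t\<close>, time 0 included, is what the
  sojourn estimate excludes.\<close>

theorem avoids_origin: "AE \<omega> in M. \<forall>t>0. Z t \<omega> \<noteq> 0"
proof -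
  define P where "P = (\<rat> \<inter> {0::real<..})"
  define P0 where "P0 = (\<rat> \<inter> {0::real..})"
  have cP: "countable P" "countable P0" unfolding P_def P0_def using countable_rat by (auto intro: countable_Int1)
  have 1: "AE \<omega> in M. \<forall>s\<in>P0. \<forall>T\<in>P. \<forall>\<delta>\<in>P. \<forall>N\<in>P. \<not> (V (Z s \<omega>) \<ge> \<delta> \<and> (\<exists>u\<in>{s..s+T}. Z u \<omega> = 0) \<and>
    (\<forall>u\<in>{s..s+T}. norm (Z u \<omega>) \<le> N \<and> ell u \<omega> \<le> N))"
    unfolding AE_ball_countable[OF cP(1)] AE_ball_countable[OF cP(2)]
    by (intro ballI no_hit_after_leaving) (auto simp: P_def P0_def)
  have 2: "AE \<omega> in M. \<forall>T\<in>P. \<forall>N\<in>P. \<not> ((\<forall>u\<in>\<rat> \<inter> {0..T}. Z u \<omega> = 0) \<and> ell T \<omega> \<le> N)"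
    unfolding AE_ball_countable[OF cP(1)]
    by (intro ballI no_sojourn) (auto simp: P_def)
  have 3: "AE \<omega> in M. \<omega> \<in> space M" by simp
  show ?thesis using 1 2 3
  proof eventually_elim
    case (elim \<omega>)
    note \<omega> = elim(3)
    have ratP: "\<exists>q\<in>P. x < q" if "0 \<le> x" for x
      using Rats_dense_in_real[of x "x + 1"] that unfolding P_def by force
    show ?case
    proof (intro allI impI notI)
      fix t :: real assume t: "t > 0" and Zt: "Z t \<omega> = 0"
      have zero: "Z s \<omega> = 0" if s: "s \<in> P0" "s \<le> t" for s
      proof (rule ccontr)
        assume "Z s \<omega> \<noteq> 0"
        then have "V (Z s \<omega>) > 0" using V_nonneg[of "Z s \<omega>"] V_eq_0_iff[of "Z s \<omega>"] by linarith
        then obtain \<delta> where \<delta>: "\<delta> \<in> \<rat>" "0 < \<delta>" "\<delta> < V (Z s \<omega>)" using Rats_dense_in_real by blast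
        obtain T where T: "T \<in> P" "t < T" using ratP[of t] t by auto
        have "s \<ge> 0" using s by (simp add: P0_def)
        have cont: "continuous_on {s..s+T} (\<lambda>u. norm (Z u \<omega>) + ell u \<omega>)"
          by (intro continuous_intros continuous_on_subset[OF Z_path[OF \<omega>]] continuous_on_subset[OF ell_path[OF \<omega>]])
             (use \<open>s \<ge> 0\<close> in auto)
        have "compact ((\<lambda>u. norm (Z u \<omega>) + ell u \<omega>) ` {s..s+T})"
          by (intro compact_continuous_image cont) auto
        then have "bdd_above ((\<lambda>u. norm (Z u \<omega>) + ell u \<omega>) ` {s..s+T})"
          by (intro bounded_imp_bdd_above compact_imp_bounded)
        then obtain N0 where N0: "\<And>u. u \<in> {s..s+T} \<Longrightarrow> norm (Z u \<omega>) + ell u \<omega> \<le> N0"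
          unfolding bdd_above_def by blast
        obtain N where N: "N \<in> P" "max 0 N0 < N" using ratP[of "max 0 N0"] by auto
        have "norm (Z u \<omega>) \<le> N \<and> ell u \<omega> \<le> N" if u: "u \<in> {s..s+T}" for u
        proof -
          have "0 \<le> ell u \<omega>" using u \<open>s \<ge> 0\<close> by (intro ell_nonneg[OF \<omega>]) auto
          moreover have "N0 < N" using N(2) by simp
          ultimately show ?thesis using N0[OF u] norm_ge_zero[of "Z u \<omega>"] by linarith
        qed
        moreover have "t \<in> {s..s+T}" using s T \<open>s \<ge> 0\<close> by auto
        moreover have "\<delta> \<in> P" using \<delta> by (simp add: P_def)
        moreover have "\<delta> \<le> V (Z s \<omega>)" using \<delta> by simp
        ultimately show False using elim(1) s(1) T(1) N(1) Zt by blast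
      qed
      obtain T where T: "T \<in> \<rat>" "0 < T" "T < t" using Rats_dense_in_real[OF t] by blast
      obtain N where N: "N \<in> P" "ell T \<omega> < N" using ratP[of "ell T \<omega>"] ell_nonneg[OF \<omega>, of T] T by auto
      have "\<forall>u\<in>\<rat> \<inter> {0..T}. Z u \<omega> = 0" using zero T by (auto simp: P0_def)
      moreover have "T \<in> P" using T by (simp add: P_def)
      ultimately show False using elim(2) N less_imp_le[OF N(2)] by blast
    qed
  qed
qed

end

section \<open>The origin is hit\<close>

definition decay :: "real \<Rightarrow> real \<Rightarrow> real \<Rightarrow> real" where
  "decay l p w = exp (- l * (w powr p + sqrt w))"
text \<open>\<open>slope\<close> and \<open>slope'\<close> are the first two derivatives of
  \<open>w powr p + sqrt w\<close>; factoring the derivatives of \<open>decay\<close> through them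
  isolates the dependence on \<open>l\<close>.\<close>

definition slope :: "real \<Rightarrow> real \<Rightarrow> real" where
  "slope p w = p * w powr (p - 1) + 1 / (2 * sqrt w)"
definition slope' :: "real \<Rightarrow> real \<Rightarrow> real" where
  "slope' p w = p * ((p - 1) * w powr (p - 2)) - 1 / (4 * w * sqrt w)"
definition decay1 :: "real \<Rightarrow> real \<Rightarrow> real \<Rightarrow> real" where
  "decay1 l p w = - l * slope p w * decay l p w"
definition decay2 :: "real \<Rightarrow> real \<Rightarrow> real \<Rightarrow> real" where
  "decay2 l p w = (l\<^sup>2 * (slope p w)\<^sup>2 - l * slope' p w) * decay l p w"

lemma slope_deriv:
  assumes "w > 0"
  shows "((\<lambda>w. w powr p + sqrt w) has_real_derivative slope p w) (at w)"
    "(slope p has_real_derivative slope' p w) (at w)"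
proof -
  have "((\<lambda>w. w powr p + sqrt w) has_real_derivative p * w powr (p - 1) + inverse (sqrt w) / 2) (at w)"
    by (intro DERIV_add has_real_derivative_powr DERIV_real_sqrt assms)
  then show "((\<lambda>w. w powr p + sqrt w) has_real_derivative slope p w) (at w)"
    by (simp add: slope_def field_simps)
  have w: "w = sqrt w * sqrt w" "sqrt w > 0" using assms by auto
  have 1: "((\<lambda>w. p * w powr (p - 1)) has_real_derivative p * ((p - 1) * w powr (p - 1 - 1))) (at w)"
    by (intro DERIV_cmult has_real_derivative_powr assms)
  have 2: "((\<lambda>w. 1 / (2 * sqrt w)) has_real_derivative - 1 / (4 * w * sqrt w)) (at w)"
    apply (rule derivative_eq_intros refl | use assms in simp; fail)+
    subgoal
    proof -
      have "(0 * (2 * r) - 1 * (0 * r + inverse r / 2 * 1 * 2)) / (2 * r * (2 * r)) = - 1 / (4 * (r * r) * r)"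
        if "r > 0" for r :: real using that by (simp add: field_simps)
      from this[OF w(2), folded w(1)] show ?thesis by simp
    qed
    done
  show "(slope p has_real_derivative slope' p w) (at w)"
    using DERIV_add[OF 1 2] unfolding slope_def[abs_def] slope'_def by simp
qed

lemma decay_deriv:
  assumes "w > 0"
  shows "(decay l p has_real_derivative decay1 l p w) (at w)"
    "(decay1 l p has_real_derivative decay2 l p w) (at w)"
proof -
  have "((\<lambda>w. exp (- l * (w powr p + sqrt w))) has_real_derivative
      exp (- l * (w powr p + sqrt w)) * (- l * slope p w)) (at w)"
    by (intro DERIV_fun_exp DERIV_cmult slope_deriv assms)
  then show 1: "(decay l p has_real_derivative decay1 l p w) (at w)"
    unfolding decay_def[abs_def] decay1_def by (simp add: mult_ac)
  have "((\<lambda>w. (- l * slope p w) * decay l p w) has_real_derivative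
      (- l * slope' p w) * decay l p w + decay1 l p w * (- l * slope p w)) (at w)"
    by (intro DERIV_mult DERIV_cmult slope_deriv 1 assms)
  moreover have "(- l * slope' p w) * decay l p w + decay1 l p w * (- l * slope p w) = decay2 l p w"
    by (simp add: decay1_def decay2_def algebra_simps power2_eq_square)
  ultimately show "(decay1 l p has_real_derivative decay2 l p w) (at w)"
    unfolding decay1_def[abs_def] by simp
qed

lemma decay_test_function:
  assumes \<epsilon>: "\<epsilon> > 0" and l: "l > 0" and p: "0 < p" "p < 1"
  shows "test_function (\<lambda>v. decay l p (v + \<epsilon>)) (\<lambda>v. decay1 l p (v + \<epsilon>)) (\<lambda>v. decay2 l p (v + \<epsilon>))
    (1 + l * slope p \<epsilon>)"
proof
  fix v :: real assume v: "v \<ge> 0"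
  then have w: "v + \<epsilon> > 0" using assms by simp
  show "((\<lambda>v. decay l p (v + \<epsilon>)) has_real_derivative decay1 l p (v + \<epsilon>)) (at v)"
    using decay_deriv(1)[OF w, of l p] by (simp add: DERIV_shift)
  show "((\<lambda>v. decay1 l p (v + \<epsilon>)) has_real_derivative decay2 l p (v + \<epsilon>)) (at v)"
    using decay_deriv(2)[OF w, of l p] by (simp add: DERIV_shift)
  have d: "0 < decay l p (v + \<epsilon>)" "decay l p (v + \<epsilon>) \<le> 1" using l w by (auto simp: decay_def)
  have s: "0 \<le> slope p \<epsilon>" "0 \<le> slope p (v + \<epsilon>)" using p \<epsilon> w by (auto simp: slope_def)
  have "slope p (v + \<epsilon>) \<le> slope p \<epsilon>"
    unfolding slope_def using v \<epsilon> p by (intro add_mono mult_left_mono powr_mono2' frac_le) auto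
  then have "l * slope p (v + \<epsilon>) * decay l p (v + \<epsilon>) \<le> l * slope p \<epsilon> * 1"
    using l s d by (intro mult_mono) auto
  moreover have "0 \<le> l * slope p (v + \<epsilon>) * decay l p (v + \<epsilon>)" using l s d by simp
  ultimately show "\<bar>decay1 l p (v + \<epsilon>)\<bar> \<le> 1 + l * slope p \<epsilon>" by (simp add: decay1_def)
  have "0 \<le> l * slope p \<epsilon>" using l s by simp
  then show "\<bar>decay l p (v + \<epsilon>)\<bar> \<le> 1 + l * slope p \<epsilon>" using d by simp
next
  show "continuous_on {0..} (\<lambda>v. decay2 l p (v + \<epsilon>))"
    unfolding decay2_def decay_def slope_def slope'_def using \<epsilon>
    by (intro continuous_intros) (auto simp: add_nonneg_eq_0_iff)
qed

text \<open>Here \<open>y = p * w powr (p - 1/2)\<close> dominates near the origin, where the exponent \<open>p\<close> makes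
  \<open>2 * c * (1 - p) - \<tau>\<close> positive; away from the origin the quadratic term with a large factor \<open>l\<close>
  takes over.\<close>
lemma decay_generator_ge:
  fixes \<tau> k c :: real
  assumes c: "c > 0" and \<tau>: "0 \<le> \<tau>" "\<tau> < 2 * c" and k: "k \<ge> 0"
  obtains l p where "l > 0" "0 < p" "p < 1"
    "\<And>w D q. w > 0 \<Longrightarrow> D \<le> \<tau> + 2 * k * sqrt w \<Longrightarrow> c * w \<le> q \<Longrightarrow>
      l * decay l p w \<le> decay1 l p w * D + 2 * decay2 l p w * q"
proof -
  \<comment> \<open>The quarter keeps \<open>p - 1/2\<close> negative, so that \<open>y\<close>
    below decreases in \<open>w\<close>; the other bound leaves at least half of
    \<open>2 * c - \<tau>\<close> in \<open>\<delta>\<close>.\<close>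
  define p where "p = min (1/4) ((2 * c - \<tau>) / (4 * c))"
  have p: "0 < p" "p \<le> 1/4" using c \<tau> by (auto simp: p_def)
  have "p \<le> (2 * c - \<tau>) / (4 * c)" by (simp add: p_def)
  then have "2 * c * p \<le> (2 * c - \<tau>) / 2" using c by (simp add: field_simps)
  moreover define \<delta> where "\<delta> = 2 * c * (1 - p) - \<tau>"
  ultimately have \<delta>: "\<delta> > 0" using \<tau> by (simp add: right_diff_distrib)
  \<comment> \<open>\<open>Y\<close> is the level of \<open>y\<close> from which on
    \<open>\<delta> * y\<close> outweighs \<open>\<tau> / 2\<close>, and \<open>w0\<close> is the
    point at which \<open>y\<close> equals it. If \<open>\<tau> = 0\<close> the level is 0 and the
    value 1 of \<open>w0\<close> is a dummy.\<close>
  define Y where "Y = \<tau> / (2 * \<delta>)"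
  have Y: "Y \<ge> 0" using \<tau> \<delta> by (simp add: Y_def)
  define w0 where "w0 = (if Y = 0 then 1 else (Y / p) powr (1 / (p - 1/2)))"
  have w0: "w0 > 0" using Y p by (simp add: w0_def)
  define s0 where "s0 = 1 / sqrt w0"
  have s0: "s0 > 0" using w0 by (simp add: s0_def)
  \<comment> \<open>Large enough for \<open>l * c\<close> to beat the drift constant
    \<open>2 * k\<close> and the deficit governed by \<open>s0 * \<tau>\<close> for
    \<open>w > w0\<close>, with a margin yielding the final \<open>1\<close>.\<close>
  define l where "l = (2 * k + s0 * \<tau> + 2) / c"
  have l: "l > 0" using k s0 \<tau> c by (auto simp: l_def intro!: divide_pos_pos add_nonneg_pos)
  have lc: "l * c = 2 * k + s0 * \<tau> + 2" using c by (simp add: l_def)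
  show ?thesis
  proof (rule that[of l p])
    fix w D q :: real assume w: "w > 0" and D: "D \<le> \<tau> + 2 * k * sqrt w" and q: "c * w \<le> q"
    define r where "r = sqrt w"
    have r: "w = r * r" "r > 0" using w by (auto simp: r_def)
    \<comment> \<open>\<open>y + 1/2\<close> is \<open>sqrt w\<close> times
      \<open>slope p w\<close>; the \<open>1/2\<close>, due to \<open>sqrt w\<close> in the
      exponent, keeps the quadratic term bounded below far from the origin.\<close>
    define y where "y = p * w powr (p - 1/2)"
    have y: "y > 0" using p w by (simp add: y_def)
    have rp: "w powr (1/2) = r" using w by (simp add: r_def powr_half_sqrt)
    have "w powr (p - 1) = w powr (p - 1/2) / r"
      using powr_diff[of w "p - 1/2" "1/2"] by (simp add: rp)
    then have s1: "slope p w = (y + 1/2) / r" using r(2) by (simp add: slope_def y_def r_def[symmetric] field_simps)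
    have e2: "w powr (p - 2) = w powr (p - 1/2) / (w * r)"
    proof -
      have "w powr (p - 2) = w powr (p - 1/2) / w powr (1 + 1/2)" using powr_diff[of w "p - 1/2" "1 + 1/2"] by simp
      also have "w powr (1 + 1/2) = w * r" using w unfolding powr_add rp by simp
      finally show ?thesis .
    qed
    have s2: "slope' p w = - ((1 - p) * y + 1/4) / (w * r)"
    proof -
      have "p * ((p - 1) * (P / (w * r))) - 1 / (4 * w * r) = - ((1 - p) * (p * P) + 1/4) / (w * r)" for P
        using r(2) w by (simp add: field_simps)
      then show ?thesis unfolding slope'_def y_def r_def[symmetric] e2 by blast
    qed
    define X where "X = l * (slope p w)\<^sup>2 - slope' p w"
    have "0 \<le> (1 - p) * y" using p y by simp
    then have "slope' p w \<le> 0" unfolding s2 using r w by (intro divide_nonpos_pos) auto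
    then have X0: "X \<ge> 0" using l by (auto simp: X_def intro: order_trans[of _ 0])
    have Xw: "w * X = l * (y + 1/2)\<^sup>2 + ((1 - p) * y + 1/4) / r"
      unfolding X_def s1 s2 using r by (simp add: field_simps power2_eq_square)
    have sl: "slope p w \<ge> 0" unfolding s1 using y r(2) by simp
    have "(\<delta> * y - \<tau> / 2) / r \<ge> - (s0 * \<tau> / 2)"
    proof (cases "y \<ge> Y")
      case True
      then have "\<delta> * y \<ge> \<delta> * Y" using \<delta> by simp
      then have "(\<delta> * y - \<tau> / 2) / r \<ge> 0" using \<delta> r by (simp add: Y_def)
      moreover have "s0 * \<tau> / 2 \<ge> 0" using s0 \<tau> by simp
      ultimately show ?thesis by linarith
    next
      case False
      then have Yp: "Y > 0" using y by simp
      have "w > w0"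
      proof (rule ccontr)
        assume "\<not> w > w0"
        then have "w0 powr (p - 1/2) \<le> w powr (p - 1/2)" using w p by (intro powr_mono2') auto
        moreover have "w0 powr (p - 1/2) = Y / p" using Yp p by (simp add: w0_def powr_powr)
        ultimately have "Y / p \<le> w powr (p - 1/2)" by simp
        then have "Y \<le> y" using p(1) unfolding y_def by (subst (asm) pos_divide_le_eq) (simp_all add: mult.commute)
        then show False using False by simp
      qed
      then have "1 / r \<le> s0" unfolding s0_def r_def using w0 by (intro frac_le) auto
      then have "\<tau> / 2 * (1 / r) \<le> \<tau> / 2 * s0" using \<tau> by (intro mult_left_mono) auto
      moreover have "\<delta> * y / r \<ge> 0" using \<delta> y r by simp
      ultimately show ?thesis by (simp add: diff_divide_distrib mult.commute)
    qed
    moreover have "2 * c * (l * (y + 1/2)\<^sup>2) - 2 * k * (y + 1/2) \<ge> (s0 * \<tau>) / 2 + 1"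
    proof -
      have "2 * c * (l * (y + 1/2)\<^sup>2) = (l * c) * (2 * (y + 1/2)) * (y + 1/2)" by (simp add: power2_eq_square)
      also have "\<dots> \<ge> (l * c) * 1 * (y + 1/2)" using l c y by (intro mult_right_mono mult_left_mono) auto
      finally have "2 * c * (l * (y + 1/2)\<^sup>2) - 2 * k * (y + 1/2) \<ge> (s0 * \<tau> + 2) * (y + 1/2)"
        unfolding lc by (simp add: algebra_simps)
      moreover have "(s0 * \<tau> + 2) * (y + 1/2) \<ge> (s0 * \<tau> + 2) * (1/2)" using s0 \<tau> y by (intro mult_left_mono) auto
      ultimately show ?thesis by (simp add: algebra_simps)
    qed
    ultimately have main: "1 \<le> (\<delta> * y - \<tau> / 2) / r + (2 * c * (l * (y + 1/2)\<^sup>2) - 2 * k * (y + 1/2))" by linarith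
    \<comment> \<open>The two sides differ by \<open>c / (2 * r)\<close>, the favourable
      second-order contribution of \<open>sqrt w\<close>, which is dropped.\<close>
    also have "\<dots> \<le> - slope p w * (\<tau> + 2 * k * r) + 2 * (c * (w * X))"
    proof -
      have "- slope p w * (\<tau> + 2 * k * r) + 2 * (c * (w * X)) - ((\<delta> * y - \<tau> / 2) / r + (2 * c * (l * (y + 1/2)\<^sup>2) - 2 * k * (y + 1/2)))
        = c / (2 * r)"
        unfolding Xw s1 \<delta>_def using r(2) by (simp add: field_simps power2_eq_square)
      moreover have "c / (2 * r) \<ge> 0" using c r by simp
      ultimately show ?thesis by linarith
    qed
    also have "\<dots> \<le> - slope p w * D + 2 * (X * q)"
    proof -
      have "slope p w * D \<le> slope p w * (\<tau> + 2 * k * r)" using D sl by (intro mult_left_mono) (auto simp: r_def)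
      moreover have "X * (c * w) \<le> X * q" using q X0 by (rule mult_left_mono)
      ultimately show ?thesis by (simp add: mult_ac)
    qed
    finally have "l * decay l p w * 1 \<le> l * decay l p w * (- slope p w * D + 2 * (X * q))"
      using l by (intro mult_left_mono) (auto simp: decay_def)
    also have "\<dots> = decay1 l p w * D + 2 * decay2 l p w * q"
      by (simp add: decay1_def decay2_def X_def algebra_simps power2_eq_square)
    finally show "l * decay l p w \<le> decay1 l p w * D + 2 * decay2 l p w * q" by simp
  qed (use l p in auto)
qed

locale subcritical = reflected A Om R mu c M F z0 B Z L
  for A Om R :: "real^'n^'n" and mu c and M :: "'a measure" and F z0 B Z L +
  fixes q0 :: real
  assumes trace_nonneg: "0 \<le> trace (Om ** A)" and trace_less: "trace (Om ** A) < 2 * q0"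
    and subcrit: "\<And>z. z \<in> orthant \<Longrightarrow> q0 * V z \<le> Q z"
begin

text \<open>\<open>Q\<close> is bounded below by a multiple of \<open>V\<close>, not of
  \<open>V + \<epsilon>\<close>. The strict gap between the trace and \<open>2 * q0\<close> pays for
  the shift once \<open>V \<ge> \<kappa> * \<epsilon>\<close>, hence the restriction to points away
  from the origin.\<close>

lemma decay_generator:
  obtains l p \<kappa> where "l > 0" "0 < p" "p < 1" "\<kappa> \<ge> 1"
    "\<And>\<epsilon> z. \<epsilon> > 0 \<Longrightarrow> z \<in> orthant \<Longrightarrow> V z \<ge> \<kappa> * \<epsilon> \<Longrightarrow>
      l * decay l p (V z + \<epsilon>) \<le> gen (\<lambda>v. decay1 l p (v + \<epsilon>)) (\<lambda>v. decay2 l p (v + \<epsilon>)) z"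
proof -
  obtain k where k: "k \<ge> 0" "\<And>z. \<bar>(Om *v z) \<bullet> mu\<bar> \<le> k * sqrt (V z)" by (rule drift_bound) blast
  define \<tau> where "\<tau> = trace (Om ** A)"
  have \<tau>: "0 \<le> \<tau>" "\<tau> < 2 * q0" using trace_nonneg trace_less by (auto simp: \<tau>_def)
  \<comment> \<open>The midpoint between \<open>\<tau> / 2\<close> and \<open>q0\<close>: half of
    the gap is kept for the generator estimate, half is spent on the shift.\<close>
  define d where "d = (\<tau> / 2 + q0) / 2"
  have d: "d > 0" "\<tau> < 2 * d" "d < q0" using \<tau> by (auto simp: d_def field_simps)
  define \<kappa> where "\<kappa> = max 1 (d / (q0 - d))"
  obtain l p where lp: "l > 0" "0 < p" "p < 1"
    "\<And>w D q. w > 0 \<Longrightarrow> D \<le> \<tau> + 2 * k * sqrt w \<Longrightarrow> d * w \<le> q \<Longrightarrow>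
      l * decay l p w \<le> decay1 l p w * D + 2 * decay2 l p w * q"
    by (rule decay_generator_ge[OF d(1) \<tau>(1) d(2) k(1)]) blast
  show ?thesis
  proof (rule that[OF lp(1-3)])
    show "\<kappa> \<ge> 1" by (simp add: \<kappa>_def)
    fix \<epsilon> :: real and z :: "real^'n" assume \<epsilon>: "\<epsilon> > 0" and z: "z \<in> orthant" and Vz: "V z \<ge> \<kappa> * \<epsilon>"
    have w: "V z + \<epsilon> > 0" using \<epsilon> V_nonneg[of z] by linarith
    have "k * sqrt (V z) \<le> k * sqrt (V z + \<epsilon>)" using k \<epsilon> by (intro mult_left_mono) auto
    then have D: "drift z \<le> \<tau> + 2 * k * sqrt (V z + \<epsilon>)"
      using k(2)[of z] unfolding drift_def \<tau>_def by linarith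
    have "d / (q0 - d) * \<epsilon> \<le> \<kappa> * \<epsilon>" using \<epsilon> by (intro mult_right_mono) (auto simp: \<kappa>_def)
    then have "d / (q0 - d) * \<epsilon> \<le> V z" using Vz by linarith
    then have "d * \<epsilon> \<le> (q0 - d) * V z" using d by (simp add: field_simps)
    then have "d * (V z + \<epsilon>) \<le> Q z" using subcrit[OF z] by (simp add: algebra_simps)
    from lp(4)[OF w D this] show "l * decay l p (V z + \<epsilon>) \<le> gen (\<lambda>v. decay1 l p (v + \<epsilon>)) (\<lambda>v. decay2 l p (v + \<epsilon>)) z"
      by (simp add: gen_def)
  qed
qed

text \<open>Time starts at 1 because the path may begin at 0. One index \<open>k\<close> governs
  closeness to the origin, size and pushing; rational times make the event measurable.\<close>

definition exits :: "real \<Rightarrow> nat \<Rightarrow> 'a set" where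
  "exits T k = {\<omega>\<in>space M. \<exists>u\<in>\<rat> \<inter> {1..1+T}. V (Z u \<omega>) < 1 / Suc k \<or> norm (Z u \<omega>) > Suc k \<or> ell u \<omega> > Suc k}"

lemma exits_events: "exits T k \<in> events"
proof -
  have "{\<omega>\<in>space M. V (Z u \<omega>) < 1 / Suc k \<or> norm (Z u \<omega>) > Suc k \<or> ell u \<omega> > Suc k} \<in> events"
    if "u \<in> \<rat> \<inter> {1..1+T}" for u
  proof -
    have u: "0 \<le> u" using that by simp
    have [measurable]: "Z u \<in> borel_measurable M" "ell u \<in> borel_measurable M"
      using Z_measurable[OF u] ell_measurable[OF u] by (auto intro: F_measurable_M)
    have [measurable]: "V \<in> borel_measurable borel" by (intro borel_measurable_continuous_onI V_cont)
    show ?thesis by measurable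
  qed
  moreover have cnt: "countable (\<rat> \<inter> {1..1+T})" using countable_rat by (rule countable_Int1)
  moreover have eq: "exits T k = (\<Union>u\<in>\<rat> \<inter> {1..1+T}. {\<omega>\<in>space M. V (Z u \<omega>) < 1 / Suc k \<or> norm (Z u \<omega>) > Suc k \<or> ell u \<omega> > Suc k})"
    by (auto simp: exits_def)
  ultimately show ?thesis unfolding eq by (intro sets.countable_UN'[OF cnt]) blast
qed

text \<open>A path avoiding 0 has, on the compact time interval, \<open>V\<close> bounded away from
  0 and bounded norm and pushing, so it drops out of the decreasing events.\<close>

lemma exits_tendsto_0:
  assumes avoid: "AE \<omega> in M. \<forall>t>0. Z t \<omega> \<noteq> 0" and T: "0 < T"
  shows "(\<lambda>k. prob (exits T k)) \<longlonglongrightarrow> 0"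
proof -
  have "decseq (exits T)"
  proof (rule decseq_SucI, rule subsetI)
    fix k \<omega> assume "\<omega> \<in> exits T (Suc k)"
    then obtain u where u: "\<omega> \<in> space M" "u \<in> \<rat> \<inter> {1..1+T}"
      "V (Z u \<omega>) < 1 / Suc (Suc k) \<or> norm (Z u \<omega>) > Suc (Suc k) \<or> ell u \<omega> > Suc (Suc k)"
      unfolding exits_def by blast
    have "1 / real (Suc (Suc k)) \<le> 1 / real (Suc k)" by (intro frac_le) auto
    with u(3) have "V (Z u \<omega>) < 1 / Suc k \<or> norm (Z u \<omega>) > Suc k \<or> ell u \<omega> > Suc k" by auto
    with u(1,2) show "\<omega> \<in> exits T k" unfolding exits_def by blast
  qed
  then have lim: "(\<lambda>k. prob (exits T k)) \<longlonglongrightarrow> prob (\<Inter>k. exits T k)"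
    by (intro finite_Lim_measure_decseq) (auto simp: exits_events)
  have "AE \<omega> in M. \<omega> \<notin> (\<Inter>k. exits T k)"
    using avoid AE_space
  proof eventually_elim
    case (elim \<omega>)
    note \<omega> = elim(2)
    have sub: "{1..1+T} \<subseteq> {0..}" by auto
    have ne: "{1..1+T} \<noteq> {}" using T by auto
    note cZ = continuous_on_subset[OF Z_path[OF \<omega>] sub] and cl = continuous_on_subset[OF ell_path[OF \<omega>] sub]
    have cV: "continuous_on {1..1+T} (\<lambda>t. V (Z t \<omega>))"
      by (rule continuous_on_compose2[OF V_cont cZ]) auto
    obtain v where v: "v \<in> {1..1+T}" "\<And>u. u \<in> {1..1+T} \<Longrightarrow> V (Z v \<omega>) \<le> V (Z u \<omega>)"
      using continuous_attains_inf[OF _ ne cV] by auto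
    have "Z v \<omega> \<noteq> 0" using elim(1) v by auto
    then have Vpos: "V (Z v \<omega>) > 0" using V_nonneg[of "Z v \<omega>"] V_eq_0_iff[of "Z v \<omega>"] by linarith
    have "continuous_on {1..1+T} (\<lambda>u. norm (Z u \<omega>) + ell u \<omega>)" by (intro continuous_intros cZ cl)
    from continuous_attains_sup[OF compact_Icc ne this]
    obtain x where x: "\<And>u. u \<in> {1..1+T} \<Longrightarrow> norm (Z u \<omega>) + ell u \<omega> \<le> norm (Z x \<omega>) + ell x \<omega>" by blast
    obtain k1 :: nat where k1: "1 / Suc k1 < V (Z v \<omega>)" using nat_approx_posE[OF Vpos] by metis
    obtain k2 :: nat where k2: "norm (Z x \<omega>) + ell x \<omega> < k2" using reals_Archimedean2 by blast
    define k where "k = max k1 k2"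
    have k: "1 / real (Suc k) \<le> 1 / Suc k1" "real k2 \<le> real (Suc k)" by (auto simp: k_def intro!: frac_le)
    have "\<omega> \<notin> exits T k"
    proof
      assume "\<omega> \<in> exits T k"
      then obtain u where u: "u \<in> {1..1+T}" "V (Z u \<omega>) < 1 / Suc k \<or> norm (Z u \<omega>) > Suc k \<or> ell u \<omega> > Suc k"
        by (auto simp: exits_def)
      have "0 \<le> ell u \<omega>" using u(1) by (intro ell_nonneg[OF \<omega>]) auto
      then show False using u(2) v(2)[OF u(1)] x[OF u(1)] k k1 k2 norm_ge_zero[of "Z u \<omega>"] by linarith
    qed
    then show ?case by auto
  qed
  then have "prob (\<Inter>k. exits T k) = 0"
    using exits_events by (subst prob_eq_0) auto
  with lim show ?thesis by simp
qed

text \<open>If 0 were avoided, then outside a small event the path would remain, over the whole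
  interval, where the generator is at least \<open>l\<close> times the function. The mean
  compensator would be at least \<open>l * T * b / 2 > 2\<close>, whereas a function with values in
  \<open>[0, 1]\<close> gains at most 1.\<close>

theorem hits_origin: "\<not> (AE \<omega> in M. \<forall>t>0. Z t \<omega> \<noteq> 0)"
proof
  assume avoid: "AE \<omega> in M. \<forall>t>0. Z t \<omega> \<noteq> 0"
  obtain l p \<kappa> where lp: "l > 0" "0 < p" "p < 1" "\<kappa> \<ge> 1"
    "\<And>\<epsilon> z. \<epsilon> > 0 \<Longrightarrow> z \<in> orthant \<Longrightarrow> V z \<ge> \<kappa> * \<epsilon> \<Longrightarrow>
      l * decay l p (V z + \<epsilon>) \<le> gen (\<lambda>v. decay1 l p (v + \<epsilon>)) (\<lambda>v. decay2 l p (v + \<epsilon>)) z"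
    by (rule decay_generator) blast
  have d01: "0 < decay l p w" "w \<ge> 0 \<Longrightarrow> decay l p w \<le> 1" for w using lp by (auto simp: decay_def)
  have dmono: "decay l p w' \<le> decay l p w" if "0 \<le> w" "w \<le> w'" for w w'
    using that lp by (auto simp: decay_def intro!: add_mono powr_mono2)
  have fVm: "(\<lambda>\<omega>. decay l p (V (Z t \<omega>) + e)) \<in> borel_measurable M" if "0 \<le> t" for t e
  proof -
    have [measurable]: "Z t \<in> borel_measurable M"
      using Z_measurable[OF that] by (rule F_measurable_M)
    have [measurable]: "V \<in> borel_measurable borel" by (intro borel_measurable_continuous_onI V_cont)
    show ?thesis unfolding decay_def by measurable
  qed
  have fVI: "integrable M (\<lambda>\<omega>. decay l p (V (Z t \<omega>) + e))" if "0 \<le> t" "0 \<le> e" for t e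
    using d01 fVm[OF that(1)] that by (intro integrable_const_bound[of _ 1]) (auto simp: less_imp_le abs_of_pos)
  \<comment> \<open>With the shift 1 in place of \<open>\<epsilon>\<close>, \<open>b\<close> bounds
    the initial mean from below for every \<open>\<epsilon> \<le> 1\<close>, so that
    \<open>T\<close> and \<open>k\<close> can be fixed before \<open>\<epsilon>\<close>.\<close>
  define b where "b = expectation (\<lambda>\<omega>. decay l p (V (Z 1 \<omega>) + 1))"
  have b0: "b > 0"
  proof -
    have "b \<noteq> 0"
    proof
      assume "b = 0"
      then have "AE \<omega> in M. decay l p (V (Z 1 \<omega>) + 1) = 0"
        unfolding b_def using fVI[of 1 1] d01(1)
        by (subst (asm) integral_nonneg_eq_0_iff_AE) (auto simp: less_imp_le)
      then have "AE \<omega> in M. False" by eventually_elim (use d01(1) in \<open>auto simp: less_le\<close>)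
      then show False by simp
    qed
    moreover have "b \<ge> 0" unfolding b_def using d01(1) by (intro Bochner_Integration.integral_nonneg) (auto simp: less_imp_le)
    ultimately show ?thesis by simp
  qed
  have b1: "b \<le> 1"
  proof -
    have "b \<le> expectation (\<lambda>\<omega>. 1)" unfolding b_def
      by (rule integral_mono) (use fVI[of 1 1] d01(2) in auto)
    then show ?thesis by (simp add: prob_space)
  qed
  \<comment> \<open>Makes \<open>l * T * b / 2\<close> exceed 2, which beats the later upper bound
    \<open>1 + b / 4\<close>.\<close>
  obtain T :: nat where T: "4 / (l * b) < real T" using reals_Archimedean2 by blast
  have T0: "real T > 0" using T lp b0 by (meson divide_pos_pos less_trans mult_pos_pos zero_less_numeral)
  have lTb: "l * (T * b) > 4" using T lp b0 by (simp add: field_simps)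
  have "\<forall>\<^sub>F k in sequentially. prob (exits T k) < b / 4"
    by (rule order_tendstoD(2)[OF exits_tendsto_0[OF avoid T0]]) (use b0 in simp)
  then obtain k where k: "prob (exits T k) < b / 4" using eventually_happens'[OF sequentially_bot] by blast
  define N where "N = real (Suc k)"
  define v0 where "v0 = 1 / real (Suc k)"
  \<comment> \<open>Matches the region \<open>S\<close> below to the condition
    \<open>V \<ge> \<kappa> * \<epsilon>\<close> of the generator bound.\<close>
  define \<epsilon> where "\<epsilon> = v0 / \<kappa>"
  have \<epsilon>: "\<epsilon> > 0" "\<kappa> * \<epsilon> = v0" "\<epsilon> \<le> 1"
  proof -
    have v0: "v0 > 0" "v0 \<le> 1" by (auto simp: v0_def)
    then show "\<epsilon> > 0" "\<kappa> * \<epsilon> = v0" using lp by (auto simp: \<epsilon>_def)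
    show "\<epsilon> \<le> 1" using v0 lp unfolding \<epsilon>_def by (subst divide_le_eq_1) auto
  qed
  let ?f = "\<lambda>v. decay l p (v + \<epsilon>)" and ?f1 = "\<lambda>v. decay1 l p (v + \<epsilon>)" and ?f2 = "\<lambda>v. decay2 l p (v + \<epsilon>)"
  interpret T: reflected_test A Om R mu c M F z0 B Z L ?f ?f1 ?f2 "1 + l * slope p \<epsilon>"
    using reflected_axioms decay_test_function[OF \<epsilon>(1) lp(1-3)] by (rule reflected_test.intro)
  define S :: "(real^'n) set" where "S = {z. v0 \<le> V z}"
  have "closed S" unfolding S_def by (intro closed_Collect_le continuous_intros)
  then have S: "S \<in> sets borel" by simp
  have E0: "space M \<in> sets (F 1)" using sets.top[of "F 1"] by (simp add: space_F)
  have g0: "0 \<le> grid 1 T n i" for n i using grid_ge[of T 1 n i] by simp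
  let ?E = "\<lambda>n. stopped 1 T n N (space M) S"
  have Em: "?E n i \<in> events" for n i using stopped_events[OF _ _ E0 S] by auto
  have ev: "\<forall>\<^sub>F n in sequentially. n > (0::nat)" by (rule eventually_gt_at_top)
  have "b / 4 > 0" using b0 by simp
  from eventually_happens'[OF sequentially_bot eventually_conj[OF ev T.dynkin_stopped[OF zero_le_one T0 _ this E0 S, of N]]]
  obtain n where n: "n > 0" and dyn: "\<And>m. m \<le> n \<Longrightarrow>
    integrable M (T.gain 1 T n (?E n) m) \<and> integrable M (T.compensator 1 T n (?E n) m) \<and>
    \<bar>expectation (T.gain 1 T n (?E n) m) - expectation (T.compensator 1 T n (?E n) m)\<bar> \<le> b / 4"
    by (auto simp: N_def)
  let ?g = "grid 1 T n"
  let ?fZ = "\<lambda>i \<omega>. ?f (V (Z (?g i) \<omega>))"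
  let ?S1 = "\<lambda>m \<omega>. \<Sum>i<m. indicator (?E n i) \<omega> * (?f (V (Z (?g (Suc i)) \<omega>)) - ?f (V (Z (?g i) \<omega>)))"
  let ?S2 = "\<lambda>m \<omega>. \<Sum>i<m. indicator (?E n i) \<omega> * (T / n * gen ?f1 ?f2 (Z (?g i) \<omega>))"
  have D: "integrable M (?S1 m)" "integrable M (?S2 m)" "\<bar>expectation (?S1 m) - expectation (?S2 m)\<bar> \<le> b / 4" if "m \<le> n" for m
    using dyn[OF that] unfolding T.gain_def T.compensator_def by blast+
  have fI: "integrable M (\<lambda>\<omega>. indicator (?E n i) \<omega> * ?fZ i \<omega>)" for i
    using fVm[OF g0, of n i \<epsilon>] Em d01 \<epsilon>
    by (intro integrable_const_bound[of _ 1]) (auto simp: indicator_def less_imp_le abs_of_pos intro!: AE_I2)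
  have gen_ge: "T / n * (l * (indicator (?E n i) \<omega> * ?fZ i \<omega>)) \<le> indicator (?E n i) \<omega> * (T / n * gen ?f1 ?f2 (Z (?g i) \<omega>))"
    if "\<omega> \<in> space M" for i \<omega>
  proof (cases "\<omega> \<in> ?E n i")
    case True
    then have "V (Z (?g i) \<omega>) \<ge> \<kappa> * \<epsilon>" by (auto simp: stopped_def S_def \<epsilon>(2))
    then have "l * ?fZ i \<omega> \<le> gen ?f1 ?f2 (Z (?g i) \<omega>)"
      by (intro lp(5)[OF \<epsilon>(1)] Z_orthant g0 that)
    then have "T / n * (l * ?fZ i \<omega>) \<le> T / n * gen ?f1 ?f2 (Z (?g i) \<omega>)"
      by (rule mult_left_mono) auto
    then show ?thesis using True by simp
  qed simp
  have S2_nonneg: "expectation (?S2 m) \<ge> 0" for m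
  proof (rule Bochner_Integration.integral_nonneg)
    fix \<omega> assume \<omega>: "\<omega> \<in> space M"
    show "?S2 m \<omega> \<ge> 0"
    proof (rule sum_nonneg)
      fix i
      have "0 \<le> T / n * (l * (indicator (?E n i) \<omega> * ?fZ i \<omega>))" using lp d01(1) by (simp add: less_imp_le)
      then show "0 \<le> indicator (?E n i) \<omega> * (T / n * gen ?f1 ?f2 (Z (?g i) \<omega>))"
        using gen_ge[OF \<omega>, of i] by linarith
    qed
  qed
  have start: "expectation (\<lambda>\<omega>. ?f (V (Z 1 \<omega>))) \<ge> b"
    unfolding b_def
    by (rule integral_mono) (use fVI[of 1] \<epsilon> dmono in auto)
  \<comment> \<open>Dynkin's formula at the truncated horizon \<open>m\<close>, with nonnegative
    mean compensator: of an initial mean at least \<open>b\<close>, at most a quarter of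
    \<open>b\<close> is lost to the approximation error and a quarter to paths in
    \<open>exits T k\<close>.\<close>
  have stay: "expectation (\<lambda>\<omega>. indicator (?E n m) \<omega> * ?fZ m \<omega>) \<ge> b / 2" if m: "m < n" for m
  proof -
    have XI: "integrable M (indicator (exits T k) :: 'a \<Rightarrow> real)" using exits_events by (simp add: emeasure_eq_measure)
    have "expectation (?S1 m) \<le> expectation (\<lambda>\<omega>. (indicator (?E n m) \<omega> * ?fZ m \<omega> + indicator (exits T k) \<omega>) - ?f (V (Z 1 \<omega>)))"
    proof (rule integral_mono)
      show "integrable M (?S1 m)" using D m by simp
      show "integrable M (\<lambda>\<omega>. (indicator (?E n m) \<omega> * ?fZ m \<omega> + indicator (exits T k) \<omega>) - ?f (V (Z 1 \<omega>)))"
        using \<epsilon> by (intro Bochner_Integration.integrable_diff Bochner_Integration.integrable_add fI XI fVI) auto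
      fix \<omega> assume \<omega>: "\<omega> \<in> space M"
      from stopped_path[OF \<omega>, of m 1 T n N S ?f] obtain j where j: "j \<le> m"
        "?S1 m \<omega> = ?f (V (Z (?g j) \<omega>)) - ?f (V (Z 1 \<omega>))"
        "\<And>i. i < j \<Longrightarrow> norm (Z (?g i) \<omega>) \<le> N \<and> ell (?g i) \<omega> \<le> N \<and> Z (?g i) \<omega> \<in> S"
        "j < m \<Longrightarrow> \<not> (norm (Z (?g j) \<omega>) \<le> N \<and> ell (?g j) \<omega> \<le> N \<and> Z (?g j) \<omega> \<in> S)" by blast
      have f01: "0 \<le> ?fZ i \<omega>" "?fZ i \<omega> \<le> 1" for i using d01 \<epsilon> by (auto simp: less_imp_le)
      show "?S1 m \<omega> \<le> (indicator (?E n m) \<omega> * ?fZ m \<omega> + indicator (exits T k) \<omega>) - ?f (V (Z 1 \<omega>))"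
      proof (cases "norm (Z (?g j) \<omega>) \<le> N \<and> ell (?g j) \<omega> \<le> N \<and> Z (?g j) \<omega> \<in> S")
        case True
        then have jm: "j = m" using j(1,4) by linarith
        have "norm (Z (?g i) \<omega>) \<le> N \<and> ell (?g i) \<omega> \<le> N \<and> Z (?g i) \<omega> \<in> S" if "i \<le> m" for i
          using that True j(3)[of i] jm by (cases "i = m") auto
        then have "\<omega> \<in> ?E n m" using \<omega> by (simp add: stopped_def)
        then show ?thesis using j(2) jm by simp
      next
        case False
        have "?g j \<in> \<rat> \<inter> {1..1+real T}"
          using grid_rational[of 1 "real T" n j] grid_mem[of "real T" j n 1] j(1) m n by auto
        moreover have "V (Z (?g j) \<omega>) < 1 / Suc k \<or> norm (Z (?g j) \<omega>) > Suc k \<or> ell (?g j) \<omega> > Suc k"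
          using False unfolding N_def S_def v0_def by (simp only: mem_Collect_eq) linarith
        ultimately have "\<omega> \<in> exits T k" using \<omega> unfolding exits_def by blast
        then show ?thesis using j(2) f01[of j] f01[of m] by (simp add: add_increasing)
      qed
    qed
    also have "\<dots> = expectation (\<lambda>\<omega>. indicator (?E n m) \<omega> * ?fZ m \<omega>) + prob (exits T k) - expectation (\<lambda>\<omega>. ?f (V (Z 1 \<omega>)))"
      using \<epsilon> by (subst Bochner_Integration.integral_diff, intro Bochner_Integration.integrable_add fI XI, intro fVI)
        (auto simp: Bochner_Integration.integral_add[OF fI XI] exits_events)
    finally show ?thesis using D(3)[of m] S2_nonneg[of m] start k m by linarith
  qed
  have "expectation (?S1 n) \<le> expectation (\<lambda>\<omega>. 1)"
  proof (rule integral_mono)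
    fix \<omega> assume \<omega>: "\<omega> \<in> space M"
    from stopped_path[OF \<omega>, of n 1 T n N S ?f] obtain j where
      "?S1 n \<omega> = ?f (V (Z (?g j) \<omega>)) - ?f (V (Z 1 \<omega>))" by blast
    moreover have "?f (V (Z (?g j) \<omega>)) \<le> 1" using \<epsilon> by (intro d01) auto
    moreover have "?f (V (Z 1 \<omega>)) > 0" by (rule d01)
    ultimately show "?S1 n \<omega> \<le> 1" by linarith
  qed (use D in auto)
  moreover have "expectation (\<lambda>\<omega>. 1 :: real) = 1" by (simp add: prob_space)
  ultimately have up: "expectation (?S2 n) \<le> 1 + b / 4" using D(3)[OF order.refl] by linarith
  have "l * (T * b) / 2 = (\<Sum>i<n. T / n * (l * (b / 2)))" using n by simp
  also have "\<dots> \<le> (\<Sum>i<n. T / n * (l * expectation (\<lambda>\<omega>. indicator (?E n i) \<omega> * ?fZ i \<omega>)))"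
    using lp stay by (intro sum_mono mult_left_mono) auto
  also have "\<dots> = expectation (\<lambda>\<omega>. \<Sum>i<n. T / n * (l * (indicator (?E n i) \<omega> * ?fZ i \<omega>)))"
    using fI by (subst Bochner_Integration.integral_sum) auto
  also have "\<dots> \<le> expectation (?S2 n)"
    by (rule integral_mono) (use fI D gen_ge in \<open>auto intro!: sum_mono\<close>)
  finally show False using up lTb b1 by linarith
qed

end

section \<open>Assembly: the inverse of \<open>RC\<close>, the Rayleigh quotients and the SRBM
  definition\<close>

lemma reflection_data_matrix_inv:
  fixes R A :: "real^'n^'n"
  assumes A: "sym_pos_def A" and R: "refl_nonsing_M_matrix R" and c: "\<forall>i. c $ i > 0"
    and sym: "transpose (R ** diag_mat c) = R ** diag_mat c"
  shows "reflection_data A (matrix_inv (R ** diag_mat c)) R c"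
proof
  define S where "S = R ** diag_mat c"
  have pd: "x \<bullet> (S *v x) > 0" if "x \<noteq> 0" for x
    unfolding S_def using M_matrix_pos_def[OF R c sym that] .
  note inv = pos_def_inverse[OF sym[folded S_def] pd]
  show "sym_pos_def A" by (rule A)
  show "sym_pos_def (matrix_inv (R ** diag_mat c))" using inv(3) by (simp add: S_def)
  show "c $ k > 0" for k using c by simp
  fix l :: "real^'n"
  define x where "x = (\<chi> k. l $ k / c $ k)"
  have "c $ i \<noteq> 0" for i using c by (metis less_irrefl)
  then have "diag_mat c *v x = l" by (simp add: diag_mat_mult_vec x_def vec_eq_iff)
  then have "R *v l = S *v x" by (simp add: S_def flip: matrix_vector_mul_assoc)
  then have "matrix_inv S *v (R *v l) = x" by (simp add: matrix_vector_mul_assoc inv(2))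
  then show "matrix_inv (R ** diag_mat c) *v (R *v l) = (\<chi> k. l $ k / c $ k)"
    by (simp add: S_def x_def)
qed

context reflection_data
begin

lemma rq_eq: "x \<bullet> ((Om ** A ** Om) *v x) / (x \<bullet> (Om *v x)) = Q x / V x"
proof -
  have "(Om ** A ** Om) *v x = Om *v (A *v (Om *v x))" by (simp add: matrix_vector_mul_assoc matrix_mul_assoc)
  then show ?thesis using Om_swap[of x "A *v (Om *v x)"] by (simp add: Q_def V_def inner_commute)
qed

lemma V_pos: "x \<noteq> 0 \<Longrightarrow> V x > 0"
  using V_nonneg[of x] V_eq_0_iff[of x] by linarith

text \<open>On the reals \<open>Sup\<close> and \<open>Inf\<close> bound a set only once it is known
  to be bounded.\<close>

lemma rq_bdd: "bdd_above (rq_set Om A)" "bdd_below (rq_set Om A)"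
proof -
  obtain l where l: "l > 0" "\<And>x. l * (norm x)\<^sup>2 \<le> V x"
    using pos_def_coercive[of Om] Om_spd unfolding sym_pos_def_def V_def by metis
  obtain K1 where K1: "K1 > 0" "\<And>x. norm (Om *v x) \<le> K1 * norm x" by (rule matrix_norm_bound) blast
  obtain K2 where K2: "K2 > 0" "\<And>x. norm (A *v x) \<le> K2 * norm x" by (rule matrix_norm_bound) blast
  have "Q x / V x \<le> K1 * K2 * K1 / l" if "x \<noteq> 0" for x
  proof -
    have "Q x \<le> norm (Om *v x) * norm (A *v (Om *v x))" unfolding Q_def by (rule norm_cauchy_schwarz)
    also have "\<dots> \<le> norm (Om *v x) * (K2 * norm (Om *v x))" by (intro mult_left_mono K2) auto
    also have "\<dots> \<le> (K1 * norm x) * (K2 * (K1 * norm x))"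
      using K1 K2 by (intro mult_mono mult_left_mono) auto
    also have "\<dots> = K1 * K2 * K1 / l * (l * (norm x)\<^sup>2)" using l by (simp add: power2_eq_square)
    also have "\<dots> \<le> K1 * K2 * K1 / l * V x" using K1 K2 l by (intro mult_left_mono) auto
    finally show ?thesis using V_pos[OF that] by (simp add: pos_divide_le_eq)
  qed
  then show "bdd_above (rq_set Om A)" unfolding rq_set_def rq_eq
    by (intro bdd_aboveI[of _ "K1 * K2 * K1 / l"]) auto
  show "bdd_below (rq_set Om A)" unfolding rq_set_def rq_eq
    by (intro bdd_belowI[of _ 0]) (auto simp: Q_nonneg)
qed

lemma rq_bounds:
  assumes "z \<in> orthant"
  shows "Q z \<le> c_plus Om A * V z" "c_minus Om A * V z \<le> Q z"
proof -
  have "Q z \<le> c_plus Om A * V z \<and> c_minus Om A * V z \<le> Q z"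
  proof (cases "z = 0")
    case False
    then have mem: "Q z / V z \<in> rq_set Om A" unfolding rq_set_def rq_eq using assms by auto
    have "Q z / V z \<le> c_plus Om A" unfolding c_plus_def by (rule cSup_upper[OF mem rq_bdd(1)])
    moreover have "c_minus Om A \<le> Q z / V z" unfolding c_minus_def by (rule cInf_lower[OF mem rq_bdd(2)])
    ultimately show ?thesis using V_pos[OF False] by (simp add: pos_divide_le_eq pos_le_divide_eq)
  qed simp
  then show "Q z \<le> c_plus Om A * V z" "c_minus Om A * V z \<le> Q z" by auto
qed

text \<open>Turns the hypothesis of the first case into strict positivity of the trace; the all-ones
  vector is a test point of the orthant.\<close>

lemma c_plus_pos: "c_plus Om A > 0"
proof -
  define x :: "real^'n" where "x = (\<chi> i. 1)"
  have x: "x \<in> orthant" "x \<noteq> 0" by (auto simp: x_def orthant_def vec_eq_iff)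
  have "Om *v x \<noteq> 0" using V_pos[OF x(2)] by (auto simp: V_def)
  then have "Q x > 0" using A_spd unfolding Q_def sym_pos_def_def by blast
  then have "0 < c_plus Om A * V x" using rq_bounds(1)[OF x(1)] by linarith
  then show ?thesis using V_pos[OF x(2)] by (simp add: zero_less_mult_iff)
qed

end

lemma face_UNIV: "z \<in> face UNIV \<longleftrightarrow> z = 0"
  by (auto simp: face_def orthant_def vec_eq_iff)

lemma is_SRBM_reflected:
  assumes "reflection_data A Om R c" and "is_SRBM M F R mu A z Z"
  obtains B L where "reflected A Om R mu c M F z B Z L"
proof -
  interpret reflection_data A Om R mu c by fact
  from assms(2) have fps: "prob_space M" "filtration (space M) F" "\<And>t. sets (F t) \<subseteq> sets M"
    and Z: "adapted_cont F (space M) Z" "\<And>t \<omega>. t \<ge> 0 \<Longrightarrow> \<omega> \<in> space M \<Longrightarrow> Z t \<omega> \<in> orthant"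
    unfolding is_SRBM_def filtered_prob_space_def by auto
  from assms(2) obtain B L where BL: "brownian_motion M F mu A z B" "adapted_cont F (space M) L"
      "\<And>t \<omega>. t \<ge> 0 \<Longrightarrow> \<omega> \<in> space M \<Longrightarrow> Z t \<omega> = B t \<omega> + R *v L t \<omega>"
      "\<And>\<omega> k. \<omega> \<in> space M \<Longrightarrow> L 0 \<omega> $ k = 0"
      "\<And>\<omega> k s t. \<omega> \<in> space M \<Longrightarrow> 0 \<le> s \<Longrightarrow> s \<le> t \<Longrightarrow> L s \<omega> $ k \<le> L t \<omega> $ k"
      "\<And>\<omega> k. \<omega> \<in> space M \<Longrightarrow> (\<integral>\<^sup>+ t. ennreal (indicator {0..} t * Z t \<omega> $ k)
              \<partial>interval_measure (\<lambda>t. L (max t 0) \<omega> $ k)) = 0"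
    unfolding is_SRBM_def by blast
  interpret prob_space M by fact
  have "reflected A Om R mu c M F z B Z L"
    by (intro reflected.intro brownian.intro brownian_axioms.intro reflected_axioms.intro;
        fact assms(1) prob_space_axioms fps Z BL A_spd)
  then show ?thesis by (rule that)
qed

theorem theorem3p4:
  fixes R A :: "real^'n^'n" and mu c :: "real^'n"
  assumes "sym_pos_def A"
    and "refl_nonsing_M_matrix R"
    and "\<forall>i. c $ i > 0"
    and "transpose (R ** diag_mat c) = R ** diag_mat c"
  shows "(trace (matrix_inv (R ** diag_mat c) ** A)
            \<ge> 2 * c_plus (matrix_inv (R ** diag_mat c)) A
          \<longrightarrow> SRBM_avoids TYPE('a) R mu A (face UNIV))
       \<and> (0 \<le> trace (matrix_inv (R ** diag_mat c) ** A) \<and>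
          trace (matrix_inv (R ** diag_mat c) ** A)
            < 2 * c_minus (matrix_inv (R ** diag_mat c)) A
          \<longrightarrow> SRBM_hits TYPE('a) R mu A (face UNIV))"
proof -
  define Om where "Om = matrix_inv (R ** diag_mat c)"
  have rd: "reflection_data A Om R c"
    unfolding Om_def by (rule reflection_data_matrix_inv[OF assms])
  interpret reflection_data A Om R mu c by (rule rd)
  have "SRBM_avoids TYPE('a) R mu A (face UNIV)" if tr: "trace (Om ** A) \<ge> 2 * c_plus Om A"
    unfolding SRBM_avoids_def face_UNIV
  proof (intro ballI allI impI)
    fix z and M :: "'a measure" and F Z
    assume "is_SRBM M F R mu A z Z"
    from is_SRBM_reflected[OF rd this] obtain B L where refl: "reflected A Om R mu c M F z B Z L" .
    have "supercritical A Om R mu c M F z B Z L"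
    proof (intro supercritical.intro supercritical_axioms.intro refl)
      show "trace (Om ** A) > 0" using tr c_plus_pos by linarith
      fix x :: "real^'n" assume x: "x \<in> orthant"
      have "2 * c_plus Om A * V x \<le> trace (Om ** A) * V x" using tr by (intro mult_right_mono) auto
      then show "2 * Q x \<le> trace (Om ** A) * V x" using rq_bounds(1)[OF x] by linarith
    qed
    then show "AE \<omega> in M. \<forall>t>0. Z t \<omega> \<noteq> 0" by (rule supercritical.avoids_origin)
  qed
  moreover have "SRBM_hits TYPE('a) R mu A (face UNIV)"
    if tr: "0 \<le> trace (Om ** A)" "trace (Om ** A) < 2 * c_minus Om A"
    unfolding SRBM_hits_def face_UNIV
  proof (intro ballI allI impI)
    fix z and M :: "'a measure" and F Z
    assume "is_SRBM M F R mu A z Z"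
    from is_SRBM_reflected[OF rd this] obtain B L where refl: "reflected A Om R mu c M F z B Z L" .
    have "subcritical A Om R mu c M F z B Z L (c_minus Om A)"
      using refl tr rq_bounds(2) by (intro subcritical.intro subcritical_axioms.intro)
    then show "\<not> (AE \<omega> in M. \<forall>t>0. Z t \<omega> \<noteq> 0)" by (rule subcritical.hits_origin)
  qed
  ultimately show ?thesis unfolding Om_def by blast
qed

end
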